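(* Consider the restricted program $$\min\ \psi(\mathbf p)\quad\text{subject to}\quad l_j\le E_{\mathbf p}[I(h(\mathbf X)\le y_j)]\le u_j,\ j=1,\dots,n,\quad \mathbf p\in\mathcal P(\epsilon), \tag{R}$$ and, for $\lambda>0$, the penalized program $$\min\ \lambda\psi(\mathbf p)+W(\mathbf p)\quad\text{subject to}\quad \mathbf p\in\mathcal P(\epsilon). \tag{Pen}$$ Assume: (1) Program (R) has a unique optimal solution $\mathbf p^*_\epsilon\in\mathcal P(\epsilon)$ such that $\bm\Psi(\mathbf p)'(\mathbf p-\mathbf p^*_\epsilon)>0$ for every $\mathbf p\in\mathcal P(\epsilon)$ feasible for (R) with $\mathbf p\ne\mathbf p^*_\epsilon$, and $\bm\phi(\mathbf p)'(\mathbf p-\mathbf p^*_\epsilon)>0$ for every $\mathbf p\in\mathcal P(\epsilon)$ infeasible for (R). (2) There is $\lambda_\epsilon>0$ such that: (i) for every $\lambda\in(0,\lambda_\epsilon]$, (Pen) has a unique optimal solution $\mathbf p^*_\epsilon(\lambda)\in\mathcal P(\epsilon)$, and $(\lambda\bm\Psi(\mathbf p)+\bm\phi(\mathbf p))'(\mathbf p-\mathbf p^*_\epsilon(\lambda))\ge 0$ for every $\mathbf p\in\mathcal P(\epsilon)$; (ii) there is a constant $M_\epsilon>0$ such that $\sum_{i=0}^{K-1}\|\mathbf p^*_\epsilon(\lambda_i)-\mathbf p^*_\epsilon(\lambda_{i+1})\|\le M_\epsilon$ for all $K$ and all $0<\lambda_K<\dots<\lambda_1<\lambda_0\le\lambda_\epsilon$.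 (3) $\|\mathbf p^*_\epsilon(\lambda)-\mathbf p^*_\epsilon\|=O(\lambda)$ as $\lambda\to0$. Let the step sizes $\gamma^k,\beta^k$ and the penalty sequence $\lambda^k$ of the stochastic algorithm described in the context be, for constants $a,b,c>0$, $$\gamma^k=\frac{a}{k^{\alpha_1}},\ \tfrac34<\alpha_1\le 1;\qquad \beta^k=\frac{b}{k^{\alpha_2}},\ 2-2\alpha_1<\alpha_2<2\alpha_1-1;$$ $$\lambda^k=\frac{c}{k^{\alpha_3}},\ 0<\alpha_3\le 1-\alpha_1,\ \text{ if }\tfrac34<\alpha_1<1;\qquad \lambda^k=\frac{c}{\log k}\ \text{ if }\alpha_1=1 .$$ Then the iterates $\mathbf p^k$ generated by the algorithm converge to $\mathbf p^*_\epsilon$ almost surely.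
   Context: Fixed data: distinct support points $z_1,\dots,z_m$ in a space $\mathcal X$; functions $h:\mathcal X^T\to\mathbb R$ and $g:\mathcal X^S\to\mathbb R$ with finite horizons $T,S$; real numbers $y_1,\dots,y_n$; the empirical distribution function $\hat F_Y$ of $y_1,\dots,y_n$; a constant $q_{1-\alpha}>0$. Put $l_j=\hat F_Y(y_j+)-q_{1-\alpha}/\sqrt n$ and $u_j=\hat F_Y(y_j-)+q_{1-\alpha}/\sqrt n$ (right/left limits), assumed to satisfy $l_j\le u_j$, and let $\Pi_j$ be the projection of $\mathbb R$ onto $[l_j,u_j]$. $\mathcal P=\{\mathbf p\in\mathbb R^m:\sum_i p_i=1,\ p_i\ge0\}$ and $\mathcal P(\epsilon)=\{\mathbf p\in\mathcal P: p_i\ge\epsilon\ \forall i\}$ with $0<\epsilon<1/m$. The vector $\mathbf p$ is identified with the distribution giving mass $p_i$ to $z_i$; $E_{\mathbf p}$ is expectation when the input process $\mathbf X$ (of length $T$ for $h$, $S$ for $g$) is i.i.d. from $\mathbf p$. $\psi(\mathbf p)=E_{\mathbf p}[g(\mathbf X)]$ and $W(\mathbf p)=\sum_{j=1}^n\big(E_{\mathbf p}[I(h(\mathbf X)\le y_j)]-\Pi_j(E_{\mathbf p}[I(h(\mathbf X)\le y_j)])\big)^2$. Gateaux derivatives: $\bm\Psi(\mathbf p)=(\Psi_i(\mathbf p))_{i=1}^m$, $\bm\phi(\mathbf p)=(\phi_i(\mathbf p))_{i=1}^m$ with $\Psi_i(\mathbf p)=\frac{d}{d\delta}\psi((1-\delta)\mathbf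 p+\delta\mathbf 1_i)|_{\delta=0^+}$ and $\phi_i(\mathbf p)=\frac{d}{d\delta}W((1-\delta)\mathbf p+\delta\mathbf 1_i)|_{\delta=0^+}$, where $\mathbf 1_i$ is the $i$-th unit vector. $\|\cdot\|$ is a norm on $\mathbb R^m$; prime denotes transpose. Score: $S_i(\mathbf x;\mathbf p)=\sum_{t}\frac{I(x_t=z_i)}{p_i}-(\text{length of }\mathbf x)$, the sum over all coordinates of $\mathbf x$. $V(\mathbf p,\mathbf q)=\sum_{i=1}^m q_i\log(q_i/p_i)$. Algorithm: choose fixed positive integers $M_1,M_2,M_3$ and initial $\mathbf p^1\in\mathcal P(\epsilon)$, $\mathbf s^1\in\prod_{j=1}^n[l_j,u_j]$. For each $k$, given $\mathbf p^k,\mathbf s^k$, generate (independently of the past given $\mathbf p^k,\mathbf s^k$) independent input processes under $\mathbf p^k$: $\mathbf X^{(r)}$, $r\le M_1$; $\tilde{\mathbf X}^{(r)}$, $r\le M_2$; $\tilde{\tilde{\mathbf X}}^{(r)}$, $r\le M_3$. Compute $$\hat\phi_{\mathbf p,i}^k=2\sum_{j=1}^n\frac1{M_1}\sum_{r=1}^{M_1}(I(h(\mathbf X^{(r)})\le y_j)-s_j^k)\cdot\frac1{M_2}\sum_{r=1}^{M_2}I(h(\tilde{\mathbf X}^{(r)})\le y_j)S_i(\tilde{\mathbf X}^{(r)};\mathbf p^k),$$ $$\hat\Psi_i^k=\frac1{M_3}\sum_{r=1}^{M_3}g(\tilde{\tilde{\mathbf X}}^{(r)})S_i(\tilde{\tilde{\mathbf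 X}}^{(r)};\mathbf p^k),$$ $$\hat\phi_{\mathbf s,j}^k=-\frac{2}{M_1+M_2}\Big(\sum_{r=1}^{M_1}(I(h(\mathbf X^{(r)})\le y_j)-s_j^k)+\sum_{r=1}^{M_2}(I(h(\tilde{\mathbf X}^{(r)})\le y_j)-s_j^k)\Big).$$ Then $\mathbf p^{k+1}$ is the unique minimizer over $\mathbf q\in\mathcal P(\epsilon)$ of $\sum_{i=1}^m\gamma^k(\lambda^k\hat\Psi_i^k+\hat\phi_{\mathbf p,i}^k)(q_i-p_i^k)+V(\mathbf p^k,\mathbf q)$, and $s_j^{k+1}=\Pi_j(s_j^k-\beta^k\hat\phi_{\mathbf s,j}^k)$, $j=1,\dots,n$. When $\lambda^k=c/\log k$, the value $\lambda^1$ is an arbitrary positive number. *)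

theory Defs
  imports "HOL-Probability.Probability" "HOL-Library.Landau_Symbols"
begin

definition is_norm :: "('a::real_vector \<Rightarrow> real) \<Rightarrow> bool" where
  "is_norm N \<longleftrightarrow>
     (\<forall>x. 0 \<le> N x) \<and> (\<forall>x. N x = 0 \<longleftrightarrow> x = 0) \<and>
     (\<forall>c x. N (c *\<^sub>R x) = \<bar>c\<bar> * N x) \<and> (\<forall>x y. N (x + y) \<le> N x + N y)"

definition unique_min_on :: "('a \<Rightarrow> real) \<Rightarrow> 'a set \<Rightarrow> 'a \<Rightarrow> bool" where
  "unique_min_on f A x \<longleftrightarrow>
     is_arg_min f (\<lambda>y. y \<in> A) x \<and> (\<forall>y. is_arg_min f (\<lambda>y. y \<in> A) y \<longrightarrow> y = x)"

definition prob_simplex :: "(real ^ 'm::finite) set" where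
  "prob_simplex = {p. (\<Sum>i\<in>UNIV. p $ i) = 1 \<and> (\<forall>i. 0 \<le> p $ i)}"

definition prob_simplex_ge :: "real \<Rightarrow> (real ^ 'm::finite) set" where
  "prob_simplex_ge \<epsilon> = {p \<in> prob_simplex. \<forall>i. \<epsilon> \<le> p $ i}"

text \<open>Mass \<open>p $ i\<close> at the support point \<open>z i\<close>. Because of \<^const>\<open>embed_pmf\<close> this, and
  everything built on it, is meaningful only for \<open>p\<close> in \<^const>\<open>prob_simplex\<close>.\<close>

definition input_pmf :: "('m::finite \<Rightarrow> 'x) \<Rightarrow> real ^ 'm \<Rightarrow> 'x pmf" where
  "input_pmf z p = map_pmf z (embed_pmf (\<lambda>i. p $ i))"

text \<open>An input process of length \<open>CARD('t)\<close> is an element of \<open>'t \<Rightarrow> 'x\<close>. The default value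
  \<^const>\<open>undefined\<close> is never used, as the product ranges over all of \<open>'t\<close>.\<close>

definition process_pmf :: "('m::finite \<Rightarrow> 'x) \<Rightarrow> real ^ 'm \<Rightarrow> ('t::finite \<Rightarrow> 'x) pmf" where
  "process_pmf z p = Pi_pmf UNIV undefined (\<lambda>_. input_pmf z p)"

definition process_exp ::
    "('m::finite \<Rightarrow> 'x) \<Rightarrow> real ^ 'm \<Rightarrow> (('t::finite \<Rightarrow> 'x) \<Rightarrow> real) \<Rightarrow> real" where
  "process_exp z p f = measure_pmf.expectation (process_pmf z p) f"

definition ecdf :: "real ^ 'n::finite \<Rightarrow> real \<Rightarrow> real" where
  "ecdf y x = real (card {j. y $ j \<le> x}) / real CARD('n)"

definition lower_bd :: "real ^ 'n::finite \<Rightarrow> real \<Rightarrow> 'n \<Rightarrow> real" where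
  "lower_bd y q j = Lim (at_right (y $ j)) (ecdf y) - q / sqrt (real CARD('n))"

definition upper_bd :: "real ^ 'n::finite \<Rightarrow> real \<Rightarrow> 'n \<Rightarrow> real" where
  "upper_bd y q j = Lim (at_left (y $ j)) (ecdf y) + q / sqrt (real CARD('n))"

definition band_proj :: "real ^ 'n::finite \<Rightarrow> real \<Rightarrow> 'n \<Rightarrow> real \<Rightarrow> real" where
  "band_proj y q j x = closest_point {lower_bd y q j .. upper_bd y q j} x"

definition output_cdf ::
    "('m::finite \<Rightarrow> 'x) \<Rightarrow> (('t::finite \<Rightarrow> 'x) \<Rightarrow> real) \<Rightarrow> real ^ 'n::finite \<Rightarrow> real ^ 'm \<Rightarrow> 'n \<Rightarrow> real" where
  "output_cdf z h y p j = process_exp z p (\<lambda>x. of_bool (h x \<le> y $ j))"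

definition psi :: "('m::finite \<Rightarrow> 'x) \<Rightarrow> (('s::finite \<Rightarrow> 'x) \<Rightarrow> real) \<Rightarrow> real ^ 'm \<Rightarrow> real" where
  "psi z g p = process_exp z p g"

definition penalty ::
    "('m::finite \<Rightarrow> 'x) \<Rightarrow> (('t::finite \<Rightarrow> 'x) \<Rightarrow> real) \<Rightarrow> real ^ 'n::finite \<Rightarrow> real \<Rightarrow> real ^ 'm \<Rightarrow> real" where
  "penalty z h y q p =
     (\<Sum>j\<in>UNIV. (output_cdf z h y p j - band_proj y q j (output_cdf z h y p j))\<^sup>2)"

definition feasible_set ::
    "('m::finite \<Rightarrow> 'x) \<Rightarrow> (('t::finite \<Rightarrow> 'x) \<Rightarrow> real) \<Rightarrow> real ^ 'n::finite \<Rightarrow> real \<Rightarrow> real \<Rightarrow> (real ^ 'm) set" where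
  "feasible_set z h y q \<epsilon> =
     {p \<in> prob_simplex_ge \<epsilon>. \<forall>j. lower_bd y q j \<le> output_cdf z h y p j \<and>
                                   output_cdf z h y p j \<le> upper_bd y q j}"

definition gateaux :: "(real ^ 'm \<Rightarrow> real) \<Rightarrow> real ^ 'm::finite \<Rightarrow> real ^ 'm" where
  "gateaux F p =
     (\<chi> i. vector_derivative (\<lambda>\<delta>. F ((1 - \<delta>) *\<^sub>R p + \<delta> *\<^sub>R axis i 1)) (at_right 0))"

definition score :: "('m::finite \<Rightarrow> 'x) \<Rightarrow> 'm \<Rightarrow> ('t::finite \<Rightarrow> 'x) \<Rightarrow> real ^ 'm \<Rightarrow> real" where
  "score z i x p = (\<Sum>t\<in>UNIV. of_bool (x t = z i) / p $ i) - real CARD('t)"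

definition kl :: "real ^ 'm::finite \<Rightarrow> real ^ 'm \<Rightarrow> real" where
  "kl p q = (\<Sum>i\<in>UNIV. q $ i * ln (q $ i / p $ i))"

text \<open>In the estimators, \<open>X\<close>, \<open>X'\<close>, \<open>X''\<close> are the three independent batches of input processes
  of one iteration; the samples are \<open>X r\<close> with \<open>r < M1\<close>, and so on.\<close>

definition phi_p_hat ::
    "('m::finite \<Rightarrow> 'x) \<Rightarrow> (('t::finite \<Rightarrow> 'x) \<Rightarrow> real) \<Rightarrow> real ^ 'n::finite \<Rightarrow> nat \<Rightarrow> nat \<Rightarrow>
     real ^ 'm \<Rightarrow> real ^ 'n \<Rightarrow> (nat \<Rightarrow> 't \<Rightarrow> 'x) \<Rightarrow> (nat \<Rightarrow> 't \<Rightarrow> 'x) \<Rightarrow> real ^ 'm" where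
  "phi_p_hat z h y M1 M2 p s X X' = (\<chi> i. 2 * (\<Sum>j\<in>UNIV.
     (1 / real M1 * (\<Sum>r<M1. (of_bool (h (X r) \<le> y $ j) - s $ j))) *
     (1 / real M2 * (\<Sum>r<M2. of_bool (h (X' r) \<le> y $ j) * score z i (X' r) p))))"

definition Psi_hat ::
    "('m::finite \<Rightarrow> 'x) \<Rightarrow> (('s::finite \<Rightarrow> 'x) \<Rightarrow> real) \<Rightarrow> nat \<Rightarrow>
     real ^ 'm \<Rightarrow> (nat \<Rightarrow> 's \<Rightarrow> 'x) \<Rightarrow> real ^ 'm" where
  "Psi_hat z g M3 p X'' = (\<chi> i. 1 / real M3 * (\<Sum>r<M3. g (X'' r) * score z i (X'' r) p))"

definition phi_s_hat ::
    "(('t::finite \<Rightarrow> 'x) \<Rightarrow> real) \<Rightarrow> real ^ 'n::finite \<Rightarrow> nat \<Rightarrow> nat \<Rightarrow>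
     real ^ 'n \<Rightarrow> (nat \<Rightarrow> 't \<Rightarrow> 'x) \<Rightarrow> (nat \<Rightarrow> 't \<Rightarrow> 'x) \<Rightarrow> real ^ 'n" where
  "phi_s_hat h y M1 M2 s X X' = (\<chi> j. - (2 / (real M1 + real M2)) *
     ((\<Sum>r<M1. (of_bool (h (X r) \<le> y $ j) - s $ j)) + (\<Sum>r<M2. (of_bool (h (X' r) \<le> y $ j) - s $ j))))"

definition mirror_objective ::
    "real \<Rightarrow> real ^ 'm::finite \<Rightarrow> real ^ 'm \<Rightarrow> real ^ 'm \<Rightarrow> real" where
  "mirror_objective \<gamma> d p q = (\<Sum>i\<in>UNIV. \<gamma> * d $ i * (q $ i - p $ i)) + kl p q"

end

theory Submission
  imports Defs "HOL-Real_Asymp.Real_Asymp"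
begin

text \<open>
  The argument is a Lyapunov argument for the relative entropy \<open>v k = V(p k, u k)\<close> to the penalized
  optimum \<open>u k = p_pen (lam k)\<close>. The three-point inequality of the entropic mirror step gives
  \<open>v (Suc k) \<le> v k - \<gamma> k * gap k - noise k + rest k\<close>, where \<open>gap k\<close> is the inner product of the exact
  gradient \<open>lam k *\<^sub>R gateaux (psi z g) + gateaux (penalty z h y q)\<close> at \<open>p k\<close> with \<open>p k - u k\<close>, which is
  nonnegative by assumption. The noise is a martingale difference of order \<open>\<gamma> k\<close>, hence summable
  almost surely. The rest consists of \<open>(\<gamma> k)\<^sup>2\<close>, of the drift of \<open>u k\<close>, which is summable by the
  bounded variation assumption, and of \<open>\<gamma> k\<close> times the distance of \<open>s k\<close> to the projected output
  distribution of \<open>p k\<close>; the latter follows a contraction on the faster time scale \<open>\<beta> k\<close>, and is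
  summable in expectation. So \<open>v\<close> converges and \<open>\<gamma> k * gap k\<close> is summable. Since \<open>\<gamma> k * lam k\<close> is not,
  \<open>gap k / lam k\<close> tends to \<open>0\<close> along a subsequence; a limit point along it must be feasible, because the
  penalty gradient vanishes there, and then optimal. Hence the limit of \<open>v\<close> is \<open>0\<close>.
\<close>

section \<open>Entropic mirror steps on the simplex\<close>

text \<open>The obstacle is that the penalty gradient is nonlinear in the output distribution: it
  contains \<open>band_proj y q j (output_cdf z h y p j)\<close>, and inserting sample averages
  there gives a biased estimate in general. With a fixed number in place of the projection, each
  summand is a product of two means, which two independent batches estimate without bias. So
  \<open>s k\<close> stands in for the projection, at the price of a bias of order
  \<open>\<gamma> k\<close> times the tracking error. The mean square of that error contracts at
  rate \<open>\<beta> k\<close> under a forcing of order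
  \<open>(\<beta> k)\<^sup>2 + (\<gamma> k)\<^sup>2 / \<beta> k\<close>; making the bias summable is
  where the window for \<alpha>2 comes from. The lower bound \<epsilon> on the masses keeps the
  scores bounded and makes the relative entropy Lipschitz in its second argument, so that the
  reference point may move with \<open>lam k\<close>. Since almost surely the samples of one
  iteration take values in a finite set that does not depend on \<open>p k\<close>, the conditional
  probabilities of single outcomes determine every mean that occurs.\<close>

text \<open>The variation and rate assumptions on the penalized optima use an arbitrary norm, while
  the analysis is Euclidean; this carries them over. The constant is the reciprocal of the minimum
  of \<open>N\<close> on the compact unit sphere.\<close>

lemma is_norm_norm_le:
  fixes N :: "'a::euclidean_space \<Rightarrow> real"
  assumes "is_norm N"
  obtains C where "0 < C" "\<And>x. norm x \<le> C * N x"
proof -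
  have pos: "\<And>x. 0 \<le> N x" and zero: "\<And>x. N x = 0 \<longleftrightarrow> x = 0"
    and scale: "\<And>c x. N (c *\<^sub>R x) = \<bar>c\<bar> * N x" and tri: "\<And>x y. N (x + y) \<le> N x + N y"
    using assms by (auto simp: is_norm_def)
  have sum_le: "N (\<Sum>i\<in>I. f i) \<le> (\<Sum>i\<in>I. N (f i))" if "finite I" for I and f :: "'a \<Rightarrow> 'a"
    using that
  proof (induction I)
    case empty then show ?case using zero[of 0] by simp
  next
    case (insert i I)
    then show ?case using tri[of "f i" "sum f I"] by simp
  qed
  \<comment> \<open>Expanding in the basis bounds \<open>N\<close> by \<open>B\<close> times the
    Euclidean norm, so \<open>N\<close> is Lipschitz and attains its minimum on the sphere.\<close>
  define B where "B = (\<Sum>b\<in>Basis. N b :: real)"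
  have B: "N x \<le> B * norm x" for x :: 'a
  proof -
    have "N x = N (\<Sum>b\<in>Basis. (x \<bullet> b) *\<^sub>R b)" by (simp add: euclidean_representation)
    also have "\<dots> \<le> (\<Sum>b\<in>Basis. N ((x \<bullet> b) *\<^sub>R b))" by (rule sum_le) simp
    also have "\<dots> \<le> (\<Sum>b\<in>Basis. norm x * N b)"
      by (intro sum_mono) (auto simp: scale intro!: mult_right_mono pos Basis_le_norm)
    finally show ?thesis by (simp add: B_def sum_distrib_left mult.commute)
  qed
  have lip: "\<bar>N x - N y\<bar> \<le> B * norm (x - y)" for x y
  proof -
    have "N (y - x) = N (x - y)" using scale[of "-1" "x - y"] by simp
    then show ?thesis using tri[of "x - y" y] tri[of "y - x" x] B[of "x - y"] by auto
  qed
  have B0: "0 \<le> B" unfolding B_def by (intro sum_nonneg pos)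
  have "B-lipschitz_on (sphere 0 1) N"
    by (rule lipschitz_onI) (use lip B0 in \<open>auto simp: dist_norm\<close>)
  then have cont: "continuous_on (sphere 0 1) N" by (rule lipschitz_on_continuous_on)
  obtain b :: 'a where "b \<in> Basis" using nonempty_Basis by blast
  then have ne: "sphere (0::'a) 1 \<noteq> {}" by (intro ex_in_conv[THEN iffD1] exI[of _ b]) simp
  obtain x0 where x0: "x0 \<in> sphere 0 1" "\<And>x. x \<in> sphere 0 1 \<Longrightarrow> N x0 \<le> N x"
    using continuous_attains_inf[OF compact_sphere ne cont] by blast
  have m: "0 < N x0" using x0(1) pos[of x0] zero[of x0] by (auto simp: order.order_iff_strict)
  have "norm x \<le> (1 / N x0) * N x" for x
  proof (cases "x = 0")
    case True then show ?thesis using pos m by simp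
  next
    case False
    then have "N x0 \<le> N ((1 / norm x) *\<^sub>R x)" by (intro x0(2)) simp
    also have "\<dots> = N x / norm x" by (simp add: scale)
    finally show ?thesis using False m by (simp add: field_simps)
  qed
  with m that[of "1 / N x0"] show ?thesis by simp
qed

text \<open>As a function of \<open>b\<close>, the left side has value and slope 0 at
  \<open>a\<close> and second derivative \<open>1 / b\<close>, which is at least 1 on the unit
  interval. The proof compares first derivatives instead, through
  \<open>ln x \<le> x - 1\<close>.\<close>

lemma ln_div_ge:
  fixes a b :: real
  assumes "0 < a" "a \<le> 1" "0 < b" "b \<le> 1"
  shows "b * ln (b / a) - b + a \<ge> (b - a)\<^sup>2 / 2"
proof -
  define f where "f = (\<lambda>x. x * ln (x / a) - x + a - (x - a)\<^sup>2 / 2)"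
  have der: "(f has_real_derivative (ln (x / a) - (x - a))) (at x)" if "0 < x" for x
    unfolding f_def by (rule derivative_eq_intros refl | use that assms in \<open>simp add: field_simps power2_eq_square\<close>)+
  have fa: "f a = 0" using assms by (simp add: f_def)
  have "0 \<le> f b"
  proof (cases "a \<le> b")
    case True
    have "f a \<le> f b"
    proof (rule DERIV_nonneg_imp_nondecreasing[OF True])
      fix x assume x: "a \<le> x" "x \<le> b"
      have "ln (a / x) \<le> a / x - 1" using x assms by (intro ln_le_minus_one) auto
      then have "ln (x / a) \<ge> (x - a) / x" using x assms by (simp add: ln_div field_simps)
      moreover have "(x - a) / x \<ge> x - a" using x assms
        mult_left_le[of x "x - a"] by (simp add: pos_le_divide_eq)
      ultimately show "\<exists>y. DERIV f x :> y \<and> 0 \<le> y" using der[of x] x assms by auto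
    qed
    then show ?thesis using fa by simp
  next
    case False
    have "f b \<ge> f a"
    proof (rule DERIV_nonpos_imp_nonincreasing[of b a])
      show "b \<le> a" using False by simp
      fix x assume x: "b \<le> x" "x \<le> a"
      have "ln (x / a) \<le> x / a - 1" using x assms by (intro ln_le_minus_one) auto
      moreover have "x / a - 1 = (x - a) / a" using assms by (simp add: field_simps)
      moreover have "(a - x) / a \<ge> a - x" using x assms mult_left_le[of a "a - x"] 
        by (simp add: field_simps)
      then have "(x - a) / a \<le> x - a" using assms by (simp add: field_simps)
      ultimately show "\<exists>y. DERIV f x :> y \<and> y \<le> 0" using der[of x] x assms by (intro exI conjI) auto
    qed
    then show ?thesis using fa by simp
  qed
  then show ?thesis by (simp add: f_def)
qed

text \<open>A Pinsker inequality in the Euclidean norm. Adding \<open>p $ i - r $ i\<close> to each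
  summand makes it nonnegative and leaves the sum unchanged, both vectors having mass 1.\<close>

lemma kl_ge:
  fixes p r :: "real ^ 'm::finite"
  assumes "p \<in> prob_simplex" "r \<in> prob_simplex" "\<And>i. 0 < p $ i" "\<And>i. 0 < r $ i"
  shows "kl p r \<ge> (norm (r - p))\<^sup>2 / 2"
proof -
  have le1: "v $ i \<le> 1" if "v \<in> prob_simplex" for v :: "real ^ 'm" and i
    using that member_le_sum[of i UNIV "\<lambda>i. v $ i"] by (auto simp: prob_simplex_def)
  have "(norm (r - p))\<^sup>2 / 2 = (\<Sum>i\<in>UNIV. (r $ i - p $ i)\<^sup>2 / 2)"
    by (simp add: norm_vec_def L2_set_def sum_nonneg sum_divide_distrib)
  also have "\<dots> \<le> (\<Sum>i\<in>UNIV. r $ i * ln (r $ i / p $ i) - r $ i + p $ i)"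
    by (intro sum_mono ln_div_ge assms le1)
  also have "\<dots> = kl p r"
    using assms by (simp add: kl_def sum.distrib sum_subtractf prob_simplex_def)
  finally show ?thesis .
qed

lemma prob_simplex_geD:
  assumes "v \<in> prob_simplex_ge \<epsilon>"
  shows "v \<in> prob_simplex" "\<epsilon> \<le> v $ i" "v $ i \<le> 1" "(\<Sum>i\<in>UNIV. v $ i) = 1"
  using assms member_le_sum[of i UNIV "\<lambda>i. v $ i"]
  by (auto simp: prob_simplex_def prob_simplex_ge_def)

lemma convex_prob_simplex_ge: "convex (prob_simplex_ge \<epsilon> :: (real ^ 'm::finite) set)"
proof (rule convexI)
  fix x y :: "real ^ 'm" and u v :: real
  assume x: "x \<in> prob_simplex_ge \<epsilon>" and y: "y \<in> prob_simplex_ge \<epsilon>"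
    and uv: "0 \<le> u" "0 \<le> v" "u + v = 1"
  have "(\<Sum>i\<in>UNIV. u * x $ i + v * y $ i) = 1"
    using prob_simplex_geD(4)[OF x] prob_simplex_geD(4)[OF y] uv
    by (simp add: sum.distrib flip: sum_distrib_left)
  moreover have "\<epsilon> \<le> u * x $ i + v * y $ i" for i
  proof -
    have "\<epsilon> = u * \<epsilon> + v * \<epsilon>" using uv by (simp flip: distrib_right)
    also have "\<dots> \<le> u * x $ i + v * y $ i"
      by (intro add_mono mult_left_mono prob_simplex_geD(2) x y uv)
    finally show ?thesis .
  qed
  moreover have "0 \<le> u * x $ i + v * y $ i" for i
    using x y uv by (auto simp: prob_simplex_ge_def prob_simplex_def)
  ultimately show "u *\<^sub>R x + v *\<^sub>R y \<in> prob_simplex_ge \<epsilon>"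
    by (simp add: prob_simplex_ge_def prob_simplex_def)
qed

lemma compact_prob_simplex_ge: "compact (prob_simplex_ge \<epsilon> :: (real ^ 'm::finite) set)"
proof (rule compact_Int_closed[of "cball 0 (real CARD('m))", THEN back_subst[of compact]])
  show "compact (cball 0 (real CARD('m)) :: (real ^ 'm) set)" by simp
  have "prob_simplex_ge \<epsilon> = (\<Inter>i. {v::real^'m. 0 \<le> v $ i} \<inter> {v. \<epsilon> \<le> v $ i}) \<inter> {v. (\<Sum>i\<in>UNIV. v $ i) = 1}"
    by (auto simp: prob_simplex_ge_def prob_simplex_def)
  also have "closed \<dots>"
    by (intro closed_Int closed_INT ballI closed_Collect_le closed_Collect_eq continuous_intros)
  finally show "closed (prob_simplex_ge \<epsilon> :: (real ^ 'm) set)" .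
  have "norm v \<le> real CARD('m)" if "v \<in> prob_simplex_ge \<epsilon>" for v :: "real ^ 'm"
  proof -
    have "norm v \<le> (\<Sum>i\<in>UNIV. \<bar>v $ i\<bar>)" by (rule norm_le_l1_cart)
    also have "\<dots> = (\<Sum>i\<in>UNIV. v $ i)"
      using that by (intro sum.cong) (auto simp: prob_simplex_ge_def prob_simplex_def)
    finally show ?thesis using prob_simplex_geD(4)[OF that] by (auto intro: order_trans[of _ 1] simp: Suc_leI)
  qed
  then show "cball 0 (real CARD('m)) \<inter> prob_simplex_ge \<epsilon> = (prob_simplex_ge \<epsilon> :: (real ^ 'm) set)"
    by auto
qed

text \<open>First-order optimality of \<open>r\<close> along the segment to \<open>u\<close>,
  combined with the Bregman identity of the entropy. All masses are at least \<epsilon>, so the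
  logarithms are differentiable at \<open>r\<close> even when \<open>r\<close> lies on the boundary
  of the feasible set.\<close>

lemma kl_three_point:
  fixes p r u d :: "real ^ 'm::finite"
  assumes eps: "0 < \<epsilon>" and p: "p \<in> prob_simplex_ge \<epsilon>" and u: "u \<in> prob_simplex_ge \<epsilon>"
    and min: "is_arg_min (mirror_objective \<gamma> d p) (\<lambda>v. v \<in> prob_simplex_ge \<epsilon>) r"
  shows "kl r u \<le> kl p u + \<gamma> * (d \<bullet> (u - r)) - kl p r"
proof -
  have r: "r \<in> prob_simplex_ge \<epsilon>"
    and r_le: "\<And>v. v \<in> prob_simplex_ge \<epsilon> \<Longrightarrow> mirror_objective \<gamma> d p r \<le> mirror_objective \<gamma> d p v"
    using min by (auto simp: is_arg_min_linorder)
  have pos: "0 < v $ i" if "v \<in> prob_simplex_ge \<epsilon>" for v :: "real ^ 'm" and i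
    using prob_simplex_geD(2)[OF that, of i] eps by simp
  define f where "f = (\<lambda>t. mirror_objective \<gamma> d p (r + t *\<^sub>R (u - r)))"
  \<comment> \<open>Directional derivative of the objective at \<open>r\<close> towards
    \<open>u\<close>. The summand 1, from the derivative of \<open>x * ln x\<close>, contributes
    nothing in the end because \<open>u\<close> and \<open>r\<close> have equal mass.\<close>
  define D where "D = (\<Sum>i\<in>UNIV. (\<gamma> * d $ i + ln (r $ i / p $ i) + 1) * (u $ i - r $ i))"
  have "(f has_real_derivative D) (at 0)"
  proof -
    have "((\<lambda>t. (r $ i + t * (u $ i - r $ i)) * ln ((r $ i + t * (u $ i - r $ i)) / p $ i))
             has_real_derivative (ln (r $ i / p $ i) + 1) * (u $ i - r $ i)) (at 0)" for i
      by (rule derivative_eq_intros refl | use pos[OF r, of i] pos[OF p, of i] in \<open>simp add: field_simps\<close>)+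
    moreover have "((\<lambda>t. \<gamma> * d $ i * (r $ i + t * (u $ i - r $ i) - p $ i)) has_real_derivative
        \<gamma> * d $ i * (u $ i - r $ i)) (at 0)" for i
      by (auto intro!: derivative_eq_intros)
    ultimately have "((\<lambda>t. (\<Sum>i\<in>UNIV. \<gamma> * d $ i * (r $ i + t * (u $ i - r $ i) - p $ i)) +
        (\<Sum>i\<in>UNIV. (r $ i + t * (u $ i - r $ i)) * ln ((r $ i + t * (u $ i - r $ i)) / p $ i)))
      has_real_derivative ((\<Sum>i\<in>UNIV. \<gamma> * d $ i * (u $ i - r $ i)) +
        (\<Sum>i\<in>UNIV. (ln (r $ i / p $ i) + 1) * (u $ i - r $ i)))) (at 0)"
      by (intro DERIV_add DERIV_sum) auto
    then show ?thesis
      by (simp add: f_def mirror_objective_def kl_def D_def distrib_right sum.distrib add.assoc)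
  qed
  moreover have "f 0 \<le> f t" if "0 < t" "t < 1" for t
  proof -
    have "r + t *\<^sub>R (u - r) = (1 - t) *\<^sub>R r + t *\<^sub>R u" by (simp add: algebra_simps)
    also have "\<dots> \<in> prob_simplex_ge \<epsilon>"
      using convexD[OF convex_prob_simplex_ge r u, of "1 - t" t] that by simp
    finally show ?thesis using r_le by (simp add: f_def)
  qed
  ultimately have D: "0 \<le> D"
  proof -
    assume der: "(f has_real_derivative D) (at 0)" and le: "\<And>t. 0 < t \<Longrightarrow> t < 1 \<Longrightarrow> f 0 \<le> f t"
    show "0 \<le> D"
    proof (rule ccontr)
      assume "\<not> 0 \<le> D"
      then obtain e where e: "e > 0" "\<And>h. 0 < h \<Longrightarrow> h < e \<Longrightarrow> f (0 + h) < f 0"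
        using DERIV_neg_dec_right[OF der] by (metis not_le)
      show False using e(2)[of "min (e/2) (1/2)"] le[of "min (e/2) (1/2)"] e(1) by (auto simp: min_less_iff_disj)
    qed
  qed
  have sums: "(\<Sum>i\<in>UNIV. u $ i - r $ i) = 0"
    using prob_simplex_geD(4)[OF u] prob_simplex_geD(4)[OF r] by (simp add: sum_subtractf)
  have "kl r u = (\<Sum>i\<in>UNIV. u $ i * ln (u $ i / p $ i) - (u $ i - r $ i) * ln (r $ i / p $ i)
      - r $ i * ln (r $ i / p $ i))"
    unfolding kl_def
  proof (intro sum.cong refl)
    fix i
    show "u $ i * ln (u $ i / r $ i) = u $ i * ln (u $ i / p $ i) - (u $ i - r $ i) * ln (r $ i / p $ i)
        - r $ i * ln (r $ i / p $ i)"
      using pos[OF r, of i] pos[OF p, of i] pos[OF u, of i] by (simp add: ln_div algebra_simps)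
  qed
  also have "\<dots> = kl p u - (\<Sum>i\<in>UNIV. (u $ i - r $ i) * ln (r $ i / p $ i)) - kl p r"
    by (simp add: kl_def sum_subtractf)
  also have "(\<Sum>i\<in>UNIV. (u $ i - r $ i) * ln (r $ i / p $ i)) = D - \<gamma> * (d \<bullet> (u - r)) - (\<Sum>i\<in>UNIV. u $ i - r $ i)"
    by (simp add: D_def inner_vec_def sum_distrib_left algebra_simps flip: sum.distrib sum_subtractf)
  finally show ?thesis using D sums by simp
qed

lemma kl_self [simp]: "kl p p = 0"
  by (auto simp: kl_def intro!: sum.neutral)

text \<open>The term \<open>kl p r\<close> of the three-point inequality dominates half the squared
  step; this absorbs the step-dependent part of the inner product and leaves the second-order term
  in \<gamma>. Taking the old iterate \<open>p\<close> itself as reference point gives the bound on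
  the step length.\<close>

lemma mirror_step_bound:
  fixes p r u d :: "real ^ 'm::finite"
  assumes eps: "0 < \<epsilon>" and p: "p \<in> prob_simplex_ge \<epsilon>" and u: "u \<in> prob_simplex_ge \<epsilon>"
    and min: "is_arg_min (mirror_objective \<gamma> d p) (\<lambda>v. v \<in> prob_simplex_ge \<epsilon>) r"
    and \<gamma>: "0 \<le> \<gamma>"
  shows "kl r u \<le> kl p u - \<gamma> * (d \<bullet> (p - u)) + \<gamma>\<^sup>2 * (norm d)\<^sup>2 / 2"
    and "norm (r - p) \<le> 2 * \<gamma> * norm d"
proof -
  have r: "r \<in> prob_simplex_ge \<epsilon>" using min by (auto simp: is_arg_min_linorder)
  have pos: "0 < v $ i" if "v \<in> prob_simplex_ge \<epsilon>" for v :: "real ^ 'm" and i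
    using prob_simplex_geD(2)[OF that, of i] eps by simp
  have low: "(norm (v - w))\<^sup>2 / 2 \<le> kl w v" if "v \<in> prob_simplex_ge \<epsilon>" "w \<in> prob_simplex_ge \<epsilon>" for v w :: "real ^ 'm"
    using that by (intro kl_ge) (auto intro: pos prob_simplex_geD)
  have step: "\<gamma> * (d \<bullet> (p - r)) \<le> \<gamma> * norm d * norm (r - p)"
    using mult_left_mono[OF norm_cauchy_schwarz[of d "p - r"] \<gamma>] by (simp add: norm_minus_commute mult.assoc)
  also have "\<dots> \<le> \<gamma>\<^sup>2 * (norm d)\<^sup>2 / 2 + (norm (r - p))\<^sup>2 / 2"
    using sum_squares_bound[of "\<gamma> * norm d" "norm (r - p)"] by (simp add: power_mult_distrib)
  finally have "\<gamma> * (d \<bullet> (p - r)) \<le> \<gamma>\<^sup>2 * (norm d)\<^sup>2 / 2 + kl p r"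
    using low[OF r p] by simp
  moreover have "\<gamma> * (d \<bullet> (u - r)) = - \<gamma> * (d \<bullet> (p - u)) + \<gamma> * (d \<bullet> (p - r))"
    by (simp add: inner_diff_right algebra_simps)
  ultimately show "kl r u \<le> kl p u - \<gamma> * (d \<bullet> (p - u)) + \<gamma>\<^sup>2 * (norm d)\<^sup>2 / 2"
    using kl_three_point[OF eps p u min] by simp
  have "0 \<le> kl r p" using order_trans[OF _ low[OF p r]] by simp
  then have "(norm (r - p))\<^sup>2 / 2 \<le> \<gamma> * norm d * norm (r - p)"
    using kl_three_point[OF eps p p min] low[OF r p] step by simp
  then have "norm (r - p) * norm (r - p) \<le> (2 * \<gamma> * norm d) * norm (r - p)"
    by (simp add: power2_eq_square algebra_simps)
  then show "norm (r - p) \<le> 2 * \<gamma> * norm d"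
    using \<gamma> by (cases "norm (r - p) = 0") (auto simp del: norm_eq_zero simp: mult_le_cancel_right)
qed

lemma continuous_on_kl:
  assumes "0 < \<epsilon>"
  shows "continuous_on (prob_simplex_ge \<epsilon> \<times> prob_simplex_ge \<epsilon>) (\<lambda>(p, u). kl p (u :: real ^ 'm::finite))"
proof -
  have "0 < v $ i" if "v \<in> prob_simplex_ge \<epsilon>" for v :: "real ^ 'm" and i
    using prob_simplex_geD(2)[OF that, of i] assms by simp
  then show ?thesis
    unfolding kl_def case_prod_beta
    by (intro continuous_intros) (fastforce simp: less_imp_neq[symmetric])+
qed

text \<open>Pays for moving the reference point. By convexity of \<open>x * ln x\<close>, the
  tangent at \<open>u\<close> bounds each difference by
  \<open>(u $ i - w $ i) * (1 + ln (u $ i / p $ i))\<close>, and the lower bound \<epsilon> on all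
  masses bounds the logarithm.\<close>

lemma kl_lipschitz:
  fixes p u w :: "real ^ 'm::finite"
  assumes eps: "0 < \<epsilon>" and p: "p \<in> prob_simplex_ge \<epsilon>" and u: "u \<in> prob_simplex_ge \<epsilon>" and w: "w \<in> prob_simplex_ge \<epsilon>"
  shows "kl p u - kl p w \<le> real CARD('m) * (1 + 1 / \<epsilon>) * norm (u - w)"
proof -
  have pos: "0 < v $ i" if "v \<in> prob_simplex_ge \<epsilon>" for v :: "real ^ 'm" and i
    using prob_simplex_geD(2)[OF that, of i] eps by simp
  have "kl p u - kl p w \<le> (\<Sum>i\<in>(UNIV :: 'm set). (1 + 1 / \<epsilon>) * norm (u - w))"
    unfolding kl_def sum_subtractf[symmetric]
  proof (intro sum_mono)
    fix i :: 'm
    note P = pos[OF p, of i] pos[OF u, of i] pos[OF w, of i]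
    have "ln (w $ i / u $ i) \<ge> 1 - u $ i / w $ i"
      using ln_le_minus_one[of "u $ i / w $ i"] P by (simp add: ln_div)
    then have "w $ i * ln (w $ i / u $ i) \<ge> w $ i - u $ i"
      using P mult_left_mono[of "1 - u $ i / w $ i" "ln (w $ i / u $ i)" "w $ i"] by (simp add: right_diff_distrib)
    then have "u $ i * ln (u $ i / p $ i) - w $ i * ln (w $ i / p $ i)
        \<le> (u $ i - w $ i) * (1 + ln (u $ i / p $ i))"
      using P by (simp add: ln_div algebra_simps)
    also have "\<dots> \<le> \<bar>u $ i - w $ i\<bar> * \<bar>1 + ln (u $ i / p $ i)\<bar>"
      by (simp flip: abs_mult)
    also have "\<dots> \<le> norm (u - w) * (1 + 1 / \<epsilon>)"
    proof (intro mult_mono)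
      show "\<bar>u $ i - w $ i\<bar> \<le> norm (u - w)" using component_le_norm_cart[of "u - w" i] by simp
      have b: "x / y \<le> 1 / \<epsilon>" if "x \<le> 1" "\<epsilon> \<le> y" for x y :: real
        using that eps by (intro order_trans[OF divide_right_mono[of x 1 y] frac_le]) auto
      have "ln (u $ i / p $ i) \<le> u $ i / p $ i - 1" "ln (p $ i / u $ i) \<le> p $ i / u $ i - 1"
        using P by (auto intro!: ln_le_minus_one)
      moreover have "ln (p $ i / u $ i) = - ln (u $ i / p $ i)" using P by (simp add: ln_div)
      ultimately show "\<bar>1 + ln (u $ i / p $ i)\<bar> \<le> 1 + 1 / \<epsilon>"
        using b[OF prob_simplex_geD(3)[OF u] prob_simplex_geD(2)[OF p], of i i] b[OF prob_simplex_geD(3)[OF p] prob_simplex_geD(2)[OF u], of i i]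
        by (simp add: abs_if)
    qed auto
    finally show "u $ i * ln (u $ i / p $ i) - w $ i * ln (w $ i / p $ i) \<le> (1 + 1 / \<epsilon>) * norm (u - w)"
      by (simp add: mult.commute)
  qed
  then show ?thesis by simp
qed

section \<open>Deterministic convergence lemmas\<close>

lemma closest_point_interval_inner:
  fixes l u x e :: real
  assumes "e \<in> {l..u}"
  shows "(x - closest_point {l..u} x) * (e - closest_point {l..u} x) \<le> 0"
  using closest_point_dot[of "{l..u}" e x] assms by simp

lemma closest_point_interval_lipschitz:
  fixes l u x x' :: real
  assumes "l \<le> u"
  shows "\<bar>closest_point {l..u} x - closest_point {l..u} x'\<bar> \<le> \<bar>x - x'\<bar>"
  using closest_point_lipschitz[of "{l..u}" x x'] assms by (simp add: dist_real_def)

lemma closest_point_interval_mem: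
  fixes l u x :: real
  assumes "l \<le> u"
  shows "closest_point {l..u} x \<in> {l..u}"
  using assms by (intro closest_point_in_set) auto

text \<open>The projection has kinks at the ends of the interval, but the squared distance does not:
  its deviation from the linearization is quadratic. The upper estimate uses \<open>P w\<close> as a
  competitor for the point nearest to \<open>v\<close>; the lower one exchanges the two
  points.\<close>

lemma DERIV_sq_dist_interval:
  fixes l u :: real
  assumes lu: "l \<le> u"
  defines "P \<equiv> closest_point {l..u}"
  shows "((\<lambda>x. (x - P x)\<^sup>2) has_real_derivative 2 * (x - P x)) (at x)"
proof -
  define H where "H = (\<lambda>x. (x - P x)\<^sup>2)"
  have upper: "H v - H w - 2 * (w - P w) * (v - w) \<le> (v - w)\<^sup>2" for v w
  proof -
    have "\<bar>v - P v\<bar> \<le> \<bar>v - P w\<bar>"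
      using closest_point_le[of "{l..u}" "P w" v] closest_point_interval_mem[OF lu, of w]
      by (simp add: P_def dist_real_def)
    then have "H v \<le> (v - P w)\<^sup>2" unfolding H_def by (rule abs_le_square_iff[THEN iffD1])
    then show ?thesis by (simp add: H_def power2_eq_square algebra_simps)
  qed
  \<comment> \<open>The 5 is 1 from the upper estimate with the points exchanged plus 4 for
    replacing the slope at \<open>v\<close> by the slope at \<open>w\<close>, the residual being
    Lipschitz with constant 2.\<close>
  have bound: "\<bar>H v - H w - 2 * (w - P w) * (v - w)\<bar> \<le> 5 * (v - w)\<^sup>2" for v w
  proof -
    have "\<bar>(v - P v) - (w - P w)\<bar> \<le> 2 * \<bar>v - w\<bar>"
      using closest_point_interval_lipschitz[OF lu, of v w] unfolding P_def by (smt (verit))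
    then have "\<bar>((v - P v) - (w - P w)) * (v - w)\<bar> \<le> 2 * \<bar>v - w\<bar> * \<bar>v - w\<bar>"
      unfolding abs_mult by (rule mult_right_mono) simp
    moreover have "\<bar>v - w\<bar> * \<bar>v - w\<bar> = (v - w)\<^sup>2" by (simp add: power2_eq_square)
    ultimately have "\<bar>2 * (v - P v) * (v - w) - 2 * (w - P w) * (v - w)\<bar> \<le> 4 * (v - w)\<^sup>2"
      by (simp add: algebra_simps abs_if split: if_splits)
    moreover have "H w - H v - 2 * (v - P v) * (w - v) \<le> (v - w)\<^sup>2"
      using upper[of w v] by (simp add: power2_commute)
    moreover have "2 * (v - P v) * (w - v) = - (2 * (v - P v) * (v - w))" by (simp add: algebra_simps)
    ultimately show ?thesis using upper[of v w] by linarith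
  qed
  have "((\<lambda>v. (H v - H x) / (v - x) - 2 * (x - P x)) \<longlongrightarrow> 0) (at x)"
  proof (rule tendsto_0_le[where K = 5])
    show "((\<lambda>v. v - x) \<longlongrightarrow> 0) (at x)" by (auto intro!: tendsto_eq_intros)
    have "norm ((H v - H x) / (v - x) - 2 * (x - P x)) \<le> norm (v - x) * 5" if "v \<noteq> x" for v
    proof -
      have "(H v - H x) / (v - x) - 2 * (x - P x) = (H v - H x - 2 * (x - P x) * (v - x)) / (v - x)"
        using that by (simp add: field_simps)
      also have "norm \<dots> \<le> 5 * (v - x)\<^sup>2 / \<bar>v - x\<bar>"
        using bound[of v x] by (simp add: divide_right_mono)
      also have "(v - x)\<^sup>2 = \<bar>v - x\<bar> * \<bar>v - x\<bar>" by (simp add: power2_eq_square)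
      also have "5 * (\<bar>v - x\<bar> * \<bar>v - x\<bar>) / \<bar>v - x\<bar> = norm (v - x) * 5"
      proof -
        have "5 * (t * t) / t = t * 5" if "t \<noteq> 0" for t :: real using that by simp
        then show ?thesis unfolding real_norm_def using that by (metis abs_eq_0 right_minus_eq)
      qed
      finally show ?thesis .
    qed
    then show "\<forall>\<^sub>F v in at x. norm ((H v - H x) / (v - x) - 2 * (x - P x)) \<le> norm (v - x) * 5"
      by (auto simp: eventually_at_filter)
  qed
  then have "((\<lambda>v. (H v - H x) / (v - x)) \<longlongrightarrow> 2 * (x - P x)) (at x)"
    by (rule LIM_zero_cancel)
  then show ?thesis by (simp add: has_field_derivative_iff H_def)
qed

section \<open>Convergence of almost decreasing sequences and extraction of subsequences\<close>

text \<open>A deterministic form of the Robbins-Siegmund argument. It is applied path by path with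
  \<open>D\<close> the noise, whose series converges without a control on its absolute
  values.\<close>

lemma almost_decreasing_convergent:
  fixes v g D r :: "nat \<Rightarrow> real"
  assumes step: "\<And>k. k \<ge> n \<Longrightarrow> v (Suc k) \<le> v k - g k - D k + r k"
    and v: "\<And>k. k \<ge> n \<Longrightarrow> 0 \<le> v k" and g: "\<And>k. k \<ge> n \<Longrightarrow> 0 \<le> g k"
    and D: "summable D" and r: "summable r"
  shows "convergent v" and "summable g"
proof -
  \<comment> \<open>Adding back the partial sums of \<open>D - r\<close> turns the almost decreasing
    sequence into a decreasing one; convergence of these sums keeps it bounded below and lets the
    limit be transferred back to \<open>v\<close>.\<close>
  define T where "T = (\<lambda>k. v (k + n) + (\<Sum>i<k + n. D i - r i))"
  have dr: "(\<lambda>k. \<Sum>i<k. D i - r i) \<longlonglongrightarrow> (\<Sum>i. D i - r i)"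
    using summable_diff[OF D r] by (rule summable_LIMSEQ)
  then have dr': "(\<lambda>k. \<Sum>i<k + n. D i - r i) \<longlonglongrightarrow> (\<Sum>i. D i - r i)" by (rule LIMSEQ_ignore_initial_segment)
  have step': "g (k + n) \<le> T k - T (Suc k)" for k
    using step[of "k + n"] by (simp add: T_def)
  have "Bseq (\<lambda>k. \<Sum>i<k + n. D i - r i)" using dr' by (rule convergent_imp_Bseq[OF convergentI])
  then obtain B where B: "\<And>k. \<bar>\<Sum>i<k + n. D i - r i\<bar> \<le> B" by (auto simp: Bseq_def)
  have low: "- B \<le> T k" for k using B[of k] v[of "k + n"] by (auto simp: T_def)
  have "decseq T"
    by (rule decseq_SucI) (use step' g in \<open>smt (verit) le_add2\<close>)
  then obtain L where L: "T \<longlonglongrightarrow> L" using decseq_convergent low by blast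
  have "(\<lambda>k. T k - (\<Sum>i<k + n. D i - r i)) \<longlonglongrightarrow> L - (\<Sum>i. D i - r i)"
    by (intro tendsto_diff L dr')
  then have "(\<lambda>k. v (k + n)) \<longlonglongrightarrow> L - (\<Sum>i. D i - r i)" by (simp add: T_def)
  then show "convergent v" by (auto intro: convergentI dest: LIMSEQ_offset)
  have "summable (\<lambda>k. g (k + n))"
  proof (rule summable_comparison_test')
    have "(\<lambda>k. T k - T (Suc k)) sums (T 0 - L)" by (rule telescope_sums'[OF L])
    then show "summable (\<lambda>k. T k - T (Suc k))" by (rule sums_summable)
    show "norm (g (k + n)) \<le> T k - T (Suc k)" if "k \<ge> 0" for k using step'[of k] g[of "k + n"] by simp
  qed
  then show "summable g" by (simp only: summable_iff_shift)
qed

text \<open>If \<open>H\<close> stayed above some \<open>e > 0\<close> from an index on,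
  \<open>w\<close> would be dominated by \<open>(1 / e) * (w k * H k)\<close> and hence
  summable.\<close>

lemma summable_weighted_imp_subseq_tendsto_0:
  fixes w H :: "nat \<Rightarrow> real"
  assumes "summable (\<lambda>k. w k * H k)" "\<not> summable w"
    and w: "\<And>k. k \<ge> n \<Longrightarrow> 0 \<le> w k" and H: "\<And>k. k \<ge> n \<Longrightarrow> 0 \<le> H k"
  obtains r where "strict_mono r" "(\<lambda>k. H (r k)) \<longlonglongrightarrow> 0"
proof -
  have small: "\<exists>k\<ge>m. H k < e" if "0 < e" for e m
  proof (rule ccontr)
    assume "\<not> ?thesis"
    then have e: "e \<le> H k" if "k \<ge> m" for k using that by force
    have "summable w"
    proof (rule summable_comparison_test'[where N = "max m n"])
      show "summable (\<lambda>k. (1 / e) * (w k * H k))" by (rule summable_mult[OF assms(1)])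
      show "norm (w k) \<le> (1 / e) * (w k * H k)" if "k \<ge> max m n" for k
        using mult_left_mono[OF e[of k] w[of k]] that \<open>0 < e\<close> w[of k] by (simp add: field_simps)
    qed
    with assms(2) show False by simp
  qed
  have "\<forall>j. \<exists>k\<ge>n. H k < 1 / real (Suc j)" by (intro allI small) simp
  have "\<exists>r. \<forall>j. (r j \<ge> n \<and> H (r j) < 1 / real (Suc j)) \<and> r j < r (Suc j)"
  proof (rule dependent_nat_choice)
    show "\<exists>k. k \<ge> n \<and> H k < 1 / real (Suc 0)" using small[of 1 n] by auto
    fix k j
    obtain k' where "k' \<ge> max n (Suc k)" "H k' < 1 / real (Suc (Suc j))"
      using small[of "1 / real (Suc (Suc j))" "max n (Suc k)"] by auto
    then show "\<exists>k'. (k' \<ge> n \<and> H k' < 1 / real (Suc (Suc j))) \<and> k < k'"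
      by (intro exI[of _ k']) auto
  qed
  then obtain r where r: "\<And>j. r j \<ge> n" "\<And>j. H (r j) < 1 / real (Suc j)" "\<And>j. r j < r (Suc j)" by blast
  have "(\<lambda>j. H (r j)) \<longlonglongrightarrow> 0"
  proof (rule tendsto_sandwich[of "\<lambda>_. 0" _ _ "\<lambda>j. 1 / real (Suc j)"])
    show "(\<lambda>j. 1 / real (Suc j)) \<longlonglongrightarrow> 0" using LIMSEQ_inverse_real_of_nat by (simp add: inverse_eq_divide)
  qed (use r H in \<open>auto intro!: eventuallyI less_imp_le\<close>)
  with r(3) that show ?thesis by (auto simp: strict_mono_Suc_iff)
qed

text \<open>Dividing the gap by the penalty parameter keeps the contribution of the objective visible in
  the limit: the penalty part is nonnegative and cannot compensate it.\<close>

lemma penalized_gap_subseq: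
  fixes x u :: "nat \<Rightarrow> 'a::euclidean_space" and A B :: "'a \<Rightarrow> 'a"
  assumes K: "compact K" and xK: "\<And>k. k \<ge> n \<Longrightarrow> x k \<in> K" and R: "R \<subseteq> K"
    and A: "continuous_on K A" and B: "continuous_on K B"
    and B_feas: "\<And>v. v \<in> R \<Longrightarrow> B v = 0"
    and A_pos: "\<And>v. v \<in> R \<Longrightarrow> v \<noteq> opt \<Longrightarrow> A v \<bullet> (v - opt) > 0"
    and B_pos: "\<And>v. v \<in> K \<Longrightarrow> v \<notin> R \<Longrightarrow> B v \<bullet> (v - opt) > 0"
    and lam: "lam \<longlonglongrightarrow> 0" and lam_pos: "\<And>k. k \<ge> n \<Longrightarrow> 0 < lam k"
    and u: "\<And>k. k \<ge> n \<Longrightarrow> norm (u k - opt) \<le> C * lam k"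
    and gam: "\<And>k. k \<ge> n \<Longrightarrow> 0 \<le> \<gamma> k" and nsum: "\<not> summable (\<lambda>k. \<gamma> k * lam k)"
    and gap: "\<And>k. k \<ge> n \<Longrightarrow> 0 \<le> (lam k *\<^sub>R A (x k) + B (x k)) \<bullet> (x k - u k)"
    and sum: "summable (\<lambda>k. \<gamma> k * ((lam k *\<^sub>R A (x k) + B (x k)) \<bullet> (x k - u k)))"
  obtains r where "strict_mono r" "(\<lambda>k. x (r k)) \<longlonglongrightarrow> opt"
proof -
  define G where "G = (\<lambda>k. (lam k *\<^sub>R A (x k) + B (x k)) \<bullet> (x k - u k))"
  have "summable (\<lambda>k. (\<gamma> k * lam k) * (G k / lam k))"
  proof -
    have "\<forall>\<^sub>F k in sequentially. (\<gamma> k * lam k) * (G k / lam k) = \<gamma> k * G k"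
      using eventually_ge_at_top[of n] by eventually_elim (use lam_pos in force)
    then show ?thesis using sum by (subst summable_cong) (auto simp: G_def)
  qed
  then obtain r1 where r1: "strict_mono r1" "(\<lambda>k. G (r1 k) / lam (r1 k)) \<longlonglongrightarrow> 0"
    by (rule summable_weighted_imp_subseq_tendsto_0[where n = n, OF _ nsum])
      (use gam lam_pos gap in \<open>auto simp: G_def intro!: mult_nonneg_nonneg divide_nonneg_pos intro: less_imp_le\<close>)
  \<comment> \<open>A strictly increasing \<open>r1\<close> satisfies \<open>r1 k \<ge> k\<close>,
    so the shift by \<open>n\<close> places every term of the sequence in the compact set.\<close>
  have "\<forall>k. x (r1 (k + n)) \<in> K"
  proof
    fix k
    have "n \<le> r1 (k + n)" using seq_suble[OF r1(1), of "k + n"] by simp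
    then show "x (r1 (k + n)) \<in> K" by (rule xK)
  qed
  then obtain xb r2 where xb: "xb \<in> K" and r2: "strict_mono r2"
    and lim2: "((\<lambda>k. x (r1 (k + n))) \<circ> r2) \<longlonglongrightarrow> xb"
    using K[unfolded compact_def, rule_format, of "\<lambda>k. x (r1 (k + n))"] by blast
  define r where "r = (\<lambda>k. r1 (r2 k + n))"
  have r: "strict_mono r"
    using r1(1) r2 by (auto simp: r_def strict_mono_def)
  have rn: "r k \<ge> n" for k using seq_suble[OF r1(1), of "r2 k + n"] by (simp add: r_def)
  have lim: "(\<lambda>k. x (r k)) \<longlonglongrightarrow> xb" using lim2 by (simp add: r_def o_def)
  have Gr: "(\<lambda>k. G (r k) / lam (r k)) \<longlonglongrightarrow> 0"
  proof -
    have "strict_mono (\<lambda>k. r2 k + n)" using r2 by (auto simp: strict_mono_def)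
    from LIMSEQ_subseq_LIMSEQ[OF r1(2) this] show ?thesis by (simp add: r_def o_def)
  qed
  have lr: "(\<lambda>k. lam (r k)) \<longlonglongrightarrow> 0" using LIMSEQ_subseq_LIMSEQ[OF lam r] by (simp add: o_def)
  have xr: "\<forall>\<^sub>F k in sequentially. x (r k) \<in> K" using xK rn by auto
  have Ar: "(\<lambda>k. A (x (r k))) \<longlonglongrightarrow> A xb" by (rule continuous_on_tendsto_compose[OF A lim xb xr])
  have Br: "(\<lambda>k. B (x (r k))) \<longlonglongrightarrow> B xb" by (rule continuous_on_tendsto_compose[OF B lim xb xr])
  have ur: "(\<lambda>k. u (r k)) \<longlonglongrightarrow> opt"
  proof (rule LIM_zero_cancel, rule tendsto_0_le[OF lr])
    show "\<forall>\<^sub>F k in sequentially. norm (u (r k) - opt) \<le> norm (lam (r k)) * \<bar>C\<bar>"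
    proof (intro eventuallyI)
      fix k
      have "norm (u (r k) - opt) \<le> C * lam (r k)" by (rule u[OF rn])
      also have "\<dots> \<le> \<bar>C\<bar> * lam (r k)" using lam_pos[OF rn] by (intro mult_right_mono) (auto intro: less_imp_le)
      finally show "norm (u (r k) - opt) \<le> norm (lam (r k)) * \<bar>C\<bar>" using lam_pos[OF rn, of k] by (simp add: mult.commute)
    qed
  qed
  \<comment> \<open>Feasibility of the limit point is read off from the undivided gap: there the
    objective part vanishes with \<open>lam\<close>, and at an infeasible point the penalty part
    would be positive.\<close>
  have "(\<lambda>k. G (r k)) \<longlonglongrightarrow> 0"
  proof -
    have "(\<lambda>k. G (r k) / lam (r k) * lam (r k)) \<longlonglongrightarrow> 0 * 0" by (intro tendsto_mult Gr lr)
    moreover have "G (r k) / lam (r k) * lam (r k) = G (r k)" for k using lam_pos[OF rn, of k] by simp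
    ultimately show ?thesis by simp
  qed
  moreover have "(\<lambda>k. G (r k)) \<longlonglongrightarrow> (0 *\<^sub>R A xb + B xb) \<bullet> (xb - opt)"
    unfolding G_def by (intro tendsto_intros lr Ar Br lim ur)
  ultimately have "B xb \<bullet> (xb - opt) = 0" using LIMSEQ_unique by fastforce
  then have feas: "xb \<in> R" using B_pos[OF xb] by force
  have "xb = opt"
  proof (rule ccontr)
    assume "xb \<noteq> opt"
    then have pos: "A xb \<bullet> (xb - opt) > 0" by (rule A_pos[OF feas])
    \<comment> \<open>A lower bound for the divided gap. The penalty gradient pairs nonnegatively
      with \<open>x - opt\<close>; replacing \<open>opt\<close> by \<open>u\<close> costs at most
      \<open>\<bar>C\<bar> * lam\<close> times the norm of that gradient, and the norm tends to 0
      because the limit point is feasible.\<close>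
    define E where "E = (\<lambda>k. A (x (r k)) \<bullet> (x (r k) - u (r k)) - \<bar>C\<bar> * norm (B (x (r k))))"
    have "E \<longlonglongrightarrow> A xb \<bullet> (xb - opt) - \<bar>C\<bar> * norm (B xb)"
      unfolding E_def by (intro tendsto_intros Ar Br lim ur)
    then have Elim: "E \<longlonglongrightarrow> A xb \<bullet> (xb - opt)" by (simp add: B_feas[OF feas])
    have "E k \<le> G (r k) / lam (r k)" for k
    proof -
      have l: "0 < lam (r k)" by (rule lam_pos[OF rn])
      have "B (x (r k)) \<bullet> (x (r k) - opt) \<ge> 0"
        using B_pos[of "x (r k)"] B_feas[of "x (r k)"] xK[OF rn, of k] by (cases "x (r k) \<in> R") force+
      moreover have "B (x (r k)) \<bullet> (u (r k) - opt) \<le> norm (B (x (r k))) * (\<bar>C\<bar> * lam (r k))"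
      proof (rule order_trans[OF norm_cauchy_schwarz mult_left_mono])
        show "norm (u (r k) - opt) \<le> \<bar>C\<bar> * lam (r k)"
          using order_trans[OF u[OF rn, of k] mult_right_mono[of C "\<bar>C\<bar>" "lam (r k)"]] l by simp
      qed simp
      moreover have "B (x (r k)) \<bullet> (x (r k) - u (r k)) =
          B (x (r k)) \<bullet> (x (r k) - opt) - B (x (r k)) \<bullet> (u (r k) - opt)" by (simp add: inner_diff_right)
      ultimately have "B (x (r k)) \<bullet> (x (r k) - u (r k)) \<ge> - (\<bar>C\<bar> * norm (B (x (r k))) * lam (r k))"
        by (simp add: mult_ac)
      then have "E k * lam (r k) \<le> G (r k)"
        by (simp add: E_def G_def inner_add_left algebra_simps)
      then show ?thesis using l by (simp add: pos_le_divide_eq)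
    qed
    then have "A xb \<bullet> (xb - opt) \<le> 0" by (intro LIMSEQ_le[OF Elim Gr]) auto
    with pos show False by simp
  qed
  with r lim that show ?thesis by blast
qed

section \<open>Almost sure convergence of noise with orthogonal increments\<close>

context prob_space
begin

lemma integrable_AE_bounded:
  fixes f :: "'a \<Rightarrow> real"
  assumes "f \<in> borel_measurable M" "AE \<omega> in M. \<bar>f \<omega>\<bar> \<le> B"
  shows "integrable M f"
  using assms by (intro integrable_const_bound[of f B]) auto

lemma integral_AE_abs_le:
  fixes f :: "'a \<Rightarrow> real"
  assumes "f \<in> borel_measurable M" "AE \<omega> in M. \<bar>f \<omega>\<bar> \<le> B"
  shows "\<bar>expectation f\<bar> \<le> B"
proof -
  have i: "integrable M f" by (rule integrable_AE_bounded[OF assms])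
  have "\<bar>expectation f\<bar> \<le> expectation (\<lambda>\<omega>. \<bar>f \<omega>\<bar>)" by (rule integral_abs_bound)
  also have "\<dots> \<le> expectation (\<lambda>_. B)" using assms(2) i by (intro integral_mono_AE) auto
  finally show ?thesis by (simp add: prob_space)
qed

text \<open>Kolmogorov's inequality. Orthogonality to bounded functions of the past replaces the martingale
  property, so that no conditional expectation has to be computed.\<close>

lemma maximal_inequality_bounded_increments:
  fixes D :: "nat \<Rightarrow> 'a \<Rightarrow> real" and F :: "nat \<Rightarrow> 'a measure" and c :: "nat \<Rightarrow> real"
  assumes filt: "filtration (space M) F" and sub: "\<And>k. subalgebra M (F k)"
    and D_meas: "\<And>k. m \<le> k \<Longrightarrow> D k \<in> borel_measurable (F (Suc k))"
    and D_bound: "\<And>k. m \<le> k \<Longrightarrow> AE \<omega> in M. \<bar>D k \<omega>\<bar> \<le> c k"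
    and orth: "\<And>k Y B. m \<le> k \<Longrightarrow> Y \<in> borel_measurable (F k) \<Longrightarrow> (AE \<omega> in M. \<bar>Y \<omega>\<bar> \<le> B) \<Longrightarrow>
            expectation (\<lambda>\<omega>. D k \<omega> * Y \<omega>) = 0"
    and e: "0 < e"
  shows "prob {\<omega> \<in> space M. \<exists>j\<le>n. e \<le> \<bar>\<Sum>i<j. D (m + i) \<omega>\<bar>} \<le> (\<Sum>i<n. (c (m + i))\<^sup>2) / e\<^sup>2"
proof -
  define S where "S = (\<lambda>j \<omega>. \<Sum>i<j. D (m + i) \<omega>)"
  have Fmono: "sets (F i) \<subseteq> sets (F j)" if "i \<le> j" for i j
    using filtration.sets_F_mono[OF filt that] .
  have spF: "space (F i) = space M" for i using filtration.space_F[OF filt] .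
  have up: "f \<in> borel_measurable (F j)" if "f \<in> borel_measurable (F i)" "i \<le> j" for i j and f :: "'a \<Rightarrow> real"
    using that(1) Fmono[OF that(2)] by (auto simp: measurable_def spF)
  have upM: "f \<in> borel_measurable M" if "f \<in> borel_measurable (F i)" for i and f :: "'a \<Rightarrow> real"
    by (rule measurable_from_subalg[OF sub that])
  have SF: "S j \<in> borel_measurable (F (m + j))" for j
    unfolding S_def
  proof (intro borel_measurable_sum)
    fix i assume "i \<in> {..<j}"
    then show "D (m + i) \<in> borel_measurable (F (m + j))"
      by (intro up[OF D_meas[of "m + i"]]) auto
  qed
  have S_bound: "\<exists>B. AE \<omega> in M. \<bar>S j \<omega>\<bar> \<le> B" for j
  proof
    have "AE \<omega> in M. \<forall>i\<in>{..<j}. \<bar>D (m + i) \<omega>\<bar> \<le> c (m + i)"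
      by (intro AE_finite_allI D_bound) auto
    then show "AE \<omega> in M. \<bar>S j \<omega>\<bar> \<le> (\<Sum>i<j. c (m + i))"
    proof eventually_elim
      case (elim \<omega>)
      then show ?case unfolding S_def by (intro order_trans[OF sum_abs] sum_mono) auto
    qed
  qed
  \<comment> \<open>First passage at \<open>j\<close>. These events are disjoint and already decided
    by \<open>F (m + j)\<close>, so their indicators are admissible factors in \<open>orth\<close>
    for all later increments.\<close>
  define T where "T = (\<lambda>j \<omega>. e \<le> \<bar>S j \<omega>\<bar> \<and> (\<forall>i<j. \<bar>S i \<omega>\<bar> < e))"
  have T_meas: "Measurable.pred (F (m + j)) (T j)" for j
  proof -
    have [measurable]: "S i \<in> borel_measurable (F (m + j))" if "i \<le> j" for i
      by (rule up[OF SF]) (use that in auto)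
    have "Measurable.pred (F (m + j)) (\<lambda>\<omega>. \<forall>i\<in>{..<j}. \<bar>S i \<omega>\<bar> < e)"
      by (intro pred_intros_finite) auto
    then have [measurable]: "Measurable.pred (F (m + j)) (\<lambda>\<omega>. \<forall>i<j. \<bar>S i \<omega>\<bar> < e)" by simp
    have [measurable]: "S j \<in> borel_measurable (F (m + j))" by (rule SF)
    show ?thesis unfolding T_def by measurable
  qed
  define I where "I = (\<lambda>j \<omega>. of_bool (T j \<omega>) :: real)"
  have I_meas: "I j \<in> borel_measurable (F (m + j))" for j
    using T_meas[of j] unfolding I_def by measurable
  have I01: "0 \<le> I j \<omega>" "I j \<omega> \<le> 1" for j \<omega> by (auto simp: I_def)
  \<comment> \<open>On the first-passage event the cross term between the next increment and the
    current sum has mean zero, so the restricted second moment can only grow after passage.\<close>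
  have sq_growth: "expectation (\<lambda>\<omega>. I j \<omega> * (S j \<omega>)\<^sup>2) \<le> expectation (\<lambda>\<omega>. I j \<omega> * (S n \<omega>)\<^sup>2)"
    and sq_int: "integrable M (\<lambda>\<omega>. I j \<omega> * (S n \<omega>)\<^sup>2)" if "j \<le> n" for j n
  proof -
    have int: "integrable M (\<lambda>\<omega>. I j \<omega> * (S l \<omega>)\<^sup>2)" for l
    proof -
      obtain B where B: "AE \<omega> in M. \<bar>S l \<omega>\<bar> \<le> B" using S_bound by blast
      show ?thesis
      proof (rule integrable_AE_bounded)
        show "(\<lambda>\<omega>. I j \<omega> * (S l \<omega>)\<^sup>2) \<in> borel_measurable M" using upM[OF I_meas] upM[OF SF] by measurable
        show "AE \<omega> in M. \<bar>I j \<omega> * (S l \<omega>)\<^sup>2\<bar> \<le> B\<^sup>2"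
          using B
        proof eventually_elim
          case (elim \<omega>)
          have "(S l \<omega>)\<^sup>2 \<le> B\<^sup>2" using elim by (simp add: abs_le_square_iff[symmetric])
          then show ?case using I01[of j \<omega>] mult_mono[of "I j \<omega>" 1 "(S l \<omega>)\<^sup>2" "B\<^sup>2"] by (simp add: abs_mult)
        qed
      qed
    qed
    show "integrable M (\<lambda>\<omega>. I j \<omega> * (S n \<omega>)\<^sup>2)" by (rule int)
    have "expectation (\<lambda>\<omega>. I j \<omega> * (S l \<omega>)\<^sup>2) \<le> expectation (\<lambda>\<omega>. I j \<omega> * (S (Suc l) \<omega>)\<^sup>2)" if "j \<le> l" for l
    proof -
      obtain B where B: "AE \<omega> in M. \<bar>S l \<omega>\<bar> \<le> B" using S_bound by blast
      have Y: "(\<lambda>\<omega>. I j \<omega> * S l \<omega>) \<in> borel_measurable (F (m + l))"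
        using up[OF I_meas, of j "m + l"] SF[of l] that by (intro borel_measurable_times) auto
      have Yb: "AE \<omega> in M. \<bar>I j \<omega> * S l \<omega>\<bar> \<le> B"
        using B
      proof eventually_elim
        case (elim \<omega>)
        then show ?case using I01[of j \<omega>] mult_mono[of "I j \<omega>" 1 "\<bar>S l \<omega>\<bar>" B] by (simp add: abs_mult)
      qed
      have o: "expectation (\<lambda>\<omega>. D (m + l) \<omega> * (I j \<omega> * S l \<omega>)) = 0" by (rule orth[OF _ Y Yb]) simp
      have Dm: "D (m + l) \<in> borel_measurable M" by (rule upM[OF D_meas]) simp
      have oi: "integrable M (\<lambda>\<omega>. D (m + l) \<omega> * (I j \<omega> * S l \<omega>))"
      proof (rule integrable_AE_bounded)
        show "(\<lambda>\<omega>. D (m + l) \<omega> * (I j \<omega> * S l \<omega>)) \<in> borel_measurable M" using Dm upM[OF Y] by measurable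
        show "AE \<omega> in M. \<bar>D (m + l) \<omega> * (I j \<omega> * S l \<omega>)\<bar> \<le> c (m + l) * B"
          using Yb D_bound[of "m + l", OF le_add1]
          by eventually_elim (simp only: abs_mult, intro mult_mono, auto)
      qed
      have "expectation (\<lambda>\<omega>. I j \<omega> * (S l \<omega>)\<^sup>2) =
          expectation (\<lambda>\<omega>. I j \<omega> * (S l \<omega>)\<^sup>2 + 2 * (D (m + l) \<omega> * (I j \<omega> * S l \<omega>)))"
        using o oi int by simp
      also have "\<dots> \<le> expectation (\<lambda>\<omega>. I j \<omega> * (S (Suc l) \<omega>)\<^sup>2)"
      proof (rule integral_mono)
        fix \<omega>
        have "I j \<omega> * (S (Suc l) \<omega>)\<^sup>2 = I j \<omega> * (S l \<omega>)\<^sup>2 + 2 * (D (m + l) \<omega> * (I j \<omega> * S l \<omega>)) + I j \<omega> * (D (m + l) \<omega>)\<^sup>2"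
          by (simp add: S_def power2_eq_square algebra_simps)
        then show "I j \<omega> * (S l \<omega>)\<^sup>2 + 2 * (D (m + l) \<omega> * (I j \<omega> * S l \<omega>)) \<le> I j \<omega> * (S (Suc l) \<omega>)\<^sup>2"
          using I01[of j \<omega>] by simp
      qed (intro Bochner_Integration.integrable_add integrable_mult_right int oi)+
      finally show ?thesis .
    qed
    note growth = this
    show "expectation (\<lambda>\<omega>. I j \<omega> * (S j \<omega>)\<^sup>2) \<le> expectation (\<lambda>\<omega>. I j \<omega> * (S n \<omega>)\<^sup>2)"
      using that
    proof (induction n rule: dec_induct)
      case (step n)
      then show ?case using growth[of n] by simp
    qed simp
  qed
  \<comment> \<open>Pythagoras: orthogonality to the bounded past sum removes the mixed terms of the
    second moment.\<close>
  have S_sq: "integrable M (\<lambda>\<omega>. (S l \<omega>)\<^sup>2) \<and> expectation (\<lambda>\<omega>. (S l \<omega>)\<^sup>2) \<le> (\<Sum>i<l. (c (m + i))\<^sup>2)" for l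
  proof (induction l)
    case 0
    then show ?case by (simp add: S_def)
  next
    case (Suc l)
    obtain B where B: "AE \<omega> in M. \<bar>S l \<omega>\<bar> \<le> B" using S_bound by blast
    have Dm: "D (m + l) \<in> borel_measurable M" by (rule upM[OF D_meas]) simp
    have o: "expectation (\<lambda>\<omega>. D (m + l) \<omega> * S l \<omega>) = 0" by (rule orth[OF _ SF B]) simp
    have oi: "integrable M (\<lambda>\<omega>. D (m + l) \<omega> * S l \<omega>)"
    proof (rule integrable_AE_bounded)
      show "(\<lambda>\<omega>. D (m + l) \<omega> * S l \<omega>) \<in> borel_measurable M" using Dm upM[OF SF] by measurable
      show "AE \<omega> in M. \<bar>D (m + l) \<omega> * S l \<omega>\<bar> \<le> c (m + l) * B"
        using B D_bound[of "m + l", OF le_add1]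
        by eventually_elim (simp only: abs_mult, intro mult_mono, auto)
    qed
    have Dsq: "AE \<omega> in M. \<bar>(D (m + l) \<omega>)\<^sup>2\<bar> \<le> (c (m + l))\<^sup>2"
      using D_bound[of "m + l", OF le_add1] by eventually_elim (simp add: abs_le_square_iff[symmetric])
    have Dm2: "(\<lambda>\<omega>. (D (m + l) \<omega>)\<^sup>2) \<in> borel_measurable M" using Dm by measurable
    have Di: "integrable M (\<lambda>\<omega>. (D (m + l) \<omega>)\<^sup>2)" by (rule integrable_AE_bounded[OF Dm2 Dsq])
    have "(\<lambda>\<omega>. (S (Suc l) \<omega>)\<^sup>2) = (\<lambda>\<omega>. (S l \<omega>)\<^sup>2 + 2 * (D (m + l) \<omega> * S l \<omega>) + (D (m + l) \<omega>)\<^sup>2)"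
      by (auto simp: S_def power2_eq_square algebra_simps)
    moreover have "expectation (\<lambda>\<omega>. (D (m + l) \<omega>)\<^sup>2) \<le> (c (m + l))\<^sup>2"
      using integral_AE_abs_le[OF Dm2 Dsq] by simp
    ultimately show ?case using Suc Di oi o by simp
  qed
  define A where "A = {\<omega> \<in> space M. \<exists>j\<le>n. e \<le> \<bar>S j \<omega>\<bar>}"
  have A: "A \<in> sets M"
  proof -
    have [measurable]: "S j \<in> borel_measurable M" for j by (rule upM[OF SF])
    have "A = {\<omega> \<in> space M. \<exists>j\<in>{..n}. e \<le> \<bar>S j \<omega>\<bar>}" by (auto simp: A_def)
    also have "\<dots> \<in> sets M" by measurable
    finally show ?thesis .
  qed
  have le1: "(\<Sum>j\<le>n. I j \<omega>) \<le> 1" for \<omega>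
  proof (cases "\<exists>j\<le>n. T j \<omega>")
    case True
    then obtain j where j: "j \<le> n" "T j \<omega>" by blast
    have "I i \<omega> = 0" if "i \<noteq> j" for i
    proof -
      have "\<not> T i \<omega>" using j(2) that by (cases i j rule: linorder_cases) (auto simp: T_def)
      then show ?thesis by (simp add: I_def)
    qed
    then have "(\<Sum>i\<le>n. I i \<omega>) = (\<Sum>i\<in>{j}. I i \<omega>)"
      using j(1) by (intro sum.mono_neutral_right) auto
    then show ?thesis using I01 by simp
  qed (auto simp: I_def)
  have ge: "e\<^sup>2 * indicator A \<omega> \<le> (\<Sum>j\<le>n. I j \<omega> * (S j \<omega>)\<^sup>2)" for \<omega>
  proof (cases "\<omega> \<in> A")
    case True
    then obtain j0 where j0: "j0 \<le> n" "e \<le> \<bar>S j0 \<omega>\<bar>" by (auto simp: A_def)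
    define j where "j = (LEAST j. e \<le> \<bar>S j \<omega>\<bar>)"
    have "e \<le> \<bar>S j \<omega>\<bar>" using LeastI[of "\<lambda>j. e \<le> \<bar>S j \<omega>\<bar>", OF j0(2)] by (simp add: j_def)
    moreover have "\<bar>S i \<omega>\<bar> < e" if "i < j" for i
      using not_less_Least[of i "\<lambda>j. e \<le> \<bar>S j \<omega>\<bar>"] that by (simp add: j_def)
    ultimately have Tj: "T j \<omega>" by (simp add: T_def)
    have jn: "j \<le> n" using Least_le[of "\<lambda>j. e \<le> \<bar>S j \<omega>\<bar>", OF j0(2)] j0(1) by (simp add: j_def)
    have "e\<^sup>2 \<le> I j \<omega> * (S j \<omega>)\<^sup>2"
      using Tj e by (simp add: I_def T_def abs_le_square_iff[symmetric])
    also have "\<dots> \<le> (\<Sum>j\<le>n. I j \<omega> * (S j \<omega>)\<^sup>2)"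
      using jn I01 by (intro member_le_sum) auto
    finally show ?thesis using True by simp
  qed (use I01 in \<open>auto intro!: sum_nonneg\<close>)
  have "e\<^sup>2 * prob A = expectation (\<lambda>\<omega>. e\<^sup>2 * indicator A \<omega>)" using A by simp
  also have "\<dots> \<le> expectation (\<lambda>\<omega>. \<Sum>j\<le>n. I j \<omega> * (S j \<omega>)\<^sup>2)"
    by (intro integral_mono ge Bochner_Integration.integrable_sum sq_int integrable_mult_right)
      (use A in \<open>auto simp: integrable_indicator_iff less_top[symmetric]\<close>)
  also have "\<dots> = (\<Sum>j\<le>n. expectation (\<lambda>\<omega>. I j \<omega> * (S j \<omega>)\<^sup>2))"
    by (intro Bochner_Integration.integral_sum sq_int) simp
  also have "\<dots> \<le> (\<Sum>j\<le>n. expectation (\<lambda>\<omega>. I j \<omega> * (S n \<omega>)\<^sup>2))"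
    by (intro sum_mono sq_growth) simp
  also have "\<dots> = expectation (\<lambda>\<omega>. \<Sum>j\<le>n. I j \<omega> * (S n \<omega>)\<^sup>2)"
    by (intro Bochner_Integration.integral_sum[symmetric] sq_int) simp
  also have "\<dots> \<le> expectation (\<lambda>\<omega>. (S n \<omega>)\<^sup>2)"
  proof (intro integral_mono Bochner_Integration.integrable_sum sq_int)
    fix \<omega>
    show "(\<Sum>j\<le>n. I j \<omega> * (S n \<omega>)\<^sup>2) \<le> (S n \<omega>)\<^sup>2"
      using mult_right_mono[OF le1[of \<omega>], of "(S n \<omega>)\<^sup>2"] by (simp add: sum_distrib_right)
  qed (use S_sq in auto)
  also have "\<dots> \<le> (\<Sum>i<n. (c (m + i))\<^sup>2)" using S_sq by blast
  finally show ?thesis using e by (simp add: A_def S_def field_simps)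
qed

text \<open>The maximal inequality bounds the probability that the sums started at \<open>m\<close>
  ever reach modulus \<open>e\<close> by a tail of the convergent series of
  \<open>(c k)\<^sup>2\<close> over \<open>e\<^sup>2\<close>. Letting \<open>m\<close> grow, almost
  surely some start stays below \<open>e\<close>; using the thresholds
  \<open>1 / real (Suc k)\<close> turns this into the Cauchy criterion.\<close>

lemma bounded_orthogonal_increments_summable:
  fixes D :: "nat \<Rightarrow> 'a \<Rightarrow> real" and F :: "nat \<Rightarrow> 'a measure" and c :: "nat \<Rightarrow> real"
  assumes filt: "filtration (space M) F" and sub: "\<And>k. subalgebra M (F k)"
    and D_meas: "\<And>k. n \<le> k \<Longrightarrow> D k \<in> borel_measurable (F (Suc k))"
    and D_bound: "\<And>k. n \<le> k \<Longrightarrow> AE \<omega> in M. \<bar>D k \<omega>\<bar> \<le> c k"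
    and orth: "\<And>k Y B. n \<le> k \<Longrightarrow> Y \<in> borel_measurable (F k) \<Longrightarrow> (AE \<omega> in M. \<bar>Y \<omega>\<bar> \<le> B) \<Longrightarrow>
            expectation (\<lambda>\<omega>. D k \<omega> * Y \<omega>) = 0"
    and c: "summable (\<lambda>k. (c k)\<^sup>2)"
  shows "AE \<omega> in M. summable (\<lambda>k. D k \<omega>)"
proof -
  have Dm [measurable]: "D k \<in> borel_measurable M" if "n \<le> k" for k
    by (rule measurable_from_subalg[OF sub D_meas[OF that]])
  define osc where "osc = (\<lambda>m e l \<omega>. \<exists>j\<le>l. e \<le> \<bar>\<Sum>i<j. D (m + i) \<omega>\<bar>)"
  have osc_sets: "{\<omega> \<in> space M. osc m e l \<omega>} \<in> sets M" if "n \<le> m" for m l and e :: real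
  proof -
    have [measurable]: "D (m + i) \<in> borel_measurable M" for i using that by (intro Dm) simp
    have "{\<omega> \<in> space M. osc m e l \<omega>} = {\<omega> \<in> space M. \<exists>j\<in>{..l}. e \<le> \<bar>\<Sum>i<j. D (m + i) \<omega>\<bar>}"
      by (auto simp: osc_def)
    also have "\<dots> \<in> sets M" by measurable
    finally show ?thesis .
  qed
  define tail where "tail = (\<lambda>m. \<Sum>i. (c (m + i))\<^sup>2)"
  have tail: "tail \<longlonglongrightarrow> 0"
    using suminf_exist_split2[OF c] by (simp add: tail_def add.commute)
  have null: "AE \<omega> in M. \<exists>m\<ge>n. \<forall>l. \<not> osc m e l \<omega>" if e: "0 < e" for e
  proof -
    define U where "U = (\<lambda>m. \<Union>l. {\<omega> \<in> space M. osc m e l \<omega>})"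
    have U: "prob (U m) \<le> tail m / e\<^sup>2" if m: "n \<le> m" for m
    proof (rule LIMSEQ_le_const2)
      show "(\<lambda>l. prob {\<omega> \<in> space M. osc m e l \<omega>}) \<longlonglongrightarrow> prob (U m)"
        unfolding U_def
      proof (intro finite_Lim_measure_incseq)
        show "range (\<lambda>l. {\<omega> \<in> space M. osc m e l \<omega>}) \<subseteq> events" using osc_sets[OF m] by blast
        show "incseq (\<lambda>l. {\<omega> \<in> space M. osc m e l \<omega>})"
          unfolding incseq_def osc_def by (blast intro: order_trans)
      qed
      have "prob {\<omega> \<in> space M. osc m e l \<omega>} \<le> tail m / e\<^sup>2" for l
      proof -
        have "prob {\<omega> \<in> space M. osc m e l \<omega>} \<le> (\<Sum>i<l. (c (m + i))\<^sup>2) / e\<^sup>2"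
          unfolding osc_def
          by (rule maximal_inequality_bounded_increments[OF filt sub]) (fact e | rule D_meas D_bound orth; use m in simp)+
        also have "\<dots> \<le> tail m / e\<^sup>2"
          unfolding tail_def
          using summable_ignore_initial_segment[OF c, of m]
          by (intro divide_right_mono sum_le_suminf) (simp_all add: add.commute)
        finally show ?thesis .
      qed
      then show "\<exists>N. \<forall>l\<ge>N. prob {\<omega> \<in> space M. osc m e l \<omega>} \<le> tail m / e\<^sup>2" by blast
    qed
    have Um: "U m \<in> sets M" if "n \<le> m" for m unfolding U_def using osc_sets[OF that] by blast
    define V where "V = (\<Inter>m\<in>{n..}. U m)"
    have V: "V \<in> sets M" unfolding V_def using Um by (intro sets.countable_INT') auto
    have "prob V \<le> 0"
    proof (rule LIMSEQ_le_const)
      show "(\<lambda>m. tail m / e\<^sup>2) \<longlonglongrightarrow> 0" using tendsto_divide[OF tail tendsto_const, of "e\<^sup>2"] e by simp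
      have "prob V \<le> tail m / e\<^sup>2" if "n \<le> m" for m
      proof -
        have "V \<subseteq> U m" using that by (auto simp: V_def)
        then show ?thesis using order_trans[OF finite_measure_mono[OF _ Um[OF that]] U[OF that]] by blast
      qed
      then show "\<exists>N. \<forall>m\<ge>N. prob V \<le> tail m / e\<^sup>2" by blast
    qed
    then have "prob V = 0" by (simp add: measure_le_0_iff)
    then have "V \<in> null_sets M" using V by (simp add: null_sets_def emeasure_eq_measure)
    then show ?thesis by (rule AE_I') (auto simp: V_def U_def)
  qed
  have "AE \<omega> in M. \<forall>k. \<exists>m\<ge>n. \<forall>l. \<not> osc m (1 / real (Suc k)) l \<omega>"
    by (subst AE_all_countable) (intro allI null, simp)
  then show ?thesis
  proof eventually_elim
    case (elim \<omega>)
    show ?case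
    proof (unfold summable_Cauchy, intro allI impI)
      fix e :: real assume "0 < e"
      then obtain k where k: "1 / real (Suc k) < e / 2" using nat_approx_posE[of "e / 2"] by auto
      obtain m where m: "m \<ge> n" "\<And>l. \<not> osc m (1 / real (Suc k)) l \<omega>" using elim by blast
      have small: "\<bar>\<Sum>i<j. D (m + i) \<omega>\<bar> < e / 2" for j
      proof -
        have "\<not> (1 / real (Suc k) \<le> \<bar>\<Sum>i<j. D (m + i) \<omega>\<bar>)" using m(2)[of j] unfolding osc_def by blast
        then show ?thesis using k by linarith
      qed
      have "norm (\<Sum>i\<in>{a..<b}. D i \<omega>) < e" if "m \<le> a" for a b
      proof (cases "a \<le> b")
        case True
        have *: "(\<Sum>i<j. D (m + i) \<omega>) = (\<Sum>i\<in>{m..<m + j}. D i \<omega>)" for j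
          using sum.shift_bounds_nat_ivl[of "\<lambda>i. D i \<omega>" 0 m j] by (simp add: lessThan_atLeast0 add.commute)
        \<comment> \<open>A block is the difference of two sums that start at the same
          \<open>m\<close>, each below \<open>e / 2\<close> in modulus.\<close>
        have "(\<Sum>i\<in>{a..<b}. D i \<omega>) = (\<Sum>i<b - m. D (m + i) \<omega>) - (\<Sum>i<a - m. D (m + i) \<omega>)"
          unfolding * using that True sum.atLeastLessThan_concat[of m a b "\<lambda>i. D i \<omega>"] by simp
        then show ?thesis using small[of "b - m"] small[of "a - m"]
            abs_triangle_ineq4[of "\<Sum>i<b - m. D (m + i) \<omega>" "\<Sum>i<a - m. D (m + i) \<omega>"] by simp
      qed (use \<open>0 < e\<close> in simp)
      then show "\<exists>N. \<forall>m\<ge>N. \<forall>n. norm (\<Sum>i\<in>{m..<n}. D i \<omega>) < e" by blast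
    qed
  qed
qed

text \<open>Monotone convergence: a nonnegative random series with finite total mean is finite
  almost everywhere.\<close>

lemma summable_expectation_AE_summable:
  fixes f :: "nat \<Rightarrow> 'a \<Rightarrow> real"
  assumes int: "\<And>k. integrable M (f k)" and nn: "\<And>k \<omega>. 0 \<le> f k \<omega>"
    and sum: "summable (\<lambda>k. expectation (f k))"
  shows "AE \<omega> in M. summable (\<lambda>k. f k \<omega>)"
proof -
  have [measurable]: "f k \<in> borel_measurable M" for k using int by auto
  have "(\<integral>\<^sup>+ \<omega>. (\<Sum>k. ennreal (f k \<omega>)) \<partial>M) = (\<Sum>k. \<integral>\<^sup>+ \<omega>. ennreal (f k \<omega>) \<partial>M)"
    by (rule nn_integral_suminf) simp
  also have "\<dots> = (\<Sum>k. ennreal (expectation (f k)))"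
    by (intro suminf_cong nn_integral_eq_integral int AE_I2 nn)
  also have "\<dots> = ennreal (\<Sum>k. expectation (f k))"
    using sum nn by (intro suminf_ennreal2) auto
  finally have "(\<integral>\<^sup>+ \<omega>. (\<Sum>k. ennreal (f k \<omega>)) \<partial>M) \<noteq> \<infinity>" by simp
  then have "AE \<omega> in M. (\<Sum>k. ennreal (f k \<omega>)) \<noteq> \<infinity>"
    by (intro nn_integral_PInf_AE) auto
  then show ?thesis
    by eventually_elim (auto intro!: summable_suminf_not_top nn simp: top_ennreal_def)
qed

text \<open>Freezing: on the event \<open>Z \<omega> = a\<close> the integrand is
  \<open>f \<omega> a\<close>, which is measurable in \<open>G\<close> and can be taken out of the
  conditional expectation of the indicator. \<open>Z\<close> is known only through its level sets
  over \<open>A\<close>, which is why measurability of \<open>f \<omega> (Z \<omega>)\<close> is a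
  premise of its own.\<close>

lemma expectation_finite_conditional_law:
  fixes Z :: "'a \<Rightarrow> 'z" and w f :: "'a \<Rightarrow> 'z \<Rightarrow> real" and h :: "'a \<Rightarrow> real"
  assumes sub: "subalgebra M G" and A: "finite A"
    and Z: "\<And>a. a \<in> A \<Longrightarrow> {\<omega> \<in> space M. Z \<omega> = a} \<in> sets M"
    and law: "\<And>a. a \<in> A \<Longrightarrow> AE \<omega> in M. real_cond_exp M G (indicator {\<omega> \<in> space M. Z \<omega> = a}) \<omega> = w \<omega> a"
    and total: "\<And>\<omega>. \<omega> \<in> space M \<Longrightarrow> (\<Sum>a\<in>A. w \<omega> a) = 1"
    and f: "\<And>a. a \<in> A \<Longrightarrow> (\<lambda>\<omega>. f \<omega> a) \<in> borel_measurable G"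
    and bound: "\<And>a. a \<in> A \<Longrightarrow> AE \<omega> in M. \<bar>f \<omega> a\<bar> \<le> B"
    and fZ_meas: "(\<lambda>\<omega>. f \<omega> (Z \<omega>)) \<in> borel_measurable M"
    and h_meas: "h \<in> borel_measurable M"
    and h: "AE \<omega> in M. h \<omega> = (\<Sum>a\<in>A. w \<omega> a * f \<omega> a)"
  shows "AE \<omega> in M. Z \<omega> \<in> A" and "expectation (\<lambda>\<omega>. f \<omega> (Z \<omega>)) = expectation h"
proof -
  have "sigma_finite_subalgebra M G"
    using sub by (intro finite_measure_subalgebra_is_sigma_finite)
      (auto simp: finite_measure_subalgebra_def finite_measure_subalgebra_axioms_def finite_measure_axioms)
  then interpret G: sigma_finite_subalgebra M G .
  define I where "I = (\<lambda>a \<omega>. indicator {\<omega> \<in> space M. Z \<omega> = a} \<omega> :: real)"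
  have law': "AE \<omega> in M. real_cond_exp M G (I a) \<omega> = w \<omega> a" if "a \<in> A" for a
    using law[OF that] by (simp add: I_def)
  have I [measurable]: "I a \<in> borel_measurable M" if "a \<in> A" for a
    unfolding I_def using Z[OF that] by measurable
  have single: "integrable M (\<lambda>\<omega>. u \<omega> * I a \<omega>) \<and> integrable M (\<lambda>\<omega>. u \<omega> * real_cond_exp M G (I a) \<omega>)
      \<and> expectation (\<lambda>\<omega>. u \<omega> * I a \<omega>) = expectation (\<lambda>\<omega>. u \<omega> * real_cond_exp M G (I a) \<omega>)"
    if a: "a \<in> A" and u: "u \<in> borel_measurable G" and ub: "AE \<omega> in M. \<bar>u \<omega>\<bar> \<le> C" for a u C
  proof -
    have uM: "u \<in> borel_measurable M" by (rule measurable_from_subalg[OF sub u])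
    have i: "integrable M (\<lambda>\<omega>. u \<omega> * I a \<omega>)"
    proof (rule integrable_AE_bounded)
      show "(\<lambda>\<omega>. u \<omega> * I a \<omega>) \<in> borel_measurable M" using uM I[OF a] by measurable
      show "AE \<omega> in M. \<bar>u \<omega> * I a \<omega>\<bar> \<le> C" using ub by eventually_elim (auto simp: I_def indicator_def)
    qed
    show ?thesis using i G.real_cond_exp_intg[OF i u I[OF a]] by auto
  qed
  have law_all: "AE \<omega> in M. \<forall>a\<in>A. real_cond_exp M G (I a) \<omega> = w \<omega> a"
    by (intro AE_finite_allI A law')
  have "expectation (\<lambda>\<omega>. \<Sum>a\<in>A. I a \<omega>) = expectation (\<lambda>\<omega>. \<Sum>a\<in>A. real_cond_exp M G (I a) \<omega>)"
    using single[of _ "\<lambda>_. 1" 1] by (simp add: Bochner_Integration.integral_sum)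
  also have "\<dots> = expectation (\<lambda>\<omega>. 1)"
  proof (rule integral_cong_AE)
    show "AE \<omega> in M. (\<Sum>a\<in>A. real_cond_exp M G (I a) \<omega>) = 1"
      using law_all AE_space by eventually_elim (simp add: total)
  qed auto
  \<comment> \<open>The weights have total mass 1, so the disjoint events
    \<open>Z \<omega> = a\<close> already exhaust the probability and \<open>Z\<close> lies in
    \<open>A\<close> almost surely.\<close>
  finally have one: "expectation (\<lambda>\<omega>. 1 - (\<Sum>a\<in>A. I a \<omega>)) = 0"
    using single[of _ "\<lambda>_. 1" 1] by (simp add: prob_space)
  have Isum: "(\<Sum>a\<in>A. I a \<omega> * v a) = (if Z \<omega> \<in> A then v (Z \<omega>) else 0)" if "\<omega> \<in> space M" for v \<omega>
    using that A by (simp add: I_def indicator_def if_distrib sum.delta cong: if_cong)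
  have "AE \<omega> in M. 1 - (\<Sum>a\<in>A. I a \<omega>) = 0"
  proof (subst integral_nonneg_eq_0_iff_AE[symmetric])
    show "integrable M (\<lambda>\<omega>. 1 - (\<Sum>a\<in>A. I a \<omega>))" using single[of _ "\<lambda>_. 1" 1] by simp
    show "AE \<omega> in M. 0 \<le> 1 - (\<Sum>a\<in>A. I a \<omega>)"
      using AE_space by eventually_elim (use Isum[of _ "\<lambda>_. 1"] in simp)
  qed (rule one)
  then show ZA: "AE \<omega> in M. Z \<omega> \<in> A"
    using AE_space by eventually_elim (use Isum[of _ "\<lambda>_. 1"] in \<open>auto split: if_splits\<close>)
  have fZ: "AE \<omega> in M. f \<omega> (Z \<omega>) = (\<Sum>a\<in>A. f \<omega> a * I a \<omega>)"
    using ZA AE_space by eventually_elim (simp add: Isum mult.commute[of "f _ _"])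
  note sf = single[OF _ f bound]
  have fM: "(\<lambda>\<omega>. f \<omega> a) \<in> borel_measurable M" if "a \<in> A" for a
    by (rule measurable_from_subalg[OF sub f[OF that]])
  have "expectation (\<lambda>\<omega>. f \<omega> (Z \<omega>)) = expectation (\<lambda>\<omega>. \<Sum>a\<in>A. f \<omega> a * I a \<omega>)"
    by (intro integral_cong_AE fZ fZ_meas borel_measurable_sum borel_measurable_times fM I)
  also have "\<dots> = expectation (\<lambda>\<omega>. \<Sum>a\<in>A. f \<omega> a * real_cond_exp M G (I a) \<omega>)"
    using sf by (simp add: Bochner_Integration.integral_sum)
  also have "\<dots> = expectation h"
  proof (intro integral_cong_AE h_meas borel_measurable_sum borel_measurable_times fM)
    show "AE \<omega> in M. (\<Sum>a\<in>A. f \<omega> a * real_cond_exp M G (I a) \<omega>) = h \<omega>"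
      using law_all h by eventually_elim (simp add: mult.commute)
  qed auto
  finally show "expectation (\<lambda>\<omega>. f \<omega> (Z \<omega>)) = expectation h" .
qed

end

section \<open>Score functions and Gateaux derivatives\<close>

lemma pmf_embed_prob_simplex:
  fixes p :: "real ^ 'm::finite"
  assumes "p \<in> prob_simplex"
  shows "pmf (embed_pmf (\<lambda>i. p $ i)) i = p $ i"
proof (rule pmf_embed_pmf)
  show nn: "0 \<le> p $ i" for i using assms by (simp add: prob_simplex_def)
  have "(\<integral>\<^sup>+i. ennreal (p $ i) \<partial>count_space UNIV) = ennreal (\<Sum>i\<in>UNIV. p $ i)"
    by (subst nn_integral_count_space_finite) (auto simp: nn intro!: sum_ennreal)
  then show "(\<integral>\<^sup>+i. ennreal (p $ i) \<partial>count_space UNIV) = 1"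
    using assms by (simp add: prob_simplex_def)
qed

text \<open>Pulling \<open>z\<close> out of the product also transforms the default value, so the
  default is exchanged first; over \<open>UNIV\<close> it is never attained. Sampling thus becomes
  the choice of an index word, and on the simplex expectations are polynomials in
  \<open>p\<close>.\<close>

lemma process_pmf_eq_map:
  "(process_pmf z p :: ('t::finite \<Rightarrow> 'x) pmf) =
     map_pmf (\<lambda>x t. z (x t)) (Pi_pmf UNIV undefined (\<lambda>_. embed_pmf (\<lambda>i. p $ i)))"
proof -
  have "(process_pmf z p :: ('t \<Rightarrow> 'x) pmf) =
      Pi_pmf UNIV (z undefined) (\<lambda>_. map_pmf z (embed_pmf (\<lambda>i. p $ i)))"
    using Pi_pmf_default_swap[of "UNIV :: 't set" undefined "z undefined"]
    by (simp add: process_pmf_def input_pmf_def)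
  then show ?thesis by (simp add: Pi_pmf_map[where dflt = undefined] o_def)
qed

lemma set_process_pmf: "set_pmf (process_pmf z p) \<subseteq> range (\<lambda>x t. z (x t))"
  by (auto simp: process_pmf_eq_map)

lemma finite_set_process_pmf:
  fixes z :: "'m::finite \<Rightarrow> 'x"
  shows "finite (set_pmf (process_pmf z p :: ('t::finite \<Rightarrow> 'x) pmf))"
  by (rule finite_subset[OF set_process_pmf]) simp

lemma process_exp_eq_sum:
  fixes f :: "('t::finite \<Rightarrow> 'x) \<Rightarrow> real" and p :: "real ^ 'm::finite"
  assumes "p \<in> prob_simplex"
  shows "process_exp z p f = (\<Sum>x\<in>UNIV. (\<Prod>t\<in>UNIV. p $ x t) * f (\<lambda>t. z (x t)))"
proof -
  have "pmf (Pi_pmf UNIV undefined (\<lambda>_. embed_pmf (\<lambda>i. p $ i))) x = (\<Prod>t\<in>UNIV. p $ x t)" for x :: "'t \<Rightarrow> 'm"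
    by (subst pmf_Pi') (auto simp: pmf_embed_prob_simplex[OF assms])
  then show ?thesis
    unfolding process_exp_def process_pmf_eq_map by (simp add: integral_measure_pmf[of UNIV])
qed

lemma process_exp_of_bool_bounds:
  fixes P :: "('t::finite \<Rightarrow> 'x) \<Rightarrow> bool" and z :: "'m::finite \<Rightarrow> 'x"
  shows "0 \<le> process_exp z p (\<lambda>x. of_bool (P x))" "process_exp z p (\<lambda>x. of_bool (P x)) \<le> 1"
proof -
  show "0 \<le> process_exp z p (\<lambda>x. of_bool (P x))" unfolding process_exp_def by (rule Bochner_Integration.integral_nonneg) simp
  have "process_exp z p (\<lambda>x. of_bool (P x)) \<le> measure_pmf.expectation (process_pmf z p) (\<lambda>_ :: 't \<Rightarrow> 'x. 1)"
    unfolding process_exp_def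
    by (intro Bochner_Integration.integral_mono integrable_measure_pmf_finite finite_set_process_pmf) auto
  then show "process_exp z p (\<lambda>x. of_bool (P x)) \<le> 1" by simp
qed

text \<open>Products of numbers of modulus at most 1 differ by at most the sum of the differences of
  their factors. The constant counts the index words and the letters of each word.\<close>

lemma process_exp_lipschitz:
  fixes P :: "('t::finite \<Rightarrow> 'x) \<Rightarrow> bool" and p r :: "real ^ 'm::finite"
  assumes p: "p \<in> prob_simplex" and r: "r \<in> prob_simplex"
  shows "\<bar>process_exp z p (\<lambda>x. of_bool (P x)) - process_exp z r (\<lambda>x. of_bool (P x))\<bar>
           \<le> real CARD('t \<Rightarrow> 'm) * real CARD('t) * norm (p - r)"
proof -
  have le1: "norm (v $ i) \<le> 1" if "v \<in> prob_simplex" for v :: "real ^ 'm" and i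
    using that member_le_sum[of i UNIV "\<lambda>i. v $ i"] by (auto simp: prob_simplex_def)
  have "\<bar>process_exp z p (\<lambda>x. of_bool (P x)) - process_exp z r (\<lambda>x. of_bool (P x))\<bar>
      = \<bar>\<Sum>x\<in>UNIV. ((\<Prod>t\<in>UNIV. p $ x t) - (\<Prod>t\<in>UNIV. r $ x t)) * of_bool (P (\<lambda>t. z (x t)))\<bar>"
    by (simp add: process_exp_eq_sum p r sum_subtractf left_diff_distrib)
  also have "\<dots> \<le> (\<Sum>x\<in>(UNIV :: ('t \<Rightarrow> 'm) set). \<Sum>t\<in>(UNIV :: 't set). norm (p - r))"
  proof (rule order_trans[OF sum_abs sum_mono])
    fix x :: "'t \<Rightarrow> 'm"
    have "\<bar>((\<Prod>t\<in>UNIV. p $ x t) - (\<Prod>t\<in>UNIV. r $ x t)) * of_bool (P (\<lambda>t. z (x t)))\<bar>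
        \<le> norm ((\<Prod>t\<in>UNIV. p $ x t) - (\<Prod>t\<in>UNIV. r $ x t))" by (auto simp: abs_mult)
    also have "\<dots> \<le> (\<Sum>t\<in>UNIV. norm (p $ x t - r $ x t))"
      by (intro norm_prod_diff le1 p r)
    also have "\<dots> \<le> (\<Sum>t\<in>(UNIV :: 't set). norm (p - r))"
      by (intro sum_mono) (use component_le_norm_cart[of "p - r"] in simp)
    finally show "\<bar>((\<Prod>t\<in>UNIV. p $ x t) - (\<Prod>t\<in>UNIV. r $ x t)) * of_bool (P (\<lambda>t. z (x t)))\<bar>
        \<le> (\<Sum>t\<in>(UNIV :: 't set). norm (p - r))" .
  qed
  finally show ?thesis by (simp add: mult_ac)
qed

text \<open>The mean of the likelihood ratio estimator. On positive masses it is the Gateaux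
  derivative of \<open>process_exp z p f\<close>, in a form whose continuity in \<open>p\<close> is
  visible.\<close>

definition score_mean ::
    "('m::finite \<Rightarrow> 'x) \<Rightarrow> (('t::finite \<Rightarrow> 'x) \<Rightarrow> real) \<Rightarrow> real ^ 'm \<Rightarrow> real ^ 'm" where
  "score_mean z f p = (\<chi> i. process_exp z p (\<lambda>x. f x * score z i x p))"

lemma continuous_on_score_mean:
  assumes "0 < \<epsilon>"
  shows "continuous_on (prob_simplex_ge \<epsilon>) (score_mean z f)"
proof -
  have "v $ i \<noteq> 0" if "v \<in> prob_simplex_ge \<epsilon>" for v :: "real ^ 'm::finite" and i
    using prob_simplex_geD(2)[OF that, of i] assms by simp
  then have "continuous_on (prob_simplex_ge \<epsilon>) (\<lambda>p. \<chi> i. \<Sum>x\<in>UNIV. (\<Prod>t\<in>UNIV. p $ x t) *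
      (f (\<lambda>t. z (x t)) * score z i (\<lambda>t. z (x t)) p))"
    unfolding score_def by (intro continuous_intros) auto
  then show ?thesis
    by (rule continuous_on_eq) (auto simp: score_mean_def process_exp_eq_sum prob_simplex_geD(1) vec_eq_iff)
qed

lemma continuous_on_process_exp:
  "continuous_on (prob_simplex_ge \<epsilon>) (\<lambda>p. process_exp z p f)"
proof (rule continuous_on_eq)
  show "continuous_on (prob_simplex_ge \<epsilon>) (\<lambda>p. \<Sum>x\<in>UNIV. (\<Prod>t\<in>UNIV. p $ x t) * f (\<lambda>t. z (x t)))"
    by (intro continuous_intros)
qed (auto simp: process_exp_eq_sum prob_simplex_geD(1))

text \<open>Logarithmic differentiation of each product of masses: moving towards the unit vector
  \<open>i\<close> changes the mass of letter \<open>j\<close> at rate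
  \<open>of_bool (j = i) - p $ j\<close>; divided by \<open>p $ j\<close> and summed over the word
  this is the score.\<close>

lemma process_exp_has_derivative:
  fixes z :: "'m::finite \<Rightarrow> 'x" and f :: "('t::finite \<Rightarrow> 'x) \<Rightarrow> real"
  assumes z: "inj z" and p: "p \<in> prob_simplex" and pos: "\<And>i. 0 < p $ i"
  shows "((\<lambda>\<delta>. process_exp z ((1 - \<delta>) *\<^sub>R p + \<delta> *\<^sub>R axis i 1) f) has_real_derivative
            score_mean z f p $ i) (at_right 0)"
proof -
  define u where "u = (\<lambda>\<delta> j. (1 - \<delta>) * p $ j + \<delta> * of_bool (j = i))"
  have seg: "((1 - \<delta>) *\<^sub>R p + \<delta> *\<^sub>R axis i 1) $ j = u \<delta> j" for \<delta> j
    by (auto simp: u_def axis_def)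
  have in_simplex: "(1 - \<delta>) *\<^sub>R p + \<delta> *\<^sub>R axis i 1 \<in> prob_simplex" if "0 \<le> \<delta>" "\<delta> \<le> 1" for \<delta>
  proof -
    have "(\<Sum>j\<in>UNIV. u \<delta> j) = 1"
      using p by (simp add: u_def sum.distrib of_bool_def if_distrib[of "\<lambda>x. \<delta> * x"] prob_simplex_def
        cong: if_cong flip: sum_distrib_left)
    moreover have "0 \<le> u \<delta> j" for j using that pos[of j] by (simp add: u_def)
    ultimately show ?thesis unfolding prob_simplex_def mem_Collect_eq seg by simp
  qed
  \<comment> \<open>The polynomial is differentiated at 0 from both sides. Its agreement with
    \<open>process_exp\<close> is only claimed for \<delta> between 0 and 1, where the segment lies
    in the simplex and \<open>embed_pmf\<close> is meaningful; this explains the passage to the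
    one-sided derivative.\<close>
  define Q where "Q = (\<lambda>\<delta>. \<Sum>x\<in>UNIV. (\<Prod>t\<in>UNIV. u \<delta> (x t)) * f (\<lambda>t. z (x t)))"
  have "(Q has_real_derivative (\<Sum>x\<in>UNIV. ((\<Prod>t\<in>UNIV. u 0 (x t)) *
      (\<Sum>t\<in>UNIV. (of_bool (x t = i) - p $ x t) / u 0 (x t))) * f (\<lambda>t. z (x t)))) (at 0)"
    unfolding Q_def
  proof (intro DERIV_sum DERIV_cmult_right has_field_derivative_prod')
    fix x :: "'t \<Rightarrow> 'm" and t
    show "u 0 (x t) \<noteq> 0" using pos[of "x t"] by (simp add: u_def)
    show "((\<lambda>\<delta>. u \<delta> (x t)) has_real_derivative of_bool (x t = i) - p $ x t) (at 0)"
      unfolding u_def by (auto intro!: derivative_eq_intros)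
  qed
  also have "(\<Sum>x\<in>UNIV. ((\<Prod>t\<in>UNIV. u 0 (x t)) *
      (\<Sum>t\<in>UNIV. (of_bool (x t = i) - p $ x t) / u 0 (x t))) * f (\<lambda>t. z (x t))) = score_mean z f p $ i"
  proof -
    have "(\<Sum>t\<in>UNIV. (of_bool (x t = i) - p $ x t) / p $ x t) = score z i (\<lambda>t. z (x t)) p" for x :: "'t \<Rightarrow> 'm"
    proof -
      \<comment> \<open>Distinct support points are needed here: the score sees
        \<open>z (x t)\<close>, whereas the derivative sees the index \<open>x t\<close>.\<close>
      have "(of_bool (x t = i) - p $ x t) / p $ x t = of_bool (z (x t) = z i) / p $ i - 1" for t
        using pos[of "x t"] by (auto simp: inj_eq[OF z] diff_divide_distrib)
      then show ?thesis by (simp add: score_def sum_subtractf)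
    qed
    then show ?thesis
      by (simp add: score_mean_def process_exp_eq_sum[OF p] u_def mult_ac)
  qed
  finally have "(Q has_real_derivative score_mean z f p $ i) (at_right 0)"
    by (rule has_field_derivative_at_within)
  moreover have eq: "Q \<delta> = process_exp z ((1 - \<delta>) *\<^sub>R p + \<delta> *\<^sub>R axis i 1) f" if "0 \<le> \<delta>" "\<delta> \<le> 1" for \<delta>
    using that unfolding Q_def by (subst process_exp_eq_sum[OF in_simplex]) (simp_all only: seg)
  moreover have "\<forall>\<^sub>F \<delta> in at_right 0. Q \<delta> = process_exp z ((1 - \<delta>) *\<^sub>R p + \<delta> *\<^sub>R axis i 1) f"
    using eventually_at_right_real[OF zero_less_one] by eventually_elim (rule eq, auto)
  ultimately show ?thesis
    by (subst has_field_derivative_cong_eventually[symmetric, where f = Q]) (auto intro: eq)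
qed

lemma gateaux_eqI:
  assumes "\<And>i. ((\<lambda>\<delta>. f ((1 - \<delta>) *\<^sub>R p + \<delta> *\<^sub>R axis i 1)) has_real_derivative (d $ i)) (at_right 0)"
  shows "gateaux f p = d"
  unfolding gateaux_def vec_eq_iff
  using assms by (auto intro!: vector_derivative_within simp: has_real_derivative_iff_has_vector_derivative)

lemma gateaux_psi:
  assumes "inj z" "p \<in> prob_simplex" "\<And>i. 0 < p $ i"
  shows "gateaux (psi z g) p = score_mean z g p"
  unfolding psi_def by (intro gateaux_eqI process_exp_has_derivative assms)

text \<open>Gradient in \<open>p\<close> of the sum of
  \<open>(output_cdf z h y p j - s $ j)\<^sup>2\<close> with \<open>s\<close> held fixed. It is
  affine in \<open>s\<close>, so an error in \<open>s\<close> enters linearly.\<close>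

definition tracking_gradient ::
    "('m::finite \<Rightarrow> 'x) \<Rightarrow> (('t::finite \<Rightarrow> 'x) \<Rightarrow> real) \<Rightarrow> real ^ 'n::finite \<Rightarrow> real ^ 'n \<Rightarrow> real ^ 'm \<Rightarrow> real ^ 'm" where
  "tracking_gradient z h y s p = 2 *\<^sub>R (\<Sum>j\<in>UNIV. (output_cdf z h y p j - s $ j) *\<^sub>R
     score_mean z (\<lambda>x. of_bool (h x \<le> y $ j)) p)"

text \<open>The derivative of the squared distance to the band is twice the residual, so the motion
  of the projection does not contribute; hence the projection may be inserted for \<open>s\<close>
  as though it were constant.\<close>

lemma gateaux_penalty:
  assumes z: "inj z" and p: "p \<in> prob_simplex" and pos: "\<And>i. 0 < p $ i"
    and bands: "\<And>j. lower_bd y q j \<le> upper_bd y q j"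
  shows "gateaux (penalty z h y q) p = tracking_gradient z h y (\<chi> j. band_proj y q j (output_cdf z h y p j)) p"
proof (rule gateaux_eqI)
  fix i
  define w where "w = (\<lambda>\<delta>. (1 - \<delta>) *\<^sub>R p + \<delta> *\<^sub>R axis i 1)"
  define c where "c = (\<lambda>\<delta> j. output_cdf z h y (w \<delta>) j)"
  have w0: "c 0 j = output_cdf z h y p j" for j by (simp add: c_def w_def)
  have c: "((\<lambda>\<delta>. c \<delta> j) has_real_derivative score_mean z (\<lambda>x. of_bool (h x \<le> y $ j)) p $ i) (at_right 0)" for j
    using process_exp_has_derivative[OF z p pos] by (simp add: c_def w_def output_cdf_def)
  have "((\<lambda>\<delta>. (c \<delta> j - band_proj y q j (c \<delta> j))\<^sup>2) has_real_derivative
      2 * (c 0 j - band_proj y q j (c 0 j)) * score_mean z (\<lambda>x. of_bool (h x \<le> y $ j)) p $ i) (at_right 0)" for j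
    unfolding band_proj_def
    using DERIV_chain2[OF DERIV_sq_dist_interval[OF bands[of j]] c[of j]] by simp
  then have "((\<lambda>\<delta>. \<Sum>j\<in>UNIV. (c \<delta> j - band_proj y q j (c \<delta> j))\<^sup>2) has_real_derivative
      (\<Sum>j\<in>UNIV. 2 * (c 0 j - band_proj y q j (c 0 j)) * score_mean z (\<lambda>x. of_bool (h x \<le> y $ j)) p $ i)) (at_right 0)"
    by (rule DERIV_sum)
  then show "((\<lambda>\<delta>. penalty z h y q ((1 - \<delta>) *\<^sub>R p + \<delta> *\<^sub>R axis i 1)) has_real_derivative
      tracking_gradient z h y (\<chi> j. band_proj y q j (output_cdf z h y p j)) p $ i) (at_right 0)"
    by (simp add: w0 c_def w_def penalty_def tracking_gradient_def sum_distrib_left algebra_simps)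
qed

section \<open>Finite laws of the simulation batches and unbiasedness of the estimators\<close>

definition batch_pmf :: "nat \<Rightarrow> 'a pmf \<Rightarrow> (nat \<Rightarrow> 'a) pmf" where
  "batch_pmf K P = Pi_pmf {..<K} undefined (\<lambda>_. P)"

lemma finite_set_batch_pmf: "finite (set_pmf P) \<Longrightarrow> finite (set_pmf (batch_pmf K P))"
  by (auto simp: batch_pmf_def set_Pi_pmf)

lemma expectation_batch_component:
  fixes f :: "'a \<Rightarrow> real"
  assumes "r < K"
  shows "measure_pmf.expectation (batch_pmf K P) (\<lambda>x. f (x r)) = measure_pmf.expectation P f"
proof -
  have "measure_pmf.expectation (batch_pmf K P) (\<lambda>x. f (x r)) =
      measure_pmf.expectation (map_pmf (\<lambda>x. x r) (batch_pmf K P)) f" by simp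
  then show ?thesis using assms by (simp add: batch_pmf_def Pi_pmf_component del: integral_map_pmf)
qed

lemma expectation_batch_average:
  fixes f :: "'a \<Rightarrow> real"
  assumes "finite (set_pmf P)" "0 < K"
  shows "measure_pmf.expectation (batch_pmf K P) (\<lambda>x. 1 / real K * (\<Sum>r<K. f (x r))) = measure_pmf.expectation P f"
  using assms
  by (simp add: Bochner_Integration.integral_sum integrable_measure_pmf_finite finite_set_batch_pmf expectation_batch_component)

lemma expectation_pair_pmf_prod:
  fixes f :: "'a \<Rightarrow> real" and g :: "'b \<Rightarrow> real"
  assumes "finite (set_pmf P)" "finite (set_pmf R)"
  shows "measure_pmf.expectation (pair_pmf P R) (\<lambda>x. f (fst x) * g (snd x)) =
    measure_pmf.expectation P f * measure_pmf.expectation R g"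
proof -
  have "measure_pmf.expectation (pair_pmf P R) (\<lambda>x. f (fst x) * g (snd x)) =
      (\<Sum>x\<in>set_pmf P \<times> set_pmf R. pmf (pair_pmf P R) x *\<^sub>R (f (fst x) * g (snd x)))"
    using assms by (intro integral_measure_pmf) auto
  also have "\<dots> = (\<Sum>x\<in>set_pmf P. \<Sum>y\<in>set_pmf R. (pmf P x * f x) * (pmf R y * g y))"
    unfolding sum.cartesian_product by (intro sum.cong refl) (auto simp: pmf_pair)
  also have "\<dots> = measure_pmf.expectation P f * measure_pmf.expectation R g"
    using assms by (simp add: integral_measure_pmf[of "set_pmf P"] integral_measure_pmf[of "set_pmf R"] sum_product)
  finally show ?thesis .
qed


definition sample_pmf ::
    "('m::finite \<Rightarrow> 'x) \<Rightarrow> nat \<Rightarrow> nat \<Rightarrow> nat \<Rightarrow> real ^ 'm \<Rightarrow>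
     ((nat \<Rightarrow> 't::finite \<Rightarrow> 'x) \<times> (nat \<Rightarrow> 't \<Rightarrow> 'x) \<times> (nat \<Rightarrow> 's::finite \<Rightarrow> 'x)) pmf" where
  "sample_pmf z M1 M2 M3 p = pair_pmf (batch_pmf M1 (process_pmf z p))
     (pair_pmf (batch_pmf M2 (process_pmf z p)) (batch_pmf M3 (process_pmf z p)))"

text \<open>Chosen independently of \<open>p\<close>, so that sums over outcomes have the same index
  set for every value of the random iterate.\<close>

definition batch_support :: "('m::finite \<Rightarrow> 'x) \<Rightarrow> nat \<Rightarrow> (nat \<Rightarrow> 't::finite \<Rightarrow> 'x) set" where
  "batch_support z K = PiE_dflt {..<K} undefined (\<lambda>_. range (\<lambda>x t. z (x t)))"

lemma finite_batch_support: "finite (batch_support z K)"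
  by (auto simp: batch_support_def)

lemma PiE_dflt_mono: "(\<And>x. x \<in> A \<Longrightarrow> B x \<subseteq> C x) \<Longrightarrow> PiE_dflt A d B \<subseteq> PiE_dflt A d C"
  by (auto simp: PiE_dflt_def)

lemma set_batch_pmf_subset: "set_pmf (batch_pmf K (process_pmf z p)) \<subseteq> batch_support z K"
  unfolding batch_pmf_def batch_support_def set_Pi_pmf[OF finite_lessThan]
  by (rule PiE_dflt_mono) (simp add: set_process_pmf)

lemma pmf_batch:
  assumes "x \<in> batch_support z K"
  shows "pmf (batch_pmf K P) x = (\<Prod>r<K. pmf P (x r))"
  using assms unfolding batch_pmf_def batch_support_def
  by (subst pmf_Pi') (auto simp: PiE_dflt_def)

definition sample_support ::
    "('m::finite \<Rightarrow> 'x) \<Rightarrow> nat \<Rightarrow> nat \<Rightarrow> nat \<Rightarrow>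
     ((nat \<Rightarrow> 't::finite \<Rightarrow> 'x) \<times> (nat \<Rightarrow> 't \<Rightarrow> 'x) \<times> (nat \<Rightarrow> 's::finite \<Rightarrow> 'x)) set" where
  "sample_support z M1 M2 M3 = batch_support z M1 \<times> batch_support z M2 \<times> batch_support z M3"

lemma finite_sample_support: "finite (sample_support z M1 M2 M3)"
  by (simp add: sample_support_def finite_batch_support)

lemma set_sample_pmf_subset: "set_pmf (sample_pmf z M1 M2 M3 p) \<subseteq> sample_support z M1 M2 M3"
  unfolding sample_pmf_def sample_support_def set_pair_pmf by (intro Sigma_mono set_batch_pmf_subset)

lemma pmf_sample:
  assumes "(x, x', x'') \<in> sample_support z M1 M2 M3"
  shows "pmf (sample_pmf z M1 M2 M3 p) (x, x', x'') =
    (\<Prod>r<M1. pmf (process_pmf z p) (x r)) * (\<Prod>r<M2. pmf (process_pmf z p) (x' r)) *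
    (\<Prod>r<M3. pmf (process_pmf z p) (x'' r))"
  using assms by (simp add: sample_pmf_def sample_support_def pmf_pair pmf_batch[of _ z] mult.assoc)

lemma sum_pmf_sample_mult:
  fixes f :: "_ \<Rightarrow> real"
  shows "(\<Sum>a\<in>sample_support z M1 M2 M3. pmf (sample_pmf z M1 M2 M3 p) a * f a) =
    measure_pmf.expectation (sample_pmf z M1 M2 M3 p) f"
  by (subst integral_measure_pmf[OF finite_sample_support]) (auto intro: subsetD[OF set_sample_pmf_subset])

lemma sum_pmf_sample: "(\<Sum>a\<in>sample_support z M1 M2 M3. pmf (sample_pmf z M1 M2 M3 p) a) = 1"
  by (rule sum_pmf_eq_1[OF finite_sample_support set_sample_pmf_subset])

lemma integrable_sample_pmf:
  fixes f :: "_ \<Rightarrow> real"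
  shows "integrable (measure_pmf (sample_pmf z M1 M2 M3 p)) f"
  by (rule integrable_measure_pmf_finite[OF finite_subset[OF set_sample_pmf_subset finite_sample_support]])

text \<open>Here the two batches are needed: independence of the first from the second factorizes
  the mean of the product into the deviation of the output distribution and its derivative.\<close>

lemma expectation_phi_p_hat:
  fixes z :: "'m::finite \<Rightarrow> 'x" and h :: "('t::finite \<Rightarrow> 'x) \<Rightarrow> real" and p :: "real ^ 'm" and M1 M2 M3 :: nat
  assumes M_pos: "0 < M1" "0 < M2"
  defines "Q \<equiv> (sample_pmf z M1 M2 M3 p :: ((nat \<Rightarrow> 't \<Rightarrow> 'x) \<times> (nat \<Rightarrow> 't \<Rightarrow> 'x) \<times> (nat \<Rightarrow> 's::finite \<Rightarrow> 'x)) pmf)"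
  shows "measure_pmf.expectation Q (\<lambda>a. phi_p_hat z h y M1 M2 p s (fst a) (fst (snd a)) $ i) =
     tracking_gradient z h y s p $ i"
proof -
  have integrable_Q: "integrable (measure_pmf Q) f" for f :: "_ \<Rightarrow> real"
    unfolding Q_def by (rule integrable_sample_pmf)
  define A where "A = (\<lambda>j (x :: nat \<Rightarrow> 't \<Rightarrow> 'x). 1 / real M1 * (\<Sum>r<M1. (of_bool (h (x r) \<le> y $ j) - s $ j)))"
  define B where "B = (\<lambda>j (x :: nat \<Rightarrow> 't \<Rightarrow> 'x). 1 / real M2 * (\<Sum>r<M2. of_bool (h (x r) \<le> y $ j) * score z i (x r) p))"
  have EA: "measure_pmf.expectation (batch_pmf M1 (process_pmf z p)) (A j) = output_cdf z h y p j - s $ j" for j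
    unfolding A_def using M_pos
    by (subst expectation_batch_average)
      (auto simp: finite_set_process_pmf output_cdf_def process_exp_def integrable_measure_pmf_finite)
  have EB: "measure_pmf.expectation (batch_pmf M2 (process_pmf z p)) (B j) =
      score_mean z (\<lambda>x. of_bool (h x \<le> y $ j)) p $ i" for j
    unfolding B_def using M_pos
    by (subst expectation_batch_average) (auto simp: finite_set_process_pmf score_mean_def process_exp_def)
  have fin: "finite (set_pmf (batch_pmf K (process_pmf z p :: ('u::finite \<Rightarrow> 'x) pmf)))" for K
    by (intro finite_set_batch_pmf finite_set_process_pmf)
  have "measure_pmf.expectation Q (\<lambda>a. A j (fst a) * B j (fst (snd a))) =
      (output_cdf z h y p j - s $ j) * score_mean z (\<lambda>x. of_bool (h x \<le> y $ j)) p $ i" for j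
    unfolding Q_def sample_pmf_def
    by (subst expectation_pair_pmf_prod[where f = "A j" and g = "\<lambda>u. B j (fst u)"])
      (simp_all add: fin EA EB expectation_pair_pmf_fst[where f = "B j"])
  then have "measure_pmf.expectation Q (\<lambda>a. 2 * (\<Sum>j\<in>UNIV. A j (fst a) * B j (fst (snd a)))) =
      tracking_gradient z h y s p $ i"
    by (simp add: Bochner_Integration.integral_sum integrable_Q tracking_gradient_def sum_distrib_left)
  then show ?thesis by (simp add: phi_p_hat_def A_def B_def)
qed

lemma expectation_Psi_hat:
  fixes z :: "'m::finite \<Rightarrow> 'x" and g :: "('s::finite \<Rightarrow> 'x) \<Rightarrow> real" and p :: "real ^ 'm" and M1 M2 M3 :: nat
  assumes M_pos: "0 < M3"
  defines "Q \<equiv> (sample_pmf z M1 M2 M3 p :: ((nat \<Rightarrow> 't::finite \<Rightarrow> 'x) \<times> (nat \<Rightarrow> 't::finite \<Rightarrow> 'x) \<times> (nat \<Rightarrow> 's \<Rightarrow> 'x)) pmf)"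
  shows "measure_pmf.expectation Q (\<lambda>a. Psi_hat z g M3 p (snd (snd a)) $ i) = score_mean z g p $ i"
proof -
  have "measure_pmf.expectation Q (\<lambda>a. Psi_hat z g M3 p (snd (snd a)) $ i) =
      measure_pmf.expectation (batch_pmf M3 (process_pmf z p)) (\<lambda>x. Psi_hat z g M3 p x $ i)"
    unfolding Q_def sample_pmf_def
    by (simp add: expectation_pair_pmf_snd[where f = "\<lambda>u. Psi_hat z g M3 p (snd u) $ i"]
        expectation_pair_pmf_snd[where f = "\<lambda>u. Psi_hat z g M3 p u $ i"])
  also have "\<dots> = score_mean z g p $ i"
    unfolding Psi_hat_def
    using expectation_batch_average[OF finite_set_process_pmf M_pos, of z p "\<lambda>x. g x * score z i x p"]
    by (simp add: score_mean_def process_exp_def)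
  finally show ?thesis .
qed

text \<open>All \<open>M1 + M2\<close> samples have the same law, so both batches can be pooled. The
  mean is the derivative of \<open>(output_cdf z h y p j - s $ j)\<^sup>2\<close> in
  \<open>s $ j\<close>, which makes the update of \<open>s\<close> a projected stochastic gradient
  step.\<close>

lemma expectation_phi_s_hat:
  fixes z :: "'m::finite \<Rightarrow> 'x" and h :: "('t::finite \<Rightarrow> 'x) \<Rightarrow> real" and p :: "real ^ 'm" and M1 M2 M3 :: nat
  assumes M_pos: "0 < M1" "0 < M2"
  defines "Q \<equiv> (sample_pmf z M1 M2 M3 p :: ((nat \<Rightarrow> 't \<Rightarrow> 'x) \<times> (nat \<Rightarrow> 't \<Rightarrow> 'x) \<times> (nat \<Rightarrow> 's::finite \<Rightarrow> 'x)) pmf)"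
  shows "measure_pmf.expectation Q (\<lambda>a. phi_s_hat h y M1 M2 s (fst a) (fst (snd a)) $ j) =
     - 2 * (output_cdf z h y p j - s $ j)"
proof -
  have integrable_Q: "integrable (measure_pmf Q) f" for f :: "_ \<Rightarrow> real"
    unfolding Q_def by (rule integrable_sample_pmf)
  define A where "A = (\<lambda>K (x :: nat \<Rightarrow> 't \<Rightarrow> 'x). (\<Sum>r<K. (of_bool (h (x r) \<le> y $ j) - s $ j)))"
  have EA: "measure_pmf.expectation (batch_pmf K (process_pmf z p)) (A K) = real K * (output_cdf z h y p j - s $ j)" for K
    unfolding A_def
    by (simp add: Bochner_Integration.integral_sum integrable_measure_pmf_finite finite_set_batch_pmf
        finite_set_process_pmf expectation_batch_component[where f = "\<lambda>x. of_bool (h x \<le> y $ j) - s $ j"]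
        expectation_batch_component[where f = "\<lambda>x. of_bool (h x \<le> y $ j)"] output_cdf_def process_exp_def right_diff_distrib)
  have "measure_pmf.expectation Q (\<lambda>a. - (2 / (real M1 + real M2)) * (A M1 (fst a) + A M2 (fst (snd a)))) =
      - (2 / (real M1 + real M2)) * (measure_pmf.expectation Q (\<lambda>a. A M1 (fst a)) +
        measure_pmf.expectation Q (\<lambda>a. A M2 (fst (snd a))))"
    by (simp only: integral_mult_right_zero Bochner_Integration.integral_add integrable_Q)
  also have "measure_pmf.expectation Q (\<lambda>a. A M1 (fst a)) = real M1 * (output_cdf z h y p j - s $ j)"
    unfolding Q_def sample_pmf_def by (simp add: EA)
  also have "measure_pmf.expectation Q (\<lambda>a. A M2 (fst (snd a))) = real M2 * (output_cdf z h y p j - s $ j)"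
    unfolding Q_def sample_pmf_def by (simp add: EA expectation_pair_pmf_snd[where f = "\<lambda>u. A M2 (fst u)"]
        expectation_pair_pmf_fst[where f = "A M2"])
  also have "- (2 / (real M1 + real M2)) * (real M1 * (output_cdf z h y p j - s $ j) + real M2 * (output_cdf z h y p j - s $ j)) =
      - 2 * (output_cdf z h y p j - s $ j)"
    using M_pos by (simp add: field_simps)
  finally show ?thesis by (simp add: phi_s_hat_def A_def)
qed

section \<open>The stochastic recursion\<close>

definition search_direction where
  "search_direction z h g y M1 M2 M3 l p s a =
     l *\<^sub>R Psi_hat z g M3 p (snd (snd a)) + phi_p_hat z h y M1 M2 p s (fst a) (fst (snd a))"

definition mean_direction where
  "mean_direction z h g y l p s = l *\<^sub>R score_mean z g p + tracking_gradient z h y s p"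

lemma expectation_search_direction:
  fixes z :: "'m::finite \<Rightarrow> 'x" and h :: "('t::finite \<Rightarrow> 'x) \<Rightarrow> real" and g :: "('s::finite \<Rightarrow> 'x) \<Rightarrow> real"
  assumes "0 < M1" "0 < M2" "0 < M3"
  shows "measure_pmf.expectation (sample_pmf z M1 M2 M3 p)
      (\<lambda>a. search_direction z h g y M1 M2 M3 l p s a $ i) = mean_direction z h g y l p s $ i"
  unfolding search_direction_def mean_direction_def
  by (simp add: integrable_sample_pmf expectation_phi_p_hat expectation_Psi_hat assms)

lemma score_bound:
  fixes x :: "'t::finite \<Rightarrow> 'x"
  assumes "0 < \<epsilon>" "\<epsilon> \<le> p $ i"
  shows "\<bar>score z i x p\<bar> \<le> real CARD('t) * (1 + 1 / \<epsilon>)"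
proof -
  have "\<bar>\<Sum>t\<in>UNIV. of_bool (x t = z i) / p $ i\<bar> \<le> (\<Sum>t\<in>(UNIV :: 't set). 1 / \<epsilon>)"
  proof (rule order_trans[OF sum_abs sum_mono])
    fix t
    have "1 / p $ i \<le> 1 / \<epsilon>" using assms by (intro frac_le) auto
    then show "\<bar>of_bool (x t = z i) / p $ i\<bar> \<le> 1 / \<epsilon>" using assms by (cases "x t = z i") auto
  qed
  then show ?thesis by (simp add: score_def distrib_left abs_le_iff)
qed

lemma abs_average_le:
  fixes f :: "nat \<Rightarrow> real"
  assumes "\<And>r. r < K \<Longrightarrow> \<bar>f r\<bar> \<le> B" "0 < K"
  shows "\<bar>1 / real K * (\<Sum>r<K. f r)\<bar> \<le> B"
proof -
  have "\<bar>\<Sum>r<K. f r\<bar> \<le> (\<Sum>r<K. B)" using assms by (intro order_trans[OF sum_abs sum_mono]) auto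
  then show ?thesis using assms(2) by (simp add: abs_mult field_simps)
qed

lemma norm_vec_le_const:
  fixes v :: "real ^ 'm::finite"
  assumes "\<And>i. \<bar>v $ i\<bar> \<le> B"
  shows "norm v \<le> real CARD('m) * B"
  using order_trans[OF norm_le_l1_cart[of v] sum_mono[of UNIV "\<lambda>i. \<bar>v $ i\<bar>" "\<lambda>_. B"]] assms by simp

lemma sets_Collect_all_less_eq:
  fixes K :: nat
  assumes "\<And>r. r < K \<Longrightarrow> W r \<in> M \<rightarrow>\<^sub>M count_space UNIV"
  shows "{\<omega> \<in> space M. \<forall>r<K. W r \<omega> = w r} \<in> sets M"
proof -
  have single: "{\<omega> \<in> space M. W r \<omega> = w r} \<in> sets M" if "r < K" for r
  proof -
    have *: "W r -` {w r} \<inter> space M \<in> sets M"  by (rule measurable_sets[OF assms[OF that]]) simp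
    have "W r -` {w r} \<inter> space M = {\<omega> \<in> space M. W r \<omega> = w r}" by (rule set_eqI, simp only: vimage_def Int_iff mem_Collect_eq singleton_iff, rule conj_commute)
    then show ?thesis using * by (simp only:)
  qed
  have "{\<omega> \<in> space M. \<forall>r\<in>{..<K}. W r \<omega> = w r} \<in> sets M"
    by (rule sets.sets_Collect_finite_All) (rule single, simp, simp)
  then show ?thesis by (simp only: Ball_def lessThan_iff)
qed

text \<open>Only the algorithm and its sampling law are fixed here. The assumptions on the two
  programs and the choice of step sizes enter later as premises of the convergence lemmas.\<close>

locale sampled_mirror_descent = prob_space M for M :: "'w measure" +
  fixes z :: "'m::finite \<Rightarrow> 'x"
    and h :: "('t::finite \<Rightarrow> 'x) \<Rightarrow> real"
    and g :: "('s::finite \<Rightarrow> 'x) \<Rightarrow> real"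
    and y :: "real ^ 'n::finite"
    and q \<epsilon> :: real
    and \<gamma> \<beta> lam :: "nat \<Rightarrow> real"
    and M1 M2 M3 :: nat
    and F :: "nat \<Rightarrow> 'w measure"
    and p :: "nat \<Rightarrow> 'w \<Rightarrow> real ^ 'm"
    and s :: "nat \<Rightarrow> 'w \<Rightarrow> real ^ 'n"
    and X X' :: "nat \<Rightarrow> nat \<Rightarrow> 'w \<Rightarrow> 't \<Rightarrow> 'x"
    and X'' :: "nat \<Rightarrow> nat \<Rightarrow> 'w \<Rightarrow> 's \<Rightarrow> 'x"
  assumes support: "inj z"
    and bands: "\<And>j. lower_bd y q j \<le> upper_bd y q j"
    and eps_pos: "0 < \<epsilon>"
    and M1_pos: "0 < M1" and M2_pos: "0 < M2" and M3_pos: "0 < M3"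
    and gamma_nonneg: "\<And>k. 1 \<le> k \<Longrightarrow> 0 \<le> \<gamma> k"
    and filtration: "filtration (space M) F"
    and subalgebra: "\<And>k. subalgebra M (F k)"
    and p_adapted: "\<And>k. 1 \<le> k \<Longrightarrow> p k \<in> borel_measurable (F k)"
    and s_adapted: "\<And>k. 1 \<le> k \<Longrightarrow> s k \<in> borel_measurable (F k)"
    and X_adapted: "\<And>k r. 1 \<le> k \<Longrightarrow> r < M1 \<Longrightarrow> X k r \<in> F (Suc k) \<rightarrow>\<^sub>M count_space UNIV"
    and X'_adapted: "\<And>k r. 1 \<le> k \<Longrightarrow> r < M2 \<Longrightarrow> X' k r \<in> F (Suc k) \<rightarrow>\<^sub>M count_space UNIV"
    and X''_adapted: "\<And>k r. 1 \<le> k \<Longrightarrow> r < M3 \<Longrightarrow> X'' k r \<in> F (Suc k) \<rightarrow>\<^sub>M count_space UNIV"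
    and sampling_law: "\<And>k x x' x''. 1 \<le> k \<Longrightarrow>
           AE \<omega> in M.
             real_cond_exp M (F k)
               (indicator {\<omega> \<in> space M. (\<forall>r<M1. X k r \<omega> = x r) \<and> (\<forall>r<M2. X' k r \<omega> = x' r) \<and>
                                       (\<forall>r<M3. X'' k r \<omega> = x'' r)}) \<omega> =
             (\<Prod>r<M1. pmf (process_pmf z (p k \<omega>)) (x r)) *
             (\<Prod>r<M2. pmf (process_pmf z (p k \<omega>)) (x' r)) *
             (\<Prod>r<M3. pmf (process_pmf z (p k \<omega>)) (x'' r))"
    and p_init: "\<And>\<omega>. \<omega> \<in> space M \<Longrightarrow> p 1 \<omega> \<in> prob_simplex_ge \<epsilon>"
    and s_init: "\<And>\<omega> j. \<omega> \<in> space M \<Longrightarrow> s 1 \<omega> $ j \<in> {lower_bd y q j .. upper_bd y q j}"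
    and p_step: "\<And>k \<omega>. 1 \<le> k \<Longrightarrow> \<omega> \<in> space M \<Longrightarrow>
           is_arg_min
             (mirror_objective (\<gamma> k)
                (lam k *\<^sub>R Psi_hat z g M3 (p k \<omega>) (\<lambda>r. X'' k r \<omega>) +
                 phi_p_hat z h y M1 M2 (p k \<omega>) (s k \<omega>) (\<lambda>r. X k r \<omega>) (\<lambda>r. X' k r \<omega>))
                (p k \<omega>))
             (\<lambda>v. v \<in> prob_simplex_ge \<epsilon>) (p (Suc k) \<omega>)"
    and s_step: "\<And>k \<omega> j. 1 \<le> k \<Longrightarrow> \<omega> \<in> space M \<Longrightarrow>
           s (Suc k) \<omega> $ j =
             band_proj y q j
               (s k \<omega> $ j -
                \<beta> k * phi_s_hat h y M1 M2 (s k \<omega>) (\<lambda>r. X k r \<omega>) (\<lambda>r. X' k r \<omega>) $ j)"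
begin

lemma p_mem: "1 \<le> k \<Longrightarrow> \<omega> \<in> space M \<Longrightarrow> p k \<omega> \<in> prob_simplex_ge \<epsilon>"
proof (induction k rule: dec_induct)
  case (step k)
  show ?case using p_step[OF step(1,4)] unfolding is_arg_min_def by blast
qed (rule p_init)

lemma band_proj_mem: "band_proj y q j x \<in> {lower_bd y q j .. upper_bd y q j}"
  unfolding band_proj_def by (rule closest_point_interval_mem[OF bands])

lemma s_mem: "1 \<le> k \<Longrightarrow> \<omega> \<in> space M \<Longrightarrow> s k \<omega> $ j \<in> {lower_bd y q j .. upper_bd y q j}"
proof (induction k rule: dec_induct)
  case (step k)
  show ?case unfolding s_step[OF step(1,4)] by (rule band_proj_mem)
qed (rule s_init)

text \<open>The restriction makes the batches \<^const>\<open>undefined\<close> from \<open>M1\<close>, \<open>M2\<close>, \<open>M3\<close> on, as they are in the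
  support of \<^const>\<open>Pi_pmf\<close>.\<close>

definition samples where
  "samples k \<omega> = (\<lambda>r\<in>{..<M1}. X k r \<omega>, \<lambda>r\<in>{..<M2}. X' k r \<omega>, \<lambda>r\<in>{..<M3}. X'' k r \<omega>)"

lemma space_F: "space (F k) = space M"
  using filtration.space_F[OF filtration] .

lemma measurable_F_Suc: "f \<in> F k \<rightarrow>\<^sub>M N \<Longrightarrow> f \<in> F (Suc k) \<rightarrow>\<^sub>M N"
  using filtration.sets_F_mono[OF filtration, of k "Suc k"] by (auto simp: measurable_def space_F)

lemma restrict_eq_iff_batch_support:
  assumes "x \<in> batch_support z K"
  shows "(\<lambda>r\<in>{..<K}. f r) = x \<longleftrightarrow> (\<forall>r<K. f r = x r)"
  using assms by (auto simp: batch_support_def PiE_dflt_def restrict_def fun_eq_iff)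

text \<open>On the finite support, equality of the restricted triple with \<open>a\<close> means
  equality at the indices below \<open>M1\<close>, \<open>M2\<close>, \<open>M3\<close>, so the
  assumed joint law applies to \<open>samples k\<close>.\<close>

lemma samples_law:
  assumes k: "1 \<le> k" and a: "a \<in> sample_support z M1 M2 M3"
  shows "{\<omega> \<in> space M. samples k \<omega> = a} \<in> sets M"
    and "AE \<omega> in M. real_cond_exp M (F k) (indicator {\<omega> \<in> space M. samples k \<omega> = a}) \<omega> =
           pmf (sample_pmf z M1 M2 M3 (p k \<omega>)) a"
proof -
  obtain x x' x'' where a_eq: "a = (x, x', x'')" by (cases a) auto
  note mem = a[unfolded a_eq]
  have eq: "{\<omega> \<in> space M. samples k \<omega> = a} = {\<omega> \<in> space M. (\<forall>r<M1. X k r \<omega> = x r) \<and>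
      (\<forall>r<M2. X' k r \<omega> = x' r) \<and> (\<forall>r<M3. X'' k r \<omega> = x'' r)}"
    using mem by (simp add: a_eq samples_def sample_support_def restrict_eq_iff_batch_support)
  show "AE \<omega> in M. real_cond_exp M (F k) (indicator {\<omega> \<in> space M. samples k \<omega> = a}) \<omega> =
      pmf (sample_pmf z M1 M2 M3 (p k \<omega>)) a"
    unfolding eq using sampling_law[OF k, of x x' x''] by (simp add: a_eq pmf_sample[OF mem])
  show "{\<omega> \<in> space M. samples k \<omega> = a} \<in> sets M"
    unfolding eq
    by (intro sets.sets_Collect_conj sets_Collect_all_less_eq)
      (erule measurable_from_subalg[OF subalgebra X_adapted[OF k]]
        measurable_from_subalg[OF subalgebra X'_adapted[OF k]] measurable_from_subalg[OF subalgebra X''_adapted[OF k]])+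
qed

lemma AE_samples_support:
  assumes "1 \<le> k"
  shows "AE \<omega> in M. samples k \<omega> \<in> sample_support z M1 M2 M3"
  \<comment> \<open>Only the statement on the support is wanted, so the integrand and its mean are
    taken to be zero.\<close>
  by (rule expectation_finite_conditional_law(1)[where G = "F k" and f = "\<lambda>_ _. 0" and h = "\<lambda>_. 0" and B = 0,
        OF subalgebra finite_sample_support samples_law[OF assms]])
    (simp_all add: sum_pmf_sample)

text \<open>One iteration of freezing: given \<open>F k\<close> the iterates act as constants, and
  the fresh samples are averaged under \<open>sample_pmf\<close> at the current
  \<open>p k \<omega>\<close>.\<close>

lemma expectation_samples:
  fixes B :: real
  assumes k: "1 \<le> k"
    and "\<And>a. a \<in> sample_support z M1 M2 M3 \<Longrightarrow> (\<lambda>\<omega>. f \<omega> a) \<in> borel_measurable (F k)"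
    and "\<And>a. a \<in> sample_support z M1 M2 M3 \<Longrightarrow> AE \<omega> in M. \<bar>f \<omega> a\<bar> \<le> B"
    and "(\<lambda>\<omega>. f \<omega> (samples k \<omega>)) \<in> borel_measurable M"
    and "u \<in> borel_measurable M"
    and u: "\<And>\<omega>. \<omega> \<in> space M \<Longrightarrow> u \<omega> = measure_pmf.expectation (sample_pmf z M1 M2 M3 (p k \<omega>)) (f \<omega>)"
  shows "expectation (\<lambda>\<omega>. f \<omega> (samples k \<omega>)) = expectation u"
proof (rule expectation_finite_conditional_law(2)[OF subalgebra finite_sample_support samples_law[OF k]])
  fix \<omega>
  show "(\<Sum>a\<in>sample_support z M1 M2 M3. pmf (sample_pmf z M1 M2 M3 (p k \<omega>)) a) = 1" by (rule sum_pmf_sample)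
next
  show "AE \<omega> in M. u \<omega> = (\<Sum>a\<in>sample_support z M1 M2 M3. pmf (sample_pmf z M1 M2 M3 (p k \<omega>)) a * f \<omega> a)"
    by (intro AE_I2) (simp only: sum_pmf_sample_mult u)
qed (assumption | fact assms)+

lemma search_direction_samples:
  "search_direction z h g y M1 M2 M3 l v w (samples k \<omega>) =
     l *\<^sub>R Psi_hat z g M3 v (\<lambda>r. X'' k r \<omega>) + phi_p_hat z h y M1 M2 v w (\<lambda>r. X k r \<omega>) (\<lambda>r. X' k r \<omega>)"
  by (simp add: search_direction_def samples_def Psi_hat_def phi_p_hat_def cong: sum.cong_simp)

lemma phi_s_hat_samples:
  "phi_s_hat h y M1 M2 w (fst (samples k \<omega>)) (fst (snd (samples k \<omega>))) =
     phi_s_hat h y M1 M2 w (\<lambda>r. X k r \<omega>) (\<lambda>r. X' k r \<omega>)"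
  by (simp add: samples_def phi_s_hat_def cong: sum.cong_simp)

end

section \<open>Measurability of the estimators\<close>

text \<open>Continuity is available only on \<open>prob_simplex_ge \<epsilon>\<close>, since scores
  divide by masses and expectations rest on \<open>embed_pmf\<close>; the iterates stay in that
  set.\<close>

lemma measurable_continuous_on_compose:
  assumes "continuous_on A f" "v \<in> borel_measurable N" "\<And>\<omega>. \<omega> \<in> space N \<Longrightarrow> v \<omega> \<in> A"
  shows "(\<lambda>\<omega>. f (v \<omega>)) \<in> borel_measurable N"
proof -
  have "v \<in> N \<rightarrow>\<^sub>M restrict_space borel A"
    by (rule measurable_restrict_space2) (use assms in auto)
  from measurable_compose[OF this borel_measurable_continuous_on_restrict[OF assms(1)]] show ?thesis .
qed

lemma borel_measurable_nth_compose:
  fixes v :: "'w \<Rightarrow> real ^ 'm::finite"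
  shows "v \<in> borel_measurable N \<Longrightarrow> (\<lambda>\<omega>. v \<omega> $ i) \<in> borel_measurable N"
  by (rule measurable_compose[OF _ borel_measurable_nth])

lemma score_measurable:
  fixes v :: "'w \<Rightarrow> real ^ 'm::finite"
  assumes v: "v \<in> borel_measurable N" and x: "x \<in> N \<rightarrow>\<^sub>M count_space UNIV"
  shows "(\<lambda>\<omega>. score z i (x \<omega>) (v \<omega>)) \<in> borel_measurable N"
proof -
  have "(\<lambda>\<omega>. of_bool (x \<omega> t = z i) :: real) \<in> borel_measurable N" for t
    by (rule measurable_compose[OF x]) simp
  then show ?thesis
    unfolding score_def using borel_measurable_nth_compose[OF v]
    by (intro borel_measurable_diff borel_measurable_sum borel_measurable_divide) auto
qed

text \<open>The batches are arbitrary measurable maps so that the lemma serves twice: for the random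
  samples at time \<open>Suc k\<close>, and for constant ones when the sample is frozen and only the
  iterates at time \<open>k\<close> vary.\<close>

lemma search_direction_measurable:
  fixes v :: "'w \<Rightarrow> real ^ 'm::finite" and w :: "'w \<Rightarrow> real ^ 'n::finite"
  assumes v: "v \<in> borel_measurable N" and w: "w \<in> borel_measurable N"
    and x: "\<And>r. r < M1 \<Longrightarrow> x r \<in> N \<rightarrow>\<^sub>M count_space UNIV"
    and x': "\<And>r. r < M2 \<Longrightarrow> x' r \<in> N \<rightarrow>\<^sub>M count_space UNIV"
    and x'': "\<And>r. r < M3 \<Longrightarrow> x'' r \<in> N \<rightarrow>\<^sub>M count_space UNIV"
  shows "(\<lambda>\<omega>. search_direction z h g y M1 M2 M3 l (v \<omega>) (w \<omega>)
           (\<lambda>r. x r \<omega>, \<lambda>r. x' r \<omega>, \<lambda>r. x'' r \<omega>) $ i) \<in> borel_measurable N"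
proof -
  have h: "(\<lambda>\<omega>. of_bool (h (u r \<omega>) \<le> y $ j) :: real) \<in> borel_measurable N"
    if "u r \<in> N \<rightarrow>\<^sub>M count_space UNIV" for u r j
    by (rule measurable_compose[OF that]) simp
  have g: "(\<lambda>\<omega>. g (x'' r \<omega>)) \<in> borel_measurable N" if "r < M3" for r
    by (rule measurable_compose[OF x''[OF that]]) simp
  show ?thesis
    unfolding search_direction_def Psi_hat_def phi_p_hat_def vector_add_component vector_scaleR_component
      vec_lambda_beta fst_conv snd_conv
    by (intro borel_measurable_add borel_measurable_times borel_measurable_sum borel_measurable_diff
      borel_measurable_scaleR borel_measurable_divide borel_measurable_const h g score_measurable borel_measurable_nth_compose v w x x' x'')
      auto
qed

lemma phi_s_hat_measurable:
  fixes w :: "'w \<Rightarrow> real ^ 'n::finite"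
  assumes w: "w \<in> borel_measurable N"
    and x: "\<And>r. r < M1 \<Longrightarrow> x r \<in> N \<rightarrow>\<^sub>M count_space UNIV"
    and x': "\<And>r. r < M2 \<Longrightarrow> x' r \<in> N \<rightarrow>\<^sub>M count_space UNIV"
  shows "(\<lambda>\<omega>. phi_s_hat h y M1 M2 (w \<omega>) (\<lambda>r. x r \<omega>) (\<lambda>r. x' r \<omega>) $ j) \<in> borel_measurable N"
proof -
  have h: "(\<lambda>\<omega>. of_bool (h (u r \<omega>) \<le> y $ j) :: real) \<in> borel_measurable N"
    if "u r \<in> N \<rightarrow>\<^sub>M count_space UNIV" for u r
    by (rule measurable_compose[OF that]) simp
  show ?thesis
    unfolding phi_s_hat_def vec_lambda_beta
    by (intro borel_measurable_add borel_measurable_times borel_measurable_sum borel_measurable_diff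
      borel_measurable_divide borel_measurable_uminus borel_measurable_const h borel_measurable_nth_compose w x x')
      auto
qed

section \<open>Bounds on the search directions and summability of the noise\<close>

context sampled_mirror_descent
begin

text \<open>Large enough for two distances: from an indicator, or a probability, to a point of the
  band, and between two points of the band.\<close>

definition band_radius :: "'n \<Rightarrow> real" where
  "band_radius j = 1 + \<bar>lower_bd y q j\<bar> + \<bar>upper_bd y q j\<bar>"

lemma band_radius_bound:
  assumes "x \<in> {lower_bd y q j .. upper_bd y q j}"
  shows "\<bar>of_bool P - x\<bar> \<le> band_radius j"
  using assms by (cases P) (auto simp: band_radius_def)

lemma output_cdf_lipschitz:
  "v \<in> prob_simplex_ge \<epsilon> \<Longrightarrow> w \<in> prob_simplex_ge \<epsilon> \<Longrightarrow>
     \<bar>output_cdf z h y v j - output_cdf z h y w j\<bar> \<le> real CARD('t \<Rightarrow> 'm) * real CARD('t) * norm (v - w)"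
  unfolding output_cdf_def by (intro process_exp_lipschitz prob_simplex_geD(1))

text \<open>Uniform because masses at least \<epsilon> bound the scores, \<open>s\<close> stays in
  the bands, and \<open>g\<close> takes finitely many values on words over the support
  points.\<close>

lemma search_direction_bounded:
  obtains C where "0 \<le> C"
    "\<And>v w a l. v \<in> prob_simplex_ge \<epsilon> \<Longrightarrow> (\<And>j. w $ j \<in> {lower_bd y q j .. upper_bd y q j}) \<Longrightarrow>
       a \<in> sample_support z M1 M2 M3 \<Longrightarrow> \<bar>l\<bar> \<le> \<Lambda> \<Longrightarrow> norm (search_direction z h g y M1 M2 M3 l v w a) \<le> C"
proof -
  define S1 where "S1 = real CARD('t) * (1 + 1 / \<epsilon>)"
  define S2 where "S2 = real CARD('s) * (1 + 1 / \<epsilon>)"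
  define G where "G = (\<Sum>x\<in>UNIV. \<bar>g (\<lambda>t. z (x t))\<bar>)"
  define C where "C = \<bar>\<Lambda>\<bar> * (G * S2) + 2 * (\<Sum>j\<in>UNIV. band_radius j * S1)"
  have S: "0 \<le> S1" "0 \<le> S2" "0 \<le> G" using eps_pos by (auto simp: S1_def S2_def G_def intro!: sum_nonneg)
  have "0 \<le> C" unfolding C_def using S by (auto intro!: add_nonneg_nonneg mult_nonneg_nonneg sum_nonneg simp: band_radius_def)
  moreover have "\<bar>search_direction z h g y M1 M2 M3 l v w a $ i\<bar> \<le> C"
    if v: "v \<in> prob_simplex_ge \<epsilon>" and w: "\<And>j. w $ j \<in> {lower_bd y q j .. upper_bd y q j}"
      and a: "a \<in> sample_support z M1 M2 M3" and l: "\<bar>l\<bar> \<le> \<Lambda>" for v w a l i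
  proof -
    obtain x x' x'' where a_eq: "a = (x, x', x'')" by (cases a) auto
    have vi: "\<epsilon> \<le> v $ i" by (rule prob_simplex_geD(2)[OF v])
    have "\<bar>g (x'' r) * score z i (x'' r) v\<bar> \<le> G * S2" if "r < M3" for r
    proof -
      have "x'' r \<in> range (\<lambda>x t. z (x t))"
        using a that by (auto simp: a_eq sample_support_def batch_support_def PiE_dflt_def)
      then obtain f where f: "x'' r = (\<lambda>t. z (f t))" by auto
      have "\<bar>g (x'' r)\<bar> \<le> G" unfolding f G_def by (rule member_le_sum) auto
      then show ?thesis unfolding abs_mult S2_def by (intro mult_mono score_bound[OF eps_pos vi]) (use S in auto)
    qed
    then have Psi: "\<bar>Psi_hat z g M3 v x'' $ i\<bar> \<le> G * S2"
      unfolding Psi_hat_def vec_lambda_beta by (intro abs_average_le M3_pos)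
    have "\<bar>(1 / real M1 * (\<Sum>r<M1. (of_bool (h (x r) \<le> y $ j) - w $ j))) *
        (1 / real M2 * (\<Sum>r<M2. of_bool (h (x' r) \<le> y $ j) * score z i (x' r) v))\<bar> \<le> band_radius j * S1" for j
    proof (unfold abs_mult[of "1 / real M1 * _"], intro mult_mono abs_average_le M1_pos M2_pos band_radius_bound w)
      show "\<bar>of_bool (h (x' r) \<le> y $ j) * score z i (x' r) v\<bar> \<le> S1" for r
        using score_bound[OF eps_pos vi, of z "x' r"] S by (auto simp: S1_def abs_mult)
    qed (auto simp: band_radius_def)
    then have "\<bar>phi_p_hat z h y M1 M2 v w x x' $ i\<bar> \<le> 2 * (\<Sum>j\<in>UNIV. band_radius j * S1)"
      unfolding phi_p_hat_def vec_lambda_beta abs_mult[of 2]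
      by (intro mult_mono order_trans[OF sum_abs sum_mono]) auto
    moreover have "\<bar>l * Psi_hat z g M3 v x'' $ i\<bar> \<le> \<bar>\<Lambda>\<bar> * (G * S2)"
      unfolding abs_mult using Psi l by (intro mult_mono) auto
    ultimately show ?thesis by (simp add: search_direction_def a_eq C_def)
  qed
  ultimately have "0 \<le> real CARD('m) * C" and
    "\<And>v w a l. v \<in> prob_simplex_ge \<epsilon> \<Longrightarrow> (\<And>j. w $ j \<in> {lower_bd y q j .. upper_bd y q j}) \<Longrightarrow>
       a \<in> sample_support z M1 M2 M3 \<Longrightarrow> \<bar>l\<bar> \<le> \<Lambda> \<Longrightarrow>
       norm (search_direction z h g y M1 M2 M3 l v w a) \<le> real CARD('m) * C"
    by (auto intro!: norm_vec_le_const)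
  then show ?thesis by (rule that)
qed

text \<open>The mean is a convex combination of search directions, compared componentwise; the
  dimension factor is the price of returning to the norm.\<close>

lemma mean_direction_bounded:
  fixes v :: "real ^ 'm"
  assumes "\<And>a. a \<in> sample_support z M1 M2 M3 \<Longrightarrow> norm (search_direction z h g y M1 M2 M3 l v w a) \<le> C"
  shows "norm (mean_direction z h g y l v w) \<le> real CARD('m) * C"
proof (rule norm_vec_le_const)
  fix i
  define A where "A = (sample_support z M1 M2 M3 :: ((nat \<Rightarrow> 't \<Rightarrow> 'x) \<times> (nat \<Rightarrow> 't \<Rightarrow> 'x) \<times> (nat \<Rightarrow> 's \<Rightarrow> 'x)) set)"
  define W where "W = pmf (sample_pmf z M1 M2 M3 v :: ((nat \<Rightarrow> 't \<Rightarrow> 'x) \<times> (nat \<Rightarrow> 't \<Rightarrow> 'x) \<times> (nat \<Rightarrow> 's \<Rightarrow> 'x)) pmf)"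
  have "mean_direction z h g y l v w $ i = (\<Sum>a\<in>A. W a * search_direction z h g y M1 M2 M3 l v w a $ i)"
    unfolding A_def W_def by (simp only: sum_pmf_sample_mult expectation_search_direction[OF M1_pos M2_pos M3_pos])
  also have "\<bar>\<dots>\<bar> \<le> (\<Sum>a\<in>A. W a * C)"
  proof (rule order_trans[OF sum_abs sum_mono])
    fix a assume "a \<in> A"
    then have "\<bar>search_direction z h g y M1 M2 M3 l v w a $ i\<bar> \<le> C"
      unfolding A_def by (rule order_trans[OF component_le_norm_cart assms])
    then show "\<bar>W a * search_direction z h g y M1 M2 M3 l v w a $ i\<bar> \<le> W a * C"
      unfolding abs_mult W_def by (intro mult_mono) auto
  qed
  also have "\<dots> = C"
    by (simp add: A_def W_def sum_pmf_sample flip: sum_distrib_right)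
  finally show "\<bar>mean_direction z h g y l v w $ i\<bar> \<le> C" .
qed

lemma mean_direction_measurable:
  assumes v: "v \<in> borel_measurable N" "\<And>\<omega>. \<omega> \<in> space N \<Longrightarrow> v \<omega> \<in> prob_simplex_ge \<epsilon>"
    and w: "w \<in> borel_measurable N"
  shows "(\<lambda>\<omega>. mean_direction z h g y l (v \<omega>) (w \<omega>)) \<in> borel_measurable N"
proof -
  have sm: "(\<lambda>\<omega>. score_mean z f (v \<omega>)) \<in> borel_measurable N" for f :: "('u::finite \<Rightarrow> 'x) \<Rightarrow> real"
    by (rule measurable_continuous_on_compose[OF continuous_on_score_mean[OF eps_pos] v])
  have cdf: "(\<lambda>\<omega>. output_cdf z h y (v \<omega>) j) \<in> borel_measurable N" for j
    unfolding output_cdf_def by (rule measurable_continuous_on_compose[OF continuous_on_process_exp v])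
  show ?thesis
    unfolding mean_direction_def tracking_gradient_def
    by (intro borel_measurable_add borel_measurable_scaleR borel_measurable_const borel_measurable_sum
      borel_measurable_diff sm cdf borel_measurable_nth_compose w)
qed

definition noise :: "(nat \<Rightarrow> real ^ 'm) \<Rightarrow> nat \<Rightarrow> 'w \<Rightarrow> real" where
  "noise u k \<omega> = \<gamma> k * ((search_direction z h g y M1 M2 M3 (lam k) (p k \<omega>) (s k \<omega>) (samples k \<omega>)
     - mean_direction z h g y (lam k) (p k \<omega>) (s k \<omega>)) \<bullet> (p k \<omega> - u k))"

lemma search_direction_samples_measurable:
  assumes k: "1 \<le> k"
  shows "(\<lambda>\<omega>. search_direction z h g y M1 M2 M3 l (p k \<omega>) (s k \<omega>) (samples k \<omega>) $ i) \<in> borel_measurable (F (Suc k))"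
  unfolding samples_def
  by (rule search_direction_measurable[where x = "\<lambda>r \<omega>. (\<lambda>r\<in>{..<M1}. X k r \<omega>) r"
        and x' = "\<lambda>r \<omega>. (\<lambda>r\<in>{..<M2}. X' k r \<omega>) r" and x'' = "\<lambda>r \<omega>. (\<lambda>r\<in>{..<M3}. X'' k r \<omega>) r"])
    (simp_all add: measurable_F_Suc[OF p_adapted[OF k]] measurable_F_Suc[OF s_adapted[OF k]]
      X_adapted[OF k] X'_adapted[OF k] X''_adapted[OF k])

lemma norm_diff_simplex_le:
  fixes v w :: "real ^ 'm"
  assumes "v \<in> prob_simplex_ge \<epsilon>" "w \<in> prob_simplex_ge \<epsilon>"
  shows "norm (v - w) \<le> real CARD('m)"
proof -
  have "\<bar>(v - w) $ i\<bar> \<le> 1" for i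
    using prob_simplex_geD(2,3)[OF assms(1), of i] prob_simplex_geD(2,3)[OF assms(2), of i] eps_pos by simp
  then show ?thesis using norm_vec_le_const[of "v - w" 1] by simp
qed

text \<open>With the sample frozen, the noise is measurable in \<open>F k\<close>, bounded by a
  multiple of \<open>\<gamma> k\<close>, and has mean zero under the sampling law. This yields
  orthogonality to bounded functions of the past; the references \<open>u k\<close> are
  deterministic and do not disturb it.\<close>

lemma noise_summable:
  assumes u: "\<And>k. 1 \<le> k \<Longrightarrow> u k \<in> prob_simplex_ge \<epsilon>" and lam: "\<And>k. 1 \<le> k \<Longrightarrow> \<bar>lam k\<bar> \<le> \<Lambda>"
    and \<gamma>2: "summable (\<lambda>k. (\<gamma> k)\<^sup>2)"
  shows "AE \<omega> in M. summable (\<lambda>k. noise u k \<omega>)"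
proof -
  obtain C where C: "0 \<le> C"
    "\<And>v w a l. v \<in> prob_simplex_ge \<epsilon> \<Longrightarrow> (\<And>j. w $ j \<in> {lower_bd y q j .. upper_bd y q j}) \<Longrightarrow>
       a \<in> sample_support z M1 M2 M3 \<Longrightarrow> \<bar>l\<bar> \<le> \<Lambda> \<Longrightarrow> norm (search_direction z h g y M1 M2 M3 l v w a) \<le> C"
    by (rule search_direction_bounded[of \<Lambda>]) blast
  define c where "c = (\<lambda>k. \<gamma> k * ((C + real CARD('m) * C) * real CARD('m)))"
  define f where "f = (\<lambda>k \<omega> a. \<gamma> k * ((search_direction z h g y M1 M2 M3 (lam k) (p k \<omega>) (s k \<omega>) a
     - mean_direction z h g y (lam k) (p k \<omega>) (s k \<omega>)) \<bullet> (p k \<omega> - u k)))"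
  have noise_f: "noise u k \<omega> = f k \<omega> (samples k \<omega>)" for k \<omega> by (simp add: noise_def f_def)
  have f_bound: "\<bar>f k \<omega> a\<bar> \<le> c k"
    if k: "1 \<le> k" and \<omega>: "\<omega> \<in> space M" and a: "a \<in> sample_support z M1 M2 M3" for k \<omega> a
  proof -
    note sd = C(2)[OF p_mem[OF k \<omega>] s_mem[OF k \<omega>] _ lam[OF k]]
    have "norm (search_direction z h g y M1 M2 M3 (lam k) (p k \<omega>) (s k \<omega>) a -
        mean_direction z h g y (lam k) (p k \<omega>) (s k \<omega>)) \<le> C + real CARD('m) * C"
      using norm_triangle_ineq4 sd[OF a] mean_direction_bounded[OF sd] by (rule order_trans[OF _ add_mono])
    then have "norm (search_direction z h g y M1 M2 M3 (lam k) (p k \<omega>) (s k \<omega>) a -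
        mean_direction z h g y (lam k) (p k \<omega>) (s k \<omega>)) * norm (p k \<omega> - u k) \<le> (C + real CARD('m) * C) * real CARD('m)"
      using C(1) by (intro mult_mono norm_diff_simplex_le p_mem[OF k \<omega>] u[OF k]) auto
    from mult_left_mono[OF order_trans[OF Cauchy_Schwarz_ineq2 this] gamma_nonneg[OF k]] show ?thesis
      unfolding f_def c_def abs_mult using gamma_nonneg[OF k] by simp
  qed
  have meas_mean: "(\<lambda>\<omega>. mean_direction z h g y (lam k) (p k \<omega>) (s k \<omega>)) \<in> borel_measurable (F k)" if k: "1 \<le> k" for k
    by (rule mean_direction_measurable[OF p_adapted[OF k] _ s_adapted[OF k]]) (simp add: space_F p_mem[OF k])
  have inner_meas: "(\<lambda>\<omega>. \<gamma> k * ((A \<omega> - mean_direction z h g y (lam k) (p k \<omega>) (s k \<omega>)) \<bullet> (p k \<omega> - u k))) \<in> borel_measurable N"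
    if "\<And>i. (\<lambda>\<omega>. A \<omega> $ i) \<in> borel_measurable N" "(\<lambda>\<omega>. mean_direction z h g y (lam k) (p k \<omega>) (s k \<omega>)) \<in> borel_measurable N"
      "p k \<in> borel_measurable N" for A k N
    unfolding inner_vec_def vector_minus_component inner_real_def
    by (intro borel_measurable_times borel_measurable_const borel_measurable_sum borel_measurable_diff
        borel_measurable_nth_compose that)
  have noise_meas: "noise u k \<in> borel_measurable (F (Suc k))" if k: "1 \<le> k" for k
    unfolding noise_def
    by (intro inner_meas search_direction_samples_measurable k measurable_F_Suc[OF meas_mean] measurable_F_Suc[OF p_adapted])
  have f_meas: "(\<lambda>\<omega>. f k \<omega> a) \<in> borel_measurable (F k)" if k: "1 \<le> k" for k a
    unfolding f_def
  proof (intro inner_meas meas_mean p_adapted k)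
    show "(\<lambda>\<omega>. search_direction z h g y M1 M2 M3 (lam k) (p k \<omega>) (s k \<omega>) a $ i) \<in> borel_measurable (F k)" for i
      using search_direction_measurable[OF p_adapted[OF k] s_adapted[OF k], where x = "\<lambda>r _. fst a r"
        and x' = "\<lambda>r _. fst (snd a) r" and x'' = "\<lambda>r _. snd (snd a) r"] by simp
  qed
  show ?thesis
  proof (rule bounded_orthogonal_increments_summable[OF filtration subalgebra, where n = 1 and c = c])
    show "noise u k \<in> borel_measurable (F (Suc k))" if "1 \<le> k" for k by (rule noise_meas[OF that])
    show "AE \<omega> in M. \<bar>noise u k \<omega>\<bar> \<le> c k" if k: "1 \<le> k" for k
      using AE_samples_support[OF k] AE_space by eventually_elim (simp only: noise_f, rule f_bound[OF k])
    show "summable (\<lambda>k. (c k)\<^sup>2)"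
      unfolding c_def power_mult_distrib by (rule summable_mult2[OF \<gamma>2])
    fix k Y B
    assume k: "1 \<le> k" and Y: "Y \<in> borel_measurable (F k)" and YB: "AE \<omega> in M. \<bar>Y \<omega>\<bar> \<le> (B :: real)"
    \<comment> \<open>The factor \<open>Y \<omega>\<close> belongs to the past and is frozen along
      with the iterates, so the inner mean over the fresh sample vanishes pointwise.\<close>
    have "expectation (\<lambda>\<omega>. f k \<omega> (samples k \<omega>) * Y \<omega>) = expectation (\<lambda>_. 0)"
    proof (rule expectation_samples[where f = "\<lambda>\<omega> a. f k \<omega> a * Y \<omega>", OF k])
      fix a :: "(nat \<Rightarrow> 't \<Rightarrow> 'x) \<times> (nat \<Rightarrow> 't \<Rightarrow> 'x) \<times> (nat \<Rightarrow> 's \<Rightarrow> 'x)"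
      assume a: "a \<in> sample_support z M1 M2 M3"
      show "(\<lambda>\<omega>. f k \<omega> a * Y \<omega>) \<in> borel_measurable (F k)" by (intro borel_measurable_times f_meas k Y)
      show "AE \<omega> in M. \<bar>f k \<omega> a * Y \<omega>\<bar> \<le> c k * B"
        using YB AE_space
      proof eventually_elim
        case (elim \<omega>)
        then show ?case unfolding abs_mult using f_bound[OF k _ a, of \<omega>] by (intro mult_mono) auto
      qed
    next
      show "(\<lambda>\<omega>. f k \<omega> (samples k \<omega>) * Y \<omega>) \<in> borel_measurable M"
        using measurable_from_subalg[OF subalgebra noise_meas[OF k]] measurable_from_subalg[OF subalgebra Y]
        unfolding noise_f by (rule borel_measurable_times)
      fix \<omega> assume "\<omega> \<in> space M"
      have "measure_pmf.expectation (sample_pmf z M1 M2 M3 (p k \<omega>)) (\<lambda>a. f k \<omega> a) =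
          \<gamma> k * (\<Sum>i\<in>UNIV. (measure_pmf.expectation (sample_pmf z M1 M2 M3 (p k \<omega>))
            (\<lambda>a. search_direction z h g y M1 M2 M3 (lam k) (p k \<omega>) (s k \<omega>) a $ i)
            - mean_direction z h g y (lam k) (p k \<omega>) (s k \<omega>) $ i) * (p k \<omega> - u k) $ i)"
        unfolding f_def inner_vec_def
        by (simp add: integrable_sample_pmf Bochner_Integration.integral_sum)
      also have "\<dots> = 0" by (simp add: expectation_search_direction M1_pos M2_pos M3_pos)
      finally show "0 = measure_pmf.expectation (sample_pmf z M1 M2 M3 (p k \<omega>)) (\<lambda>a. f k \<omega> a * Y \<omega>)"
        by simp
    qed simp
    then show "expectation (\<lambda>\<omega>. noise u k \<omega> * Y \<omega>) = 0" by (simp add: noise_f)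
  qed
qed

end

section \<open>Tracking of the projected output distribution by \<open>s\<close>\<close>

lemma square_add_le_weighted:
  fixes x w b :: real
  assumes "0 < b"
  shows "(x + w)\<^sup>2 \<le> (1 + b) * x\<^sup>2 + (1 + 1 / b) * w\<^sup>2"
proof -
  have "0 \<le> (b * x - w)\<^sup>2 / b" using assms by simp
  also have "(b * x - w)\<^sup>2 / b = b * x\<^sup>2 - 2 * x * w + w\<^sup>2 / b"
    using assms by (simp add: field_simps power2_eq_square)
  finally show ?thesis by (simp add: power2_sum algebra_simps)
qed

context sampled_mirror_descent
begin

definition target :: "real ^ 'm \<Rightarrow> real ^ 'n" where
  "target v = (\<chi> j. band_proj y q j (output_cdf z h y v j))"

definition tracking_error :: "'n \<Rightarrow> nat \<Rightarrow> 'w \<Rightarrow> real" where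
  "tracking_error j k \<omega> = s k \<omega> $ j - target (p k \<omega>) $ j"

lemma target_mem: "target v $ j \<in> {lower_bd y q j .. upper_bd y q j}"
  by (simp only: target_def vec_lambda_beta band_proj_mem)

lemma tracking_error_bound: "1 \<le> k \<Longrightarrow> \<omega> \<in> space M \<Longrightarrow> \<bar>tracking_error j k \<omega>\<bar> \<le> band_radius j"
  using s_mem[of k \<omega> j] target_mem[of "p k \<omega>" j] by (auto simp: tracking_error_def band_radius_def)

lemma target_lipschitz:
  assumes "v \<in> prob_simplex_ge \<epsilon>" "w \<in> prob_simplex_ge \<epsilon>"
  shows "\<bar>target v $ j - target w $ j\<bar> \<le> real CARD('t \<Rightarrow> 'm) * real CARD('t) * norm (v - w)"
  unfolding target_def vec_lambda_beta band_proj_def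
  by (rule order_trans[OF closest_point_interval_lipschitz[OF bands] output_cdf_lipschitz[OF assms]])

lemma tracking_error_measurable:
  assumes k: "1 \<le> k"
  shows "tracking_error j k \<in> borel_measurable (F k)"
proof -
  have cont: "continuous_on UNIV (band_proj y q j)"
  proof -
    have "1-lipschitz_on UNIV (band_proj y q j)"
      unfolding band_proj_def
      by (rule lipschitz_onI) (use closest_point_interval_lipschitz[OF bands] in \<open>auto simp: dist_real_def\<close>)
    then show ?thesis by (rule lipschitz_on_continuous_on)
  qed
  have cdf: "(\<lambda>\<omega>. output_cdf z h y (p k \<omega>) j) \<in> borel_measurable (F k)"
    unfolding output_cdf_def
    by (rule measurable_continuous_on_compose[OF continuous_on_process_exp[where \<epsilon> = \<epsilon>] p_adapted[OF k]]) (simp add: space_F p_mem[OF k])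
  have "(\<lambda>\<omega>. band_proj y q j (output_cdf z h y (p k \<omega>) j)) \<in> borel_measurable (F k)"
    by (rule measurable_continuous_on_compose[OF cont cdf]) simp
  then show ?thesis
    unfolding tracking_error_def target_def vec_lambda_beta
    by (intro borel_measurable_diff borel_measurable_nth_compose s_adapted k)
qed

lemma tracking_error_sq_integrable:
  assumes k: "1 \<le> k"
  shows "integrable M (\<lambda>\<omega>. (tracking_error j k \<omega>)\<^sup>2)"
proof (rule integrable_AE_bounded[OF _ AE_I2])
  show "(\<lambda>\<omega>. (tracking_error j k \<omega>)\<^sup>2) \<in> borel_measurable M"
    using measurable_from_subalg[OF subalgebra tracking_error_measurable[OF k]] by simp
  fix \<omega> assume "\<omega> \<in> space M"
  then have "\<bar>tracking_error j k \<omega>\<bar> \<le> \<bar>band_radius j\<bar>"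
    using order_trans[OF tracking_error_bound[OF k] abs_ge_self] by blast
  then show "\<bar>(tracking_error j k \<omega>)\<^sup>2\<bar> \<le> (band_radius j)\<^sup>2"
    by (simp only: abs_power2 abs_le_square_iff)
qed

lemma phi_s_hat_bounded:
  assumes "w $ j \<in> {lower_bd y q j .. upper_bd y q j}"
  shows "\<bar>phi_s_hat h y M1 M2 w x x' $ j\<bar> \<le> 2 * band_radius j"
proof -
  have sum: "\<bar>\<Sum>r<K. (of_bool (h (x r) \<le> y $ j) - w $ j)\<bar> \<le> real K * band_radius j" for K x
    using order_trans[OF sum_abs sum_mono[of "{..<K}" _ "\<lambda>_. band_radius j"]] band_radius_bound[OF assms] by simp
  have "\<bar>(\<Sum>r<M1. (of_bool (h (x r) \<le> y $ j) - w $ j)) + (\<Sum>r<M2. (of_bool (h (x' r) \<le> y $ j) - w $ j))\<bar>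
      \<le> (real M1 + real M2) * band_radius j"
    unfolding distrib_right by (rule order_trans[OF abs_triangle_ineq add_mono[OF sum sum]])
  from mult_left_mono[OF this, of "2 / (real M1 + real M2)"]
  have "2 / (real M1 + real M2) * \<bar>(\<Sum>r<M1. (of_bool (h (x r) \<le> y $ j) - w $ j)) + (\<Sum>r<M2. (of_bool (h (x' r) \<le> y $ j) - w $ j))\<bar>
      \<le> 2 * band_radius j" using M1_pos by simp
  then show ?thesis
    by (simp only: phi_s_hat_def vec_lambda_beta abs_mult abs_minus_cancel) simp
qed

text \<open>Two effects compete: the step of \<open>s\<close> pulls the error towards 0 at rate
  \<open>\<beta> k\<close>, while the target drifts by at most a multiple of
  \<open>\<gamma> k\<close> because \<open>p\<close> moves. Estimation noise enters only at second
  order, its cross term being replaced by its conditional mean.\<close>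

lemma tracking_recursion:
  assumes \<beta>: "\<And>k. 1 \<le> k \<Longrightarrow> 0 < \<beta> k" "\<And>k. 1 \<le> k \<Longrightarrow> \<beta> k \<le> b"
    and lam: "\<And>k. 1 \<le> k \<Longrightarrow> \<bar>lam k\<bar> \<le> \<Lambda>"
  obtains C where "0 \<le> C" "\<And>k. 1 \<le> k \<Longrightarrow> expectation (\<lambda>\<omega>. (tracking_error j (Suc k) \<omega>)\<^sup>2) \<le>
     (1 - 3 * \<beta> k) * expectation (\<lambda>\<omega>. (tracking_error j k \<omega>)\<^sup>2) + C * ((\<beta> k)\<^sup>2 + (\<gamma> k)\<^sup>2 / \<beta> k)"
proof -
  obtain Cd where Cd: "0 \<le> Cd"
    "\<And>v w a l. v \<in> prob_simplex_ge \<epsilon> \<Longrightarrow> (\<And>j. w $ j \<in> {lower_bd y q j .. upper_bd y q j}) \<Longrightarrow>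
       a \<in> sample_support z M1 M2 M3 \<Longrightarrow> \<bar>l\<bar> \<le> \<Lambda> \<Longrightarrow> norm (search_direction z h g y M1 M2 M3 l v w a) \<le> Cd"
    by (rule search_direction_bounded[of \<Lambda>]) blast
  define R where "R = band_radius j"
  \<comment> \<open>Lipschitz constant of the target times the bound
    \<open>2 * \<gamma> k * Cd\<close> on the mirror step, with \<open>\<gamma> k\<close> split
    off.\<close>
  define K where "K = real CARD('t \<Rightarrow> 'm) * real CARD('t) * (2 * Cd)"
  define C where "C = (1 + b) * (4 * R\<^sup>2 + K\<^sup>2)"
  have b: "0 < b" using \<beta>[of 1] by simp
  have C0: "0 \<le> C" using b by (simp add: C_def)
  have "expectation (\<lambda>\<omega>. (tracking_error j (Suc k) \<omega>)\<^sup>2) \<le>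
     (1 - 3 * \<beta> k) * expectation (\<lambda>\<omega>. (tracking_error j k \<omega>)\<^sup>2) + C * ((\<beta> k)\<^sup>2 + (\<gamma> k)\<^sup>2 / \<beta> k)"
    if k: "1 \<le> k" for k
  proof -
    define e where "e = tracking_error j k"
    define \<phi> where "\<phi> = (\<lambda>\<omega>. phi_s_hat h y M1 M2 (s k \<omega>) (\<lambda>r. X k r \<omega>) (\<lambda>r. X' k r \<omega>) $ j)"
    define B where "B = \<beta> k"
    have B: "0 < B" "B \<le> b" using \<beta>[OF k] by (auto simp: B_def)
    have e_F: "e \<in> borel_measurable (F k)" unfolding e_def by (rule tracking_error_measurable[OF k])
    have e_M: "e \<in> borel_measurable M" by (rule measurable_from_subalg[OF subalgebra e_F])
    have e'_M: "tracking_error j (Suc k) \<in> borel_measurable M"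
      by (rule measurable_from_subalg[OF subalgebra tracking_error_measurable]) simp
    have \<phi>_M: "\<phi> \<in> borel_measurable M"
      unfolding \<phi>_def
      by (rule measurable_from_subalg[OF subalgebra[of "Suc k"] phi_s_hat_measurable])
        (assumption | rule measurable_F_Suc[OF s_adapted[OF k]] X_adapted[OF k] X'_adapted[OF k])+
    have e_le: "\<bar>e \<omega>\<bar> \<le> R" if "\<omega> \<in> space M" for \<omega>
      unfolding e_def R_def by (rule tracking_error_bound[OF k that])
    have \<phi>_le: "\<bar>phi_s_hat h y M1 M2 (s k \<omega>) x x' $ j\<bar> \<le> 2 * R" if "\<omega> \<in> space M" for \<omega> x x'
      unfolding R_def by (rule phi_s_hat_bounded[OF s_mem[OF k that]])
    have int_e2: "integrable M (\<lambda>\<omega>. (e \<omega>)\<^sup>2)" unfolding e_def by (rule tracking_error_sq_integrable[OF k])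
    have int_e'2: "integrable M (\<lambda>\<omega>. (tracking_error j (Suc k) \<omega>)\<^sup>2)" by (rule tracking_error_sq_integrable) simp
    have int_\<phi>2: "integrable M (\<lambda>\<omega>. (\<phi> \<omega>)\<^sup>2)" and E_\<phi>2: "expectation (\<lambda>\<omega>. (\<phi> \<omega>)\<^sup>2) \<le> 4 * R\<^sup>2"
    proof -
      have m: "(\<lambda>\<omega>. (\<phi> \<omega>)\<^sup>2) \<in> borel_measurable M" using \<phi>_M by simp
      have l: "AE \<omega> in M. \<bar>(\<phi> \<omega>)\<^sup>2\<bar> \<le> (2 * R)\<^sup>2"
      proof (rule AE_I2)
        fix \<omega> assume "\<omega> \<in> space M"
        then have "\<bar>\<phi> \<omega>\<bar> \<le> \<bar>2 * R\<bar>" using order_trans[OF \<phi>_le abs_ge_self] by (simp add: \<phi>_def)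
        then show "\<bar>(\<phi> \<omega>)\<^sup>2\<bar> \<le> (2 * R)\<^sup>2" by (simp only: abs_power2 abs_le_square_iff)
      qed
      show "integrable M (\<lambda>\<omega>. (\<phi> \<omega>)\<^sup>2)" by (rule integrable_AE_bounded[OF m l])
      show "expectation (\<lambda>\<omega>. (\<phi> \<omega>)\<^sup>2) \<le> 4 * R\<^sup>2" using integral_AE_abs_le[OF m l] by (simp add: power_mult_distrib)
    qed
    have e\<phi>_le: "\<bar>e \<omega> * phi_s_hat h y M1 M2 (s k \<omega>) x x' $ j\<bar> \<le> R * (2 * R)" if "\<omega> \<in> space M" for \<omega> x x'
      unfolding abs_mult by (intro mult_mono e_le \<phi>_le that order_trans[OF abs_ge_zero e_le[OF that]]) auto
    have int_e\<phi>: "integrable M (\<lambda>\<omega>. e \<omega> * \<phi> \<omega>)"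
      using e_M \<phi>_M e\<phi>_le by (intro integrable_AE_bounded[where B = "R * (2 * R)"] AE_I2) (auto simp: \<phi>_def)
    define v where "v = (\<lambda>\<omega>. e \<omega> * (- 2 * (output_cdf z h y (p k \<omega>) j - s k \<omega> $ j)))"
    have v_M: "v \<in> borel_measurable M"
    proof -
      have "(\<lambda>\<omega>. output_cdf z h y (p k \<omega>) j) \<in> borel_measurable (F k)"
        unfolding output_cdf_def
        by (rule measurable_continuous_on_compose[OF continuous_on_process_exp[where \<epsilon> = \<epsilon>] p_adapted[OF k]]) (simp add: space_F p_mem[OF k])
      then have "v \<in> borel_measurable (F k)"
        unfolding v_def
        by (intro borel_measurable_times borel_measurable_diff borel_measurable_const e_F borel_measurable_nth_compose s_adapted k)
      then show ?thesis by (rule measurable_from_subalg[OF subalgebra])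
    qed
    have "expectation (\<lambda>\<omega>. e \<omega> * phi_s_hat h y M1 M2 (s k \<omega>) (fst (samples k \<omega>)) (fst (snd (samples k \<omega>))) $ j) = expectation v"
    proof (rule expectation_samples[where f = "\<lambda>\<omega> a. e \<omega> * phi_s_hat h y M1 M2 (s k \<omega>) (fst a) (fst (snd a)) $ j", OF k _ _ _ v_M])
      fix a :: "(nat \<Rightarrow> 't \<Rightarrow> 'x) \<times> (nat \<Rightarrow> 't \<Rightarrow> 'x) \<times> (nat \<Rightarrow> 's \<Rightarrow> 'x)"
      show "(\<lambda>\<omega>. e \<omega> * phi_s_hat h y M1 M2 (s k \<omega>) (fst a) (fst (snd a)) $ j) \<in> borel_measurable (F k)"
        using phi_s_hat_measurable[OF s_adapted[OF k], of M1 "\<lambda>r _. fst a r" M2 "\<lambda>r _. fst (snd a) r"]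
        by (intro borel_measurable_times e_F) simp
      show "AE \<omega> in M. \<bar>e \<omega> * phi_s_hat h y M1 M2 (s k \<omega>) (fst a) (fst (snd a)) $ j\<bar> \<le> R * (2 * R)"
        by (intro AE_I2 e\<phi>_le)
    next
      show "(\<lambda>\<omega>. e \<omega> * phi_s_hat h y M1 M2 (s k \<omega>) (fst (samples k \<omega>)) (fst (snd (samples k \<omega>))) $ j) \<in> borel_measurable M"
        using e_M \<phi>_M by (simp add: phi_s_hat_samples \<phi>_def)
      fix \<omega> assume "\<omega> \<in> space M"
      show "v \<omega> = measure_pmf.expectation (sample_pmf z M1 M2 M3 (p k \<omega>))
          (\<lambda>a. e \<omega> * phi_s_hat h y M1 M2 (s k \<omega>) (fst a) (fst (snd a)) $ j)"
        by (simp add: v_def expectation_phi_s_hat M1_pos M2_pos)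
    qed
    then have E_e\<phi>: "expectation (\<lambda>\<omega>. e \<omega> * \<phi> \<omega>) = expectation v" by (simp add: phi_s_hat_samples \<phi>_def)
    \<comment> \<open>Since \<open>s k\<close> lies in the band, the variational inequality of the
      projection shows that heading for the unprojected value \<open>output_cdf\<close> also reduces
      the distance to the projected one.\<close>
    have v_ge: "2 * (e \<omega>)\<^sup>2 \<le> v \<omega>" if "\<omega> \<in> space M" for \<omega>
    proof -
      have "(output_cdf z h y (p k \<omega>) j - target (p k \<omega>) $ j) * (s k \<omega> $ j - target (p k \<omega>) $ j) \<le> 0"
        unfolding target_def vec_lambda_beta band_proj_def
        by (rule closest_point_interval_inner[OF s_mem[OF k that]])
      then show ?thesis by (simp add: v_def e_def tracking_error_def power2_eq_square algebra_simps)
    qed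
    have v_int: "integrable M v"
    proof (rule integrable_AE_bounded[OF v_M AE_I2])
      fix \<omega> assume \<omega>: "\<omega> \<in> space M"
      have "\<bar>e \<omega> * (- 2 * (output_cdf z h y (p k \<omega>) j - s k \<omega> $ j))\<bar> \<le> R * (2 * R)"
      proof -
        have "\<bar>output_cdf z h y (p k \<omega>) j - s k \<omega> $ j\<bar> \<le> R"
          using process_exp_of_bool_bounds[of z "p k \<omega>" "\<lambda>x. h x \<le> y $ j"] s_mem[OF k \<omega>, of j]
          by (auto simp: R_def band_radius_def output_cdf_def)
        then show ?thesis
          using e_le[OF \<omega>] by (simp only: abs_mult, intro mult_mono) auto
      qed
      then show "\<bar>v \<omega>\<bar> \<le> R * (2 * R)" by (simp add: v_def)
    qed
    have E_v: "2 * expectation (\<lambda>\<omega>. (e \<omega>)\<^sup>2) \<le> expectation v"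
    proof -
      have "expectation (\<lambda>\<omega>. 2 * (e \<omega>)\<^sup>2) \<le> expectation v"
        by (intro Bochner_Integration.integral_mono v_int v_ge integrable_mult_right int_e2)
      then show ?thesis by simp
    qed
    have step: "AE \<omega> in M. (tracking_error j (Suc k) \<omega>)\<^sup>2 \<le>
        (1 + B) * ((e \<omega>)\<^sup>2 - 2 * B * (e \<omega> * \<phi> \<omega>) + B\<^sup>2 * (\<phi> \<omega>)\<^sup>2) + (1 + 1 / B) * (K * \<gamma> k)\<^sup>2"
      using AE_samples_support[OF k] AE_space
    proof eventually_elim
      case (elim \<omega>)
      note pk = p_mem[OF k elim(2)] and pk' = p_mem[OF _ elim(2), of "Suc k", simplified]
      define x where "x = s (Suc k) \<omega> $ j - target (p k \<omega>) $ j"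
      define w where "w = target (p k \<omega>) $ j - target (p (Suc k) \<omega>) $ j"
      have "norm (p (Suc k) \<omega> - p k \<omega>) \<le> 2 * \<gamma> k * norm (search_direction z h g y M1 M2 M3 (lam k) (p k \<omega>) (s k \<omega>) (samples k \<omega>))"
        by (rule mirror_step_bound(2)[OF eps_pos pk pk _ gamma_nonneg[OF k]])
          (unfold search_direction_samples, rule p_step[OF k elim(2)])
      also have "\<dots> \<le> 2 * \<gamma> k * Cd"
        using gamma_nonneg[OF k] by (intro mult_left_mono Cd(2) pk s_mem[OF k elim(2)] elim(1) lam[OF k]) auto
      finally have "norm (p k \<omega> - p (Suc k) \<omega>) \<le> 2 * Cd * \<gamma> k" by (simp add: norm_minus_commute mult_ac)
      then have "real CARD('t \<Rightarrow> 'm) * real CARD('t) * norm (p k \<omega> - p (Suc k) \<omega>) \<le>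
          real CARD('t \<Rightarrow> 'm) * real CARD('t) * (2 * Cd * \<gamma> k)"
        by (rule mult_left_mono) simp
      from order_trans[OF target_lipschitz[OF pk pk', of j] this]
      have "\<bar>w\<bar> \<le> K * \<gamma> k" by (simp add: w_def K_def mult_ac)
      then have w2: "w\<^sup>2 \<le> (K * \<gamma> k)\<^sup>2" using abs_le_square_iff[of w "K * \<gamma> k"] by auto
      \<comment> \<open>The target is a fixed point of the projection, which is nonexpansive; hence
        projecting the update cannot enlarge the error.\<close>
      have "closest_point {lower_bd y q j .. upper_bd y q j} (target (p k \<omega>) $ j) = target (p k \<omega>) $ j"
        by (rule closest_point_self[OF target_mem])
      then have "\<bar>x\<bar> \<le> \<bar>e \<omega> - B * \<phi> \<omega>\<bar>"
        using closest_point_interval_lipschitz[OF bands[of j], of "s k \<omega> $ j - B * \<phi> \<omega>" "target (p k \<omega>) $ j"]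
        by (simp add: x_def s_step[OF k elim(2)] band_proj_def e_def tracking_error_def \<phi>_def B_def algebra_simps)
      then have x2: "x\<^sup>2 \<le> (e \<omega>)\<^sup>2 - 2 * B * (e \<omega> * \<phi> \<omega>) + B\<^sup>2 * (\<phi> \<omega>)\<^sup>2"
        by (simp add: abs_le_square_iff power2_eq_square algebra_simps)
      have "(tracking_error j (Suc k) \<omega>)\<^sup>2 = (x + w)\<^sup>2" by (simp add: tracking_error_def x_def w_def)
      \<comment> \<open>Weight \<open>B = \<beta> k\<close> in Young's inequality: the factor
        \<open>1 + B\<close> is small enough to leave a contraction, and the drift is inflated by
        \<open>1 / B\<close>, the source of the forcing
        \<open>(\<gamma> k)\<^sup>2 / \<beta> k\<close>.\<close>
      also have "\<dots> \<le> (1 + B) * x\<^sup>2 + (1 + 1 / B) * w\<^sup>2" by (rule square_add_le_weighted[OF B(1)])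
      also have "\<dots> \<le> (1 + B) * ((e \<omega>)\<^sup>2 - 2 * B * (e \<omega> * \<phi> \<omega>) + B\<^sup>2 * (\<phi> \<omega>)\<^sup>2) + (1 + 1 / B) * (K * \<gamma> k)\<^sup>2"
        using B(1) by (intro add_mono mult_left_mono x2 w2) auto
      finally show ?case .
    qed
    define A where "A = expectation (\<lambda>\<omega>. (e \<omega>)\<^sup>2)"
    have A0: "0 \<le> A" unfolding A_def by (rule Bochner_Integration.integral_nonneg) simp
    have "expectation (\<lambda>\<omega>. (tracking_error j (Suc k) \<omega>)\<^sup>2) \<le> expectation (\<lambda>\<omega>.
        (1 + B) * ((e \<omega>)\<^sup>2 - 2 * B * (e \<omega> * \<phi> \<omega>) + B\<^sup>2 * (\<phi> \<omega>)\<^sup>2) + (1 + 1 / B) * (K * \<gamma> k)\<^sup>2)"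
      by (rule integral_mono_AE[OF int_e'2 _ step]) (intro Bochner_Integration.integrable_add
        Bochner_Integration.integrable_diff integrable_mult_right integrable_const int_e2 int_e\<phi> int_\<phi>2)
    also have "\<dots> = (1 + B) * (A - 2 * B * expectation v + B\<^sup>2 * expectation (\<lambda>\<omega>. (\<phi> \<omega>)\<^sup>2)) + (1 + 1 / B) * (K * \<gamma> k)\<^sup>2"
      by (simp add: int_e2 int_e\<phi> int_\<phi>2 E_e\<phi> A_def prob_space)
    also have "\<dots> \<le> (1 + B) * (A - 2 * B * (2 * A) + B\<^sup>2 * (4 * R\<^sup>2)) + (1 + 1 / B) * (K * \<gamma> k)\<^sup>2"
      using B(1) E_v E_\<phi>2 by (intro add_right_mono mult_left_mono add_mono diff_mono) (auto simp: A_def)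
    \<comment> \<open>The gradient step contracts by \<open>1 - 4 * B\<close>, and
      \<open>(1 + B) * (1 - 4 * B) = 1 - 3 * B - 4 * B\<^sup>2\<close>.\<close>
    also have "\<dots> = (1 - 3 * B) * A - 4 * B\<^sup>2 * A + (1 + B) * (4 * R\<^sup>2) * B\<^sup>2 + (1 + B) * K\<^sup>2 * ((\<gamma> k)\<^sup>2 / B)"
      using B(1) by (simp add: field_simps power2_eq_square)
    also have "\<dots> \<le> (1 - 3 * B) * A + (1 + b) * (4 * R\<^sup>2) * B\<^sup>2 + (1 + b) * K\<^sup>2 * ((\<gamma> k)\<^sup>2 / B)"
    proof -
      have "0 \<le> 4 * B\<^sup>2 * A" using A0 by simp
      moreover have "(1 + B) * (4 * R\<^sup>2) * B\<^sup>2 \<le> (1 + b) * (4 * R\<^sup>2) * B\<^sup>2"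
        using B by (intro mult_right_mono) auto
      moreover have "(1 + B) * K\<^sup>2 * ((\<gamma> k)\<^sup>2 / B) \<le> (1 + b) * K\<^sup>2 * ((\<gamma> k)\<^sup>2 / B)"
        using B by (intro mult_right_mono) auto
      ultimately show ?thesis by linarith
    qed
    also have "\<dots> \<le> (1 - 3 * B) * A + C * (B\<^sup>2 + (\<gamma> k)\<^sup>2 / B)"
    proof -
      have "(1 + b) * (4 * R\<^sup>2) * B\<^sup>2 \<le> C * B\<^sup>2" "(1 + b) * K\<^sup>2 * ((\<gamma> k)\<^sup>2 / B) \<le> C * ((\<gamma> k)\<^sup>2 / B)"
        unfolding C_def using B b by (intro mult_right_mono mult_left_mono; simp)+
      then show ?thesis by (simp add: distrib_left)
    qed
    finally show ?thesis by (simp add: A_def e_def B_def)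
  qed
  with C0 show ?thesis by (rule that)
qed

text \<open>The nonincreasing weights \<open>t\<close> damp the forcing, since
  \<open>(\<beta> k)\<^sup>2\<close> alone need not be summable. Telescoping the weighted recursion
  makes \<open>t k * \<beta> k\<close> times the mean square error summable, and the third series is
  what it costs to pass from squares to absolute values.\<close>

lemma tracking_error_summable:
  assumes \<beta>: "\<And>k. 1 \<le> k \<Longrightarrow> 0 < \<beta> k" "\<And>k. 1 \<le> k \<Longrightarrow> \<beta> k \<le> b"
    and lam: "\<And>k. 1 \<le> k \<Longrightarrow> \<bar>lam k\<bar> \<le> \<Lambda>"
    and t: "\<And>k. 1 \<le> k \<Longrightarrow> 0 < t k" "\<And>k. 1 \<le> k \<Longrightarrow> t (Suc k) \<le> t k"
    and sums: "summable (\<lambda>k. t k * (\<beta> k)\<^sup>2)" "summable (\<lambda>k. t k * ((\<gamma> k)\<^sup>2 / \<beta> k))"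
      "summable (\<lambda>k. (\<gamma> k)\<^sup>2 / (t k * \<beta> k))"
  shows "AE \<omega> in M. summable (\<lambda>k. \<gamma> k * \<bar>tracking_error j k \<omega>\<bar>)"
proof -
  define A where "A = (\<lambda>k. expectation (\<lambda>\<omega>. (tracking_error j k \<omega>)\<^sup>2))"
  have A0: "0 \<le> A k" for k unfolding A_def by (rule Bochner_Integration.integral_nonneg) simp
  obtain C where C: "0 \<le> C" "\<And>k. 1 \<le> k \<Longrightarrow> A (Suc k) \<le> (1 - 3 * \<beta> k) * A k + C * ((\<beta> k)\<^sup>2 + (\<gamma> k)\<^sup>2 / \<beta> k)"
    unfolding A_def by (rule tracking_recursion[OF \<beta> lam, where j = j]) auto
  have "summable (\<lambda>k. 3 * (t k * \<beta> k * A k))"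
  proof (rule almost_decreasing_convergent(2)[where n = 1 and v = "\<lambda>k. t k * A k" and D = "\<lambda>_. 0"
        and r = "\<lambda>k. C * (t k * (\<beta> k)\<^sup>2 + t k * ((\<gamma> k)\<^sup>2 / \<beta> k))"])
    fix k :: nat assume k: "1 \<le> k"
    have "t (Suc k) * A (Suc k) \<le> t k * A (Suc k)" by (intro mult_right_mono t(2) k A0)
    also have "\<dots> \<le> t k * ((1 - 3 * \<beta> k) * A k + C * ((\<beta> k)\<^sup>2 + (\<gamma> k)\<^sup>2 / \<beta> k))"
      using t(1)[OF k] by (intro mult_left_mono C(2) k) auto
    finally show "t (Suc k) * A (Suc k) \<le> t k * A k - 3 * (t k * \<beta> k * A k) - 0 +
        C * (t k * (\<beta> k)\<^sup>2 + t k * ((\<gamma> k)\<^sup>2 / \<beta> k))" by (simp add: algebra_simps)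
    show "0 \<le> t k * A k" "0 \<le> 3 * (t k * \<beta> k * A k)"
      using t(1)[OF k] \<beta>(1)[OF k] A0[of k] by auto
  qed (intro summable_mult summable_add sums summable_zero)+
  \<comment> \<open>Shifted because signs and integrability are known from index 1 on, while the
    monotone convergence lemma asks for them at every index.\<close>
  then have sA: "summable (\<lambda>k. t (Suc k) * \<beta> (Suc k) * A (Suc k))"
    unfolding summable_Suc_iff[of "\<lambda>k. t k * \<beta> k * A k"] using summable_mult_D[of 3] by fastforce
  have "AE \<omega> in M. summable (\<lambda>k. t (Suc k) * \<beta> (Suc k) * (tracking_error j (Suc k) \<omega>)\<^sup>2)"
  proof (rule summable_expectation_AE_summable)
    fix k
    have "integrable M (\<lambda>\<omega>. (tracking_error j (Suc k) \<omega>)\<^sup>2)" by (rule tracking_error_sq_integrable) simp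
    then show "integrable M (\<lambda>\<omega>. t (Suc k) * \<beta> (Suc k) * (tracking_error j (Suc k) \<omega>)\<^sup>2)" by simp
    show "0 \<le> t (Suc k) * \<beta> (Suc k) * (tracking_error j (Suc k) \<omega>)\<^sup>2" for \<omega>
      using t(1)[of "Suc k"] \<beta>(1)[of "Suc k"] by simp
  next
    show "summable (\<lambda>k. expectation (\<lambda>\<omega>. t (Suc k) * \<beta> (Suc k) * (tracking_error j (Suc k) \<omega>)\<^sup>2))"
      using sA by (simp add: A_def)
  qed
  then show ?thesis
  proof eventually_elim
    case (elim \<omega>)
    have "summable (\<lambda>k. \<gamma> (Suc k) * \<bar>tracking_error j (Suc k) \<omega>\<bar>)"
    proof (rule summable_comparison_test')
      show "summable (\<lambda>k. t (Suc k) * \<beta> (Suc k) * (tracking_error j (Suc k) \<omega>)\<^sup>2 + (\<gamma> (Suc k))\<^sup>2 / (t (Suc k) * \<beta> (Suc k)))"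
        using elim sums(3)[THEN summable_Suc_iff[THEN iffD2]] by (rule summable_add)
      fix k :: nat
      define c where "c = t (Suc k) * \<beta> (Suc k)"
      define d where "d = \<bar>tracking_error j (Suc k) \<omega>\<bar>"
      have c: "0 < c" using t(1)[of "Suc k"] \<beta>(1)[of "Suc k"] by (simp add: c_def)
      have gn: "0 \<le> \<gamma> (Suc k)" by (rule gamma_nonneg) simp
      \<comment> \<open>The arithmetic-geometric mean inequality, balancing the squared error with
        weight \<open>c\<close> against \<open>(\<gamma> (Suc k))\<^sup>2 / c\<close>.\<close>
      have "0 \<le> (c * d - \<gamma> (Suc k))\<^sup>2 / c" using c by simp
      also have "(c * d - \<gamma> (Suc k))\<^sup>2 / c = c * d\<^sup>2 - 2 * (\<gamma> (Suc k) * d) + (\<gamma> (Suc k))\<^sup>2 / c"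
        using c by (simp add: field_simps power2_eq_square)
      finally have "\<gamma> (Suc k) * d \<le> c * d\<^sup>2 + (\<gamma> (Suc k))\<^sup>2 / c"
        using mult_nonneg_nonneg[OF gn, of d] by (simp add: d_def)
      then show "norm (\<gamma> (Suc k) * \<bar>tracking_error j (Suc k) \<omega>\<bar>) \<le>
          t (Suc k) * \<beta> (Suc k) * (tracking_error j (Suc k) \<omega>)\<^sup>2 + (\<gamma> (Suc k))\<^sup>2 / (t (Suc k) * \<beta> (Suc k))"
        using gn by (simp add: abs_mult c_def d_def)
    qed
    then show ?case by (simp only: summable_Suc_iff[of "\<lambda>k. \<gamma> k * \<bar>tracking_error j k \<omega>\<bar>"])
  qed
qed

end

section \<open>Descent of the relative entropy and convergence of the iterates\<close>

lemma tracking_gradient_diff: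
  fixes z :: "'m::finite \<Rightarrow> 'x"
  shows
  "tracking_gradient z h y w v = tracking_gradient z h y w' v -
     2 *\<^sub>R (\<Sum>j\<in>UNIV. (w $ j - w' $ j) *\<^sub>R score_mean z (\<lambda>x. of_bool (h x \<le> y $ j)) v)"
proof -
  have "(output_cdf z h y v j - w $ j) *\<^sub>R G = (output_cdf z h y v j - w' $ j) *\<^sub>R G - (w $ j - w' $ j) *\<^sub>R G" for j and G :: "real ^ 'm"
    by (simp add: scaleR_diff_left)
  then show ?thesis by (simp only: tracking_gradient_def sum_subtractf scaleR_diff_right)
qed

context sampled_mirror_descent
begin

text \<open>The error sequences depend on the path, so they are existentially quantified inside the
  almost sure statement; afterwards only the deterministic lemmas are needed.\<close>

lemma descent_inequality:
  assumes \<beta>: "\<And>k. 1 \<le> k \<Longrightarrow> 0 < \<beta> k" "\<And>k. 1 \<le> k \<Longrightarrow> \<beta> k \<le> b"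
    and lam: "\<And>k. 1 \<le> k \<Longrightarrow> \<bar>lam k\<bar> \<le> \<Lambda>"
    and t: "\<And>k. 1 \<le> k \<Longrightarrow> 0 < t k" "\<And>k. 1 \<le> k \<Longrightarrow> t (Suc k) \<le> t k"
    and sums: "summable (\<lambda>k. t k * (\<beta> k)\<^sup>2)" "summable (\<lambda>k. t k * ((\<gamma> k)\<^sup>2 / \<beta> k))"
      "summable (\<lambda>k. (\<gamma> k)\<^sup>2 / (t k * \<beta> k))" "summable (\<lambda>k. (\<gamma> k)\<^sup>2)"
    and u: "\<And>k. 1 \<le> k \<Longrightarrow> u k \<in> prob_simplex_ge \<epsilon>" and du: "summable (\<lambda>k. norm (u (Suc k) - u k))"
  shows "AE \<omega> in M. \<exists>D r. summable D \<and> summable r \<and> (\<forall>k\<ge>1. kl (p (Suc k) \<omega>) (u (Suc k)) \<le>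
    kl (p k \<omega>) (u k) - \<gamma> k * (mean_direction z h g y (lam k) (p k \<omega>) (target (p k \<omega>)) \<bullet> (p k \<omega> - u k)) - D k + r k)"
proof -
  obtain Cd where Cd: "0 \<le> Cd"
    "\<And>v w a l. v \<in> prob_simplex_ge \<epsilon> \<Longrightarrow> (\<And>j. w $ j \<in> {lower_bd y q j .. upper_bd y q j}) \<Longrightarrow>
       a \<in> sample_support z M1 M2 M3 \<Longrightarrow> \<bar>l\<bar> \<le> \<Lambda> \<Longrightarrow> norm (search_direction z h g y M1 M2 M3 l v w a) \<le> Cd"
    by (rule search_direction_bounded[of \<Lambda>]) blast
  define G where "G = (\<lambda>j. score_mean z (\<lambda>x. of_bool (h x \<le> y $ j)))"
  have "\<exists>B. \<forall>v\<in>prob_simplex_ge \<epsilon>. norm (G j v) \<le> B" for j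
    unfolding G_def
    by (rule continuous_on_compact_bound[OF compact_prob_simplex_ge continuous_on_score_mean[OF eps_pos]]) blast
  then obtain B where B: "\<And>j v. v \<in> prob_simplex_ge \<epsilon> \<Longrightarrow> norm (G j v) \<le> B j" by metis
  define L where "L = real CARD('m) * (1 + 1 / \<epsilon>)"
  have "AE \<omega> in M. summable (\<lambda>k. noise u k \<omega>)" by (rule noise_summable[OF u lam sums(4)])
  moreover have "AE \<omega> in M. \<forall>j\<in>UNIV. summable (\<lambda>k. \<gamma> k * \<bar>tracking_error j k \<omega>\<bar>)"
    by (intro AE_finite_allI tracking_error_summable[OF \<beta> lam t sums(1-3)]) auto
  moreover have "AE \<omega> in M. \<forall>k. 1 \<le> k \<longrightarrow> samples k \<omega> \<in> sample_support z M1 M2 M3"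
    unfolding AE_all_countable by (intro allI AE_impI AE_samples_support)
  ultimately show ?thesis
    using AE_space
  proof eventually_elim
    case (elim \<omega>)
    \<comment> \<open>The three summands pay for the second-order term of the mirror step, for
      moving the reference point, and for using \<open>s k\<close> instead of the target in the
      gradient.\<close>
    define r where "r = (\<lambda>k. Cd\<^sup>2 / 2 * (\<gamma> k)\<^sup>2 + L * norm (u (Suc k) - u k) +
        2 * real CARD('m) * (\<Sum>j\<in>UNIV. B j * (\<gamma> k * \<bar>tracking_error j k \<omega>\<bar>)))"
    have "summable r"
      unfolding r_def using elim(2)
      by (intro summable_add summable_mult summable_sum sums du) auto
    moreover have "kl (p (Suc k) \<omega>) (u (Suc k)) \<le> kl (p k \<omega>) (u k)
        - \<gamma> k * (mean_direction z h g y (lam k) (p k \<omega>) (target (p k \<omega>)) \<bullet> (p k \<omega> - u k)) - noise u k \<omega> + r k"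
      if k: "1 \<le> k" for k
    proof -
      note pk = p_mem[OF k elim(4)] and pk' = p_mem[OF _ elim(4), of "Suc k", simplified]
      define d where "d = search_direction z h g y M1 M2 M3 (lam k) (p k \<omega>) (s k \<omega>) (samples k \<omega>)"
      define w where "w = p k \<omega> - u k"
      have "kl (p (Suc k) \<omega>) (u k) \<le> kl (p k \<omega>) (u k) - \<gamma> k * (d \<bullet> (p k \<omega> - u k)) + (\<gamma> k)\<^sup>2 * (norm d)\<^sup>2 / 2"
        unfolding d_def
        by (rule mirror_step_bound(1)[OF eps_pos pk u[OF k] _ gamma_nonneg[OF k]])
          (unfold search_direction_samples, rule p_step[OF k elim(4)])
      moreover have "(\<gamma> k)\<^sup>2 * (norm d)\<^sup>2 / 2 \<le> Cd\<^sup>2 / 2 * (\<gamma> k)\<^sup>2"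
      proof -
        have "norm d \<le> Cd" unfolding d_def
          by (rule Cd(2)[OF pk s_mem[OF k elim(4)] elim(3)[rule_format, OF k] lam[OF k]])
        then have "(norm d)\<^sup>2 \<le> Cd\<^sup>2" by (intro power_mono) auto
        from mult_left_mono[OF this, of "(\<gamma> k)\<^sup>2 / 2"] show ?thesis by (simp add: mult.commute)
      qed
      moreover have "kl (p (Suc k) \<omega>) (u (Suc k)) - kl (p (Suc k) \<omega>) (u k) \<le> L * norm (u (Suc k) - u k)"
        unfolding L_def by (rule kl_lipschitz[OF eps_pos pk' u u[OF k]]) simp
      moreover have "- \<gamma> k * (d \<bullet> w) \<le> - noise u k \<omega> -
          \<gamma> k * (mean_direction z h g y (lam k) (p k \<omega>) (target (p k \<omega>)) \<bullet> w) +
          2 * real CARD('m) * (\<Sum>j\<in>UNIV. B j * (\<gamma> k * \<bar>tracking_error j k \<omega>\<bar>))"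
      proof -
        \<comment> \<open>The mean direction is affine in \<open>s\<close>, so the bias is linear in
          the tracking errors with bounded coefficients.\<close>
        have "mean_direction z h g y (lam k) (p k \<omega>) (s k \<omega>) =
            mean_direction z h g y (lam k) (p k \<omega>) (target (p k \<omega>)) - 2 *\<^sub>R (\<Sum>j\<in>UNIV. tracking_error j k \<omega> *\<^sub>R G j (p k \<omega>))"
          unfolding mean_direction_def tracking_error_def G_def
            tracking_gradient_diff[of z h y "s k \<omega>" "p k \<omega>" "target (p k \<omega>)"] by simp
        then have "mean_direction z h g y (lam k) (p k \<omega>) (s k \<omega>) \<bullet> w =
            mean_direction z h g y (lam k) (p k \<omega>) (target (p k \<omega>)) \<bullet> w - 2 * (\<Sum>j\<in>UNIV. tracking_error j k \<omega> * (G j (p k \<omega>) \<bullet> w))"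
          by (simp add: inner_diff_left inner_sum_left)
        moreover have "(\<Sum>j\<in>UNIV. tracking_error j k \<omega> * (G j (p k \<omega>) \<bullet> w)) \<le> (\<Sum>j\<in>UNIV. \<bar>tracking_error j k \<omega>\<bar> * (B j * real CARD('m)))"
        proof (rule sum_mono)
          fix j
          have "\<bar>G j (p k \<omega>) \<bullet> w\<bar> \<le> B j * real CARD('m)"
            using order_trans[OF norm_ge_zero B[OF pk]]
            by (intro order_trans[OF Cauchy_Schwarz_ineq2] mult_mono B pk) (simp_all add: w_def norm_diff_simplex_le pk u[OF k])
          then have "\<bar>tracking_error j k \<omega> * (G j (p k \<omega>) \<bullet> w)\<bar> \<le> \<bar>tracking_error j k \<omega>\<bar> * (B j * real CARD('m))"
            unfolding abs_mult by (rule mult_left_mono) simp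
          then show "tracking_error j k \<omega> * (G j (p k \<omega>) \<bullet> w) \<le> \<bar>tracking_error j k \<omega>\<bar> * (B j * real CARD('m))" by linarith
        qed
        ultimately have "mean_direction z h g y (lam k) (p k \<omega>) (target (p k \<omega>)) \<bullet> w -
            2 * (\<Sum>j\<in>UNIV. \<bar>tracking_error j k \<omega>\<bar> * (B j * real CARD('m))) \<le>
            mean_direction z h g y (lam k) (p k \<omega>) (s k \<omega>) \<bullet> w" by linarith
        from mult_left_mono[OF this gamma_nonneg[OF k]]
        have "\<gamma> k * (mean_direction z h g y (lam k) (p k \<omega>) (target (p k \<omega>)) \<bullet> w) -
            2 * real CARD('m) * (\<Sum>j\<in>UNIV. B j * (\<gamma> k * \<bar>tracking_error j k \<omega>\<bar>)) \<le>
            \<gamma> k * (mean_direction z h g y (lam k) (p k \<omega>) (s k \<omega>) \<bullet> w)"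
          by (simp add: right_diff_distrib sum_distrib_left mult_ac)
        moreover have "noise u k \<omega> = \<gamma> k * (d \<bullet> w) - \<gamma> k * (mean_direction z h g y (lam k) (p k \<omega>) (s k \<omega>) \<bullet> w)"
          by (simp add: noise_def d_def w_def inner_diff_left right_diff_distrib)
        ultimately show ?thesis by simp
      qed
      ultimately show ?thesis by (simp add: r_def w_def)
    qed
    ultimately show ?case using elim(1)
      by (intro exI[of _ "\<lambda>k. noise u k \<omega>"] exI[of _ r] conjI allI impI)
  qed
qed

lemma gateaux_on_simplex_ge:
  assumes "v \<in> prob_simplex_ge \<epsilon>"
  shows "gateaux (psi z g) v = score_mean z g v"
    and "gateaux (penalty z h y q) v = tracking_gradient z h y (target v) v"
proof -
  have "0 < v $ i" for i using prob_simplex_geD(2)[OF assms, of i] eps_pos by simp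
  then show "gateaux (psi z g) v = score_mean z g v"
    "gateaux (penalty z h y q) v = tracking_gradient z h y (target v) v"
    using prob_simplex_geD(1)[OF assms] support bands
    by (auto simp: gateaux_psi gateaux_penalty target_def)
qed

lemma continuous_on_gateaux:
  "continuous_on (prob_simplex_ge \<epsilon>) (gateaux (psi z g))"
  "continuous_on (prob_simplex_ge \<epsilon>) (gateaux (penalty z h y q))"
proof -
  show "continuous_on (prob_simplex_ge \<epsilon>) (gateaux (psi z g))"
    by (rule continuous_on_eq[OF continuous_on_score_mean[OF eps_pos]]) (simp add: gateaux_on_simplex_ge)
  have target: "continuous_on (prob_simplex_ge \<epsilon>) (\<lambda>v. target v $ j)" for j
  proof (rule lipschitz_on_continuous_on, rule lipschitz_onI)
    fix v w :: "real ^ 'm" assume "v \<in> prob_simplex_ge \<epsilon>" "w \<in> prob_simplex_ge \<epsilon>"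
    from target_lipschitz[OF this]
    show "dist (target v $ j) (target w $ j) \<le> real CARD('t \<Rightarrow> 'm) * real CARD('t) * dist v w"
      by (simp add: dist_norm)
  qed simp
  have "continuous_on (prob_simplex_ge \<epsilon>) (\<lambda>v. tracking_gradient z h y (target v) v)"
    unfolding tracking_gradient_def output_cdf_def
    by (intro continuous_intros target continuous_on_process_exp continuous_on_score_mean eps_pos)
  then show "continuous_on (prob_simplex_ge \<epsilon>) (gateaux (penalty z h y q))"
    by (rule continuous_on_eq) (simp add: gateaux_on_simplex_ge)
qed

lemma gateaux_penalty_feasible:
  assumes "v \<in> feasible_set z h y q \<epsilon>"
  shows "gateaux (penalty z h y q) v = 0"
proof -
  have v: "v \<in> prob_simplex_ge \<epsilon>" using assms by (simp add: feasible_set_def)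
  have "target v $ j = output_cdf z h y v j" for j
    unfolding target_def vec_lambda_beta band_proj_def
    by (rule closest_point_self) (use assms in \<open>auto simp: feasible_set_def\<close>)
  then show ?thesis by (simp add: gateaux_on_simplex_ge[OF v] tracking_gradient_def)
qed

text \<open>The index \<open>n\<close> separates an initial stretch, in which \<open>lam k\<close>
  may lie outside the range of the penalized program, from the part where rate and nonnegativity of
  the gap are available. \<open>u\<close> abstracts from the penalized optima so that it can be
  defined on the initial stretch too.\<close>

lemma iterates_converge:
  assumes \<beta>: "\<And>k. 1 \<le> k \<Longrightarrow> 0 < \<beta> k" "\<And>k. 1 \<le> k \<Longrightarrow> \<beta> k \<le> b"
    and lam: "\<And>k. 1 \<le> k \<Longrightarrow> 0 < lam k" "lam \<longlonglongrightarrow> 0"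
    and t: "\<And>k. 1 \<le> k \<Longrightarrow> 0 < t k" "\<And>k. 1 \<le> k \<Longrightarrow> t (Suc k) \<le> t k"
    and sums: "summable (\<lambda>k. t k * (\<beta> k)\<^sup>2)" "summable (\<lambda>k. t k * ((\<gamma> k)\<^sup>2 / \<beta> k))"
      "summable (\<lambda>k. (\<gamma> k)\<^sup>2 / (t k * \<beta> k))" "summable (\<lambda>k. (\<gamma> k)\<^sup>2)"
    and diverge: "\<not> summable (\<lambda>k. \<gamma> k * lam k)"
    and u: "\<And>k. 1 \<le> k \<Longrightarrow> u k \<in> prob_simplex_ge \<epsilon>" and du: "summable (\<lambda>k. norm (u (Suc k) - u k))"
    and n: "1 \<le> n" and rate: "\<And>k. n \<le> k \<Longrightarrow> norm (u k - p_opt) \<le> C * lam k"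
    and gap: "\<And>k v. n \<le> k \<Longrightarrow> v \<in> prob_simplex_ge \<epsilon> \<Longrightarrow>
      (lam k *\<^sub>R gateaux (psi z g) v + gateaux (penalty z h y q) v) \<bullet> (v - u k) \<ge> 0"
    and p_opt: "p_opt \<in> prob_simplex_ge \<epsilon>"
    and objective: "\<And>v. v \<in> feasible_set z h y q \<epsilon> \<Longrightarrow> v \<noteq> p_opt \<Longrightarrow> gateaux (psi z g) v \<bullet> (v - p_opt) > 0"
    and infeasible: "\<And>v. v \<in> prob_simplex_ge \<epsilon> \<Longrightarrow> v \<notin> feasible_set z h y q \<epsilon> \<Longrightarrow>
      gateaux (penalty z h y q) v \<bullet> (v - p_opt) > 0"
  shows "AE \<omega> in M. (\<lambda>k. p k \<omega>) \<longlonglongrightarrow> p_opt"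
proof -
  obtain \<Lambda> where \<Lambda>: "\<And>k. \<bar>lam k\<bar> \<le> \<Lambda>"
    using convergent_imp_Bseq[OF convergentI[OF lam(2)]] by (auto simp: Bseq_def)
  let ?H = "\<lambda>k v. lam k *\<^sub>R gateaux (psi z g) v + gateaux (penalty z h y q) v"
  have u_lim: "u \<longlonglongrightarrow> p_opt"
  proof (rule LIM_zero_cancel, rule tendsto_0_le[OF lam(2)])
    show "\<forall>\<^sub>F k in sequentially. norm (u k - p_opt) \<le> norm (lam k) * C"
      using eventually_ge_at_top[of n]
      by eventually_elim (use rate lam(1) n in \<open>auto simp: mult.commute abs_of_pos\<close>)
  qed
  have pos: "0 < v $ i" if "v \<in> prob_simplex_ge \<epsilon>" for v :: "real ^ 'm" and i
    using prob_simplex_geD(2)[OF that, of i] eps_pos by simp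
  have kl_low: "(norm (v - w))\<^sup>2 / 2 \<le> kl w v" if "v \<in> prob_simplex_ge \<epsilon>" "w \<in> prob_simplex_ge \<epsilon>" for v w :: "real ^ 'm"
    using that by (intro kl_ge) (auto intro: pos prob_simplex_geD)
  have "AE \<omega> in M. \<exists>D r. summable D \<and> summable r \<and> (\<forall>k\<ge>1. kl (p (Suc k) \<omega>) (u (Suc k)) \<le>
    kl (p k \<omega>) (u k) - \<gamma> k * (mean_direction z h g y (lam k) (p k \<omega>) (target (p k \<omega>)) \<bullet> (p k \<omega> - u k)) - D k + r k)"
    by (rule descent_inequality[OF \<beta> _ t sums u du]) (use \<Lambda> in auto)
  then show ?thesis
    using AE_space
  proof eventually_elim
    case (elim \<omega>)
    obtain D r where D: "summable D" and r: "summable r"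
      and step: "\<And>k. 1 \<le> k \<Longrightarrow> kl (p (Suc k) \<omega>) (u (Suc k)) \<le> kl (p k \<omega>) (u k)
        - \<gamma> k * (mean_direction z h g y (lam k) (p k \<omega>) (target (p k \<omega>)) \<bullet> (p k \<omega> - u k)) - D k + r k"
      using elim(1) by blast
    have pk: "p k \<omega> \<in> prob_simplex_ge \<epsilon>" if "n \<le> k" for k using p_mem[OF _ elim(2)] that n by simp
    have uk: "u k \<in> prob_simplex_ge \<epsilon>" if "n \<le> k" for k using u that n by simp
    have H: "mean_direction z h g y (lam k) (p k \<omega>) (target (p k \<omega>)) = ?H k (p k \<omega>)" if "n \<le> k" for k
      by (simp add: mean_direction_def gateaux_on_simplex_ge[OF pk[OF that]])
    define v where "v = (\<lambda>k. kl (p k \<omega>) (u k))"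
    have v0: "0 \<le> v k" if "n \<le> k" for k
      unfolding v_def using order_trans[OF _ kl_low[OF uk[OF that] pk[OF that]]] by simp
    have g0: "0 \<le> \<gamma> k * (?H k (p k \<omega>) \<bullet> (p k \<omega> - u k))" if "n \<le> k" for k
      using that n by (intro mult_nonneg_nonneg gamma_nonneg gap pk) auto
    have vstep: "v (Suc k) \<le> v k - \<gamma> k * (?H k (p k \<omega>) \<bullet> (p k \<omega> - u k)) - D k + r k" if "n \<le> k" for k
      using step[of k] that n by (simp add: v_def H[OF that])
    have conv: "convergent v" and sumg: "summable (\<lambda>k. \<gamma> k * (?H k (p k \<omega>) \<bullet> (p k \<omega> - u k)))"
      using almost_decreasing_convergent[of n v "\<lambda>k. \<gamma> k * (?H k (p k \<omega>) \<bullet> (p k \<omega> - u k))" D r, OF vstep v0 g0 D r]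
      by auto
    \<comment> \<open>The subsequence may depend on the path. It only serves to identify the limit
      of the whole entropy sequence, which is already known to exist.\<close>
    obtain \<sigma> where \<sigma>: "strict_mono \<sigma>" and lim: "(\<lambda>k. p (\<sigma> k) \<omega>) \<longlonglongrightarrow> p_opt"
    proof (rule penalized_gap_subseq[where n = n and x = "\<lambda>k. p k \<omega>" and u = u and R = "feasible_set z h y q \<epsilon>"
          and A = "gateaux (psi z g)" and B = "gateaux (penalty z h y q)" and opt = p_opt and lam = lam and \<gamma> = \<gamma> and C = C,
          OF compact_prob_simplex_ge pk _ continuous_on_gateaux gateaux_penalty_feasible objective infeasible lam(2) _ rate _ diverge _ sumg])
      show "feasible_set z h y q \<epsilon> \<subseteq> prob_simplex_ge \<epsilon>" by (auto simp: feasible_set_def)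
      show "0 < lam k" "0 \<le> \<gamma> k" if "n \<le> k" for k using lam(1) gamma_nonneg n that by simp_all
      show "0 \<le> (lam k *\<^sub>R gateaux (psi z g) (p k \<omega>) + gateaux (penalty z h y q) (p k \<omega>)) \<bullet> (p k \<omega> - u k)"
        if "n \<le> k" for k by (rule gap[OF that pk[OF that]])
    qed
    have "(\<lambda>k. v (\<sigma> k)) \<longlonglongrightarrow> kl p_opt p_opt"
    proof -
      have "(\<lambda>k. (\<lambda>(p, u). kl p u) (p (\<sigma> k) \<omega>, u (\<sigma> k))) \<longlonglongrightarrow> (\<lambda>(p, u). kl p u) (p_opt, p_opt)"
      proof (rule continuous_on_tendsto_compose[OF continuous_on_kl[OF eps_pos]])
        show "(\<lambda>k. (p (\<sigma> k) \<omega>, u (\<sigma> k))) \<longlonglongrightarrow> (p_opt, p_opt)"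
          using LIMSEQ_subseq_LIMSEQ[OF u_lim \<sigma>] by (intro tendsto_Pair lim) (simp add: o_def)
        show "\<forall>\<^sub>F k in sequentially. (p (\<sigma> k) \<omega>, u (\<sigma> k)) \<in> prob_simplex_ge \<epsilon> \<times> prob_simplex_ge \<epsilon>"
          using eventually_ge_at_top[of n]
        proof eventually_elim
          case (elim k)
          then have "n \<le> \<sigma> k" using seq_suble[OF \<sigma>, of k] by simp
          then show ?case using pk uk by simp
        qed
      qed (use p_opt in simp)
      then show ?thesis by (simp add: v_def)
    qed
    moreover obtain l where l: "v \<longlonglongrightarrow> l" using conv by (auto simp: convergent_def)
    moreover have "(\<lambda>k. v (\<sigma> k)) \<longlonglongrightarrow> l" using LIMSEQ_subseq_LIMSEQ[OF l \<sigma>] by (simp add: o_def)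
    ultimately have "v \<longlonglongrightarrow> 0" using LIMSEQ_unique by fastforce
    \<comment> \<open>Entropy dominates half the squared distance, so its vanishing brings
      \<open>p k\<close> to the moving reference point, which itself tends to
      \<open>p_opt\<close>.\<close>
    have "(\<lambda>k. u k - p k \<omega>) \<longlonglongrightarrow> 0"
    proof (rule Lim_null_comparison)
      show "(\<lambda>k. sqrt (2 * v k)) \<longlonglongrightarrow> 0"
        using tendsto_real_sqrt[OF tendsto_mult_left[OF \<open>v \<longlonglongrightarrow> 0\<close>, of 2]] by simp
      show "\<forall>\<^sub>F k in sequentially. norm (u k - p k \<omega>) \<le> sqrt (2 * v k)"
        using eventually_ge_at_top[of n]
      proof eventually_elim
        case (elim k)
        show ?case using kl_low[OF uk[OF elim] pk[OF elim]] by (intro real_le_rsqrt) (simp add: v_def)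
      qed
    qed
    from tendsto_diff[OF u_lim this] show ?case by simp
  qed
qed

end

section \<open>Step sizes\<close>

text \<open>The terms dominate the increments of \<open>ln (ln k)\<close>, by
  \<open>ln x \<le> x - 1\<close> applied twice, and these increments telescope to an unbounded
  sequence.\<close>

lemma not_summable_inverse_mult_ln: "\<not> summable (\<lambda>k. 1 / (real k * ln (real k)))"
proof
  assume sum: "summable (\<lambda>k. 1 / (real k * ln (real k)))"
  define f where "f = (\<lambda>k. ln (ln (real k)))"
  have "summable (\<lambda>k. f (Suc k) - f k)"
  proof (rule summable_comparison_test'[OF sum, where N = 3])
    fix k :: nat assume k: "3 \<le> k"
    have l: "0 < ln (real k)" using k by simp
    have le: "ln (real k) \<le> ln (real (Suc k))" using k by simp
    have "f (Suc k) - f k = ln (ln (real (Suc k)) / ln (real k))"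
      using l le by (simp add: f_def ln_div)
    also have "\<dots> \<le> ln (real (Suc k)) / ln (real k) - 1"
      by (rule ln_le_minus_one, rule divide_pos_pos) (use l le in linarith)+
    also have "\<dots> = ln (real (Suc k) / real k) / ln (real k)"
      using k l by (simp add: ln_div diff_divide_distrib)
    also have "\<dots> \<le> (1 / real k) / ln (real k)"
    proof (intro divide_right_mono)
      have "ln (real (Suc k) / real k) \<le> real (Suc k) / real k - 1"
        by (rule ln_le_minus_one) (use k in simp)
      then show "ln (real (Suc k) / real k) \<le> 1 / real k" using k by (simp add: field_simps)
    qed (use l in simp)
    finally have "f (Suc k) - f k \<le> 1 / (real k * ln (real k))" by simp
    moreover have "f k \<le> f (Suc k)" unfolding f_def using l le by (subst ln_le_cancel_iff) linarith+
    ultimately show "norm (f (Suc k) - f k) \<le> 1 / (real k * ln (real k))" by simp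
  qed
  then have "convergent (\<lambda>n. \<Sum>k<n. f (Suc k) - f k)" by (simp add: summable_iff_convergent)
  then obtain L where "(\<lambda>n. f n - f 0) \<longlonglongrightarrow> L" by (auto simp: sum_lessThan_telescope convergent_def)
  moreover have "filterlim (\<lambda>n. f n - f 0) at_top sequentially"
    unfolding f_def by real_asymp
  ultimately show False
    using not_tendsto_and_filterlim_at_infinity[of sequentially] filterlim_at_top_imp_at_infinity by fastforce
qed

text \<open>The exponent \<open>\<sigma>\<close> is that of the weights \<open>k powr - \<sigma>\<close> in the tracking estimate; the two
  bounds on \<open>\<alpha>2\<close> are exactly what makes the admissible interval for \<open>\<sigma>\<close> nonempty.\<close>

lemma step_size_summability:
  fixes \<alpha>1 \<alpha>2 a b :: real
  assumes \<alpha>: "2 - 2 * \<alpha>1 < \<alpha>2" "\<alpha>2 < 2 * \<alpha>1 - 1" and b: "0 < b"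
    and \<gamma>: "\<And>k. 1 \<le> k \<Longrightarrow> \<gamma> k = a / real k powr \<alpha>1" and \<beta>: "\<And>k. 1 \<le> k \<Longrightarrow> \<beta> k = b / real k powr \<alpha>2"
  obtains t where "\<And>k. 1 \<le> k \<Longrightarrow> 0 < t k" "\<And>k. 1 \<le> k \<Longrightarrow> t (Suc k) \<le> t k"
    "summable (\<lambda>k. t k * (\<beta> k)\<^sup>2)" "summable (\<lambda>k. t k * ((\<gamma> k)\<^sup>2 / \<beta> k))"
    "summable (\<lambda>k. (\<gamma> k)\<^sup>2 / (t k * \<beta> k))" "summable (\<lambda>k. (\<gamma> k)\<^sup>2)"
proof -
  \<comment> \<open>Midpoint of the admissible interval. Its lower end makes the weights decrease
    and \<open>t k * (\<beta> k)\<^sup>2\<close> summable; its upper end makes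
    \<open>(\<gamma> k)\<^sup>2 / (t k * \<beta> k)\<close> summable.\<close>
  define \<sigma> where "\<sigma> = (max 0 (1 - 2 * \<alpha>2) + (2 * \<alpha>1 - 1 - \<alpha>2)) / 2"
  have \<sigma>: "0 < \<sigma>" "1 - 2 * \<alpha>2 < \<sigma>" "\<sigma> < 2 * \<alpha>1 - 1 - \<alpha>2"
    using \<alpha> by (auto simp: \<sigma>_def max_def field_simps)
  define t where "t = (\<lambda>k. real k powr (- \<sigma>))"
  have powr_sum: "summable f" if "\<And>k. 1 \<le> k \<Longrightarrow> f k = c * real k powr e" "e < -1" for f :: "nat \<Rightarrow> real" and c e
  proof (rule summable_cong[THEN iffD2])
    show "\<forall>\<^sub>F k in sequentially. f k = c * real k powr e"
      using eventually_ge_at_top[of 1] by eventually_elim (rule that(1))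
    show "summable (\<lambda>k. c * real k powr e)" using that(2) by (intro summable_mult) (simp add: summable_real_powr_iff)
  qed
  have sq: "(x powr e)\<^sup>2 = x powr (2 * e)" if "0 < x" for x e :: real
    using that by (simp add: power2_eq_square powr_add[symmetric])
  show ?thesis
  proof (rule that[of t])
    show "0 < t k" if "1 \<le> k" for k using that by (simp add: t_def)
    show "t (Suc k) \<le> t k" if "1 \<le> k" for k
      using that \<sigma>(1) unfolding t_def by (intro powr_mono2') auto
    show "summable (\<lambda>k. t k * (\<beta> k)\<^sup>2)"
      by (rule powr_sum[of _ "b\<^sup>2" "- \<sigma> - 2 * \<alpha>2"])
        (use \<sigma> in \<open>auto simp: \<beta> t_def power_divide sq powr_diff\<close>)
    show "summable (\<lambda>k. t k * ((\<gamma> k)\<^sup>2 / \<beta> k))"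
      by (rule powr_sum[of _ "a\<^sup>2 / b" "- \<sigma> + \<alpha>2 - 2 * \<alpha>1"])
        (use \<sigma> in \<open>auto simp: \<beta> \<gamma> t_def power_divide sq powr_diff powr_add powr_minus field_simps\<close>)
    show "summable (\<lambda>k. (\<gamma> k)\<^sup>2 / (t k * \<beta> k))"
      by (rule powr_sum[of _ "a\<^sup>2 / b" "\<sigma> + \<alpha>2 - 2 * \<alpha>1"])
        (use \<sigma> in \<open>auto simp: \<beta> \<gamma> t_def power_divide sq powr_diff powr_add powr_minus field_simps\<close>)
    \<comment> \<open>The two bounds on \<alpha>2 are compatible only for \<alpha>1 above 3/4, so
      \<alpha>1 exceeds 1/2.\<close>
    show "summable (\<lambda>k. (\<gamma> k)\<^sup>2)"
      by (rule powr_sum[of _ "a\<^sup>2" "- 2 * \<alpha>1"])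
        (use \<alpha> in \<open>auto simp: \<gamma> power_divide sq powr_minus field_simps\<close>)
  qed
qed

text \<open>The penalty must vanish slowly enough for the objective to be felt:
  \<open>\<gamma> k * lam k\<close> decays like \<open>k powr - (\<alpha>1 + \<alpha>3)\<close> with
  exponent sum at most 1, or like \<open>1 / (k * ln k)\<close>. Monotonicity starts at 2 because
  \<open>lam 1\<close> is arbitrary in the logarithmic case.\<close>

lemma penalty_parameter_properties:
  fixes \<alpha>1 \<alpha>3 a c :: real
  assumes \<alpha>1: "3 / 4 < \<alpha>1" "\<alpha>1 \<le> 1" and a: "0 < a" and c: "0 < c"
    and \<gamma>: "\<And>k. 1 \<le> k \<Longrightarrow> \<gamma> k = a / real k powr \<alpha>1"
    and lam_poly: "\<alpha>1 < 1 \<Longrightarrow> 0 < \<alpha>3 \<and> \<alpha>3 \<le> 1 - \<alpha>1 \<and> (\<forall>k\<ge>1. lam k = c / real k powr \<alpha>3)"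
    and lam_log: "\<alpha>1 = 1 \<Longrightarrow> 0 < lam 1 \<and> (\<forall>k\<ge>2. lam k = c / ln (real k))"
  shows "\<And>k. 1 \<le> k \<Longrightarrow> 0 < lam k" and "\<And>k. 2 \<le> k \<Longrightarrow> lam (Suc k) < lam k"
    and "lam \<longlonglongrightarrow> 0" and "\<not> summable (\<lambda>k. \<gamma> k * lam k)"
proof -
  have cases: "(\<forall>k\<ge>1. 0 < lam k) \<and> (\<forall>k\<ge>2. lam (Suc k) < lam k) \<and> lam \<longlonglongrightarrow> 0 \<and> \<not> summable (\<lambda>k. \<gamma> k * lam k)"
  proof (cases "\<alpha>1 < 1")
    case True
    then have \<alpha>3: "0 < \<alpha>3" "\<alpha>3 \<le> 1 - \<alpha>1" and lam: "\<And>k. 1 \<le> k \<Longrightarrow> lam k = c / real k powr \<alpha>3"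
      using lam_poly by auto
    have "lam (Suc k) < lam k" if "2 \<le> k" for k
      using that c \<alpha>3 powr_less_mono2[of \<alpha>3 "real k" "real (Suc k)"]
      by (simp add: lam divide_strict_left_mono)
    moreover have "lam \<longlonglongrightarrow> 0"
    proof (rule Lim_transform_eventually)
      show "(\<lambda>k. c / real k powr \<alpha>3) \<longlonglongrightarrow> 0" using \<alpha>3(1) by real_asymp
      show "\<forall>\<^sub>F k in sequentially. c / real k powr \<alpha>3 = lam k"
        using eventually_ge_at_top[of 1] by eventually_elim (simp add: lam)
    qed
    moreover have "\<not> summable (\<lambda>k. \<gamma> k * lam k)"
    proof
      assume "summable (\<lambda>k. \<gamma> k * lam k)"
      moreover have "\<forall>\<^sub>F k in sequentially. \<gamma> k * lam k = (a * c) * real k powr (- (\<alpha>1 + \<alpha>3))"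
        using eventually_ge_at_top[of 1]
        by eventually_elim (simp add: \<gamma> lam powr_minus powr_diff divide_inverse mult_ac)
      ultimately have "summable (\<lambda>k. (a * c) * real k powr (- (\<alpha>1 + \<alpha>3)))"
        by (simp only: summable_cong)
      then have "summable (\<lambda>k. real k powr (- (\<alpha>1 + \<alpha>3)))"
        using a c by (simp add: summable_cmult_iff)
      then show False using \<alpha>3 by (simp add: summable_real_powr_iff)
    qed
    ultimately show ?thesis using lam c by simp
  next
    case False
    then have one: "\<alpha>1 = 1" using \<alpha>1 by simp
    then have lam1: "0 < lam 1" and lam: "\<And>k. 2 \<le> k \<Longrightarrow> lam k = c / ln (real k)" using lam_log by auto
    have "0 < lam k" if "1 \<le> k" for k using lam1 lam[of k] c that by (cases "k = 1") auto
    moreover have "lam (Suc k) < lam k" if "2 \<le> k" for k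
      using that c by (simp add: lam divide_strict_left_mono)
    moreover have "lam \<longlonglongrightarrow> 0"
    proof (rule Lim_transform_eventually)
      show "(\<lambda>k. c / ln (real k)) \<longlonglongrightarrow> 0" by real_asymp
      show "\<forall>\<^sub>F k in sequentially. c / ln (real k) = lam k"
        using eventually_ge_at_top[of 2] by eventually_elim (simp add: lam)
    qed
    moreover have "\<not> summable (\<lambda>k. \<gamma> k * lam k)"
    proof
      assume "summable (\<lambda>k. \<gamma> k * lam k)"
      moreover have "\<forall>\<^sub>F k in sequentially. \<gamma> k * lam k = (a * c) * (1 / (real k * ln (real k)))"
        using eventually_ge_at_top[of 2] by eventually_elim (simp add: \<gamma> lam one)
      ultimately have "summable (\<lambda>k. (a * c) * (1 / (real k * ln (real k))))"
        by (simp only: summable_cong)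
      then have "summable (\<lambda>k. 1 / (real k * ln (real k)))"
        using a c by (simp only: summable_cmult_iff mult_eq_0_iff) auto
      then show False using not_summable_inverse_mult_ln by simp
    qed
    ultimately show ?thesis by simp
  qed
  then show "\<And>k. 1 \<le> k \<Longrightarrow> 0 < lam k" "\<And>k. 2 \<le> k \<Longrightarrow> lam (Suc k) < lam k"
    "lam \<longlonglongrightarrow> 0" "\<not> summable (\<lambda>k. \<gamma> k * lam k)" by blast+
qed

section \<open>Convergence\<close>

theorem theorem4:
  fixes z :: "'m::finite \<Rightarrow> 'x"
    and h :: "('t::finite \<Rightarrow> 'x) \<Rightarrow> real"
    and g :: "('s::finite \<Rightarrow> 'x) \<Rightarrow> real"
    and y :: "real ^ 'n::finite"
    and q \<epsilon> :: real
    and N :: "real ^ 'm \<Rightarrow> real"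
    and p_opt :: "real ^ 'm"
    and p_pen :: "real \<Rightarrow> real ^ 'm"
    and lam_max M_var :: real
    and \<alpha>1 \<alpha>2 \<alpha>3 a b c :: real
    and \<gamma> \<beta> lam :: "nat \<Rightarrow> real"
    and M1 M2 M3 :: nat
    and M :: "'w measure"
    and F :: "nat \<Rightarrow> 'w measure"
    and p1 :: "real ^ 'm"
    and s1 :: "real ^ 'n"
    and p :: "nat \<Rightarrow> 'w \<Rightarrow> real ^ 'm"
    and s :: "nat \<Rightarrow> 'w \<Rightarrow> real ^ 'n"
    and X X' :: "nat \<Rightarrow> nat \<Rightarrow> 'w \<Rightarrow> 't \<Rightarrow> 'x"
    and X'' :: "nat \<Rightarrow> nat \<Rightarrow> 'w \<Rightarrow> 's \<Rightarrow> 'x"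
  assumes support: "inj z"
    and q_pos: "0 < q"
    and bands: "\<And>j. lower_bd y q j \<le> upper_bd y q j"
    and eps_pos: "0 < \<epsilon>" and eps_lt: "\<epsilon> < 1 / real CARD('m)"
    and norm: "is_norm N"
    and R_opt: "unique_min_on (psi z g) (feasible_set z h y q \<epsilon>) p_opt"
    and R_objective: "\<And>v. v \<in> feasible_set z h y q \<epsilon> \<Longrightarrow> v \<noteq> p_opt \<Longrightarrow>
           gateaux (psi z g) v \<bullet> (v - p_opt) > 0"
    and R_penalty: "\<And>v. v \<in> prob_simplex_ge \<epsilon> \<Longrightarrow> v \<notin> feasible_set z h y q \<epsilon> \<Longrightarrow>
           gateaux (penalty z h y q) v \<bullet> (v - p_opt) > 0"
    and lam_max_pos: "0 < lam_max"
    and Pen_opt: "\<And>l. 0 < l \<Longrightarrow> l \<le> lam_max \<Longrightarrow>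
           unique_min_on (\<lambda>v. l * psi z g v + penalty z h y q v) (prob_simplex_ge \<epsilon>) (p_pen l)"
    and Pen_gradient: "\<And>l v. 0 < l \<Longrightarrow> l \<le> lam_max \<Longrightarrow> v \<in> prob_simplex_ge \<epsilon> \<Longrightarrow>
           (l *\<^sub>R gateaux (psi z g) v + gateaux (penalty z h y q) v) \<bullet> (v - p_pen l) \<ge> 0"
    and M_var_pos: "0 < M_var"
    and Pen_variation: "\<And>(K::nat) (l::nat \<Rightarrow> real). 0 < l K \<Longrightarrow> (\<forall>i<K. l (Suc i) < l i) \<Longrightarrow> l 0 \<le> lam_max \<Longrightarrow>
           (\<Sum>i<K. N (p_pen (l i) - p_pen (l (Suc i)))) \<le> M_var"
    and Pen_rate: "(\<lambda>l. N (p_pen l - p_opt)) \<in> O[at_right 0](\<lambda>l. l)"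
    and a_pos: "0 < a" and b_pos: "0 < b" and c_pos: "0 < c"
    and alpha1_gt: "3 / 4 < \<alpha>1" and alpha1_le: "\<alpha>1 \<le> 1"
    and alpha2_gt: "2 - 2 * \<alpha>1 < \<alpha>2" and alpha2_lt: "\<alpha>2 < 2 * \<alpha>1 - 1"
    and gamma: "\<And>k. 1 \<le> k \<Longrightarrow> \<gamma> k = a / real k powr \<alpha>1"
    and beta: "\<And>k. 1 \<le> k \<Longrightarrow> \<beta> k = b / real k powr \<alpha>2"
    and lam_poly: "\<alpha>1 < 1 \<Longrightarrow> 0 < \<alpha>3 \<and> \<alpha>3 \<le> 1 - \<alpha>1 \<and> (\<forall>k\<ge>1. lam k = c / real k powr \<alpha>3)"
    and lam_log: "\<alpha>1 = 1 \<Longrightarrow> 0 < lam 1 \<and> (\<forall>k\<ge>2. lam k = c / ln (real k))"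
    and M1_pos: "0 < M1" and M2_pos: "0 < M2" and M3_pos: "0 < M3"
    and p1_in: "p1 \<in> prob_simplex_ge \<epsilon>"
    and s1_in: "\<And>j. s1 $ j \<in> {lower_bd y q j .. upper_bd y q j}"
    and prob_space: "prob_space M"
    and filtration: "filtration (space M) F"
    and subalgebra: "\<And>k. subalgebra M (F k)"
    and p_adapted: "\<And>k. 1 \<le> k \<Longrightarrow> p k \<in> borel_measurable (F k)"
    and s_adapted: "\<And>k. 1 \<le> k \<Longrightarrow> s k \<in> borel_measurable (F k)"
    and X_adapted: "\<And>k r. 1 \<le> k \<Longrightarrow> r < M1 \<Longrightarrow> X k r \<in> F (Suc k) \<rightarrow>\<^sub>M count_space UNIV"
    and X'_adapted: "\<And>k r. 1 \<le> k \<Longrightarrow> r < M2 \<Longrightarrow> X' k r \<in> F (Suc k) \<rightarrow>\<^sub>M count_space UNIV"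
    and X''_adapted: "\<And>k r. 1 \<le> k \<Longrightarrow> r < M3 \<Longrightarrow> X'' k r \<in> F (Suc k) \<rightarrow>\<^sub>M count_space UNIV"
    and sampling_law: "\<And>k x x' x''. 1 \<le> k \<Longrightarrow>
           AE \<omega> in M.
             real_cond_exp M (F k)
               (indicator {\<omega> \<in> space M. (\<forall>r<M1. X k r \<omega> = x r) \<and> (\<forall>r<M2. X' k r \<omega> = x' r) \<and>
                                       (\<forall>r<M3. X'' k r \<omega> = x'' r)}) \<omega> =
             (\<Prod>r<M1. pmf (process_pmf z (p k \<omega>)) (x r)) *
             (\<Prod>r<M2. pmf (process_pmf z (p k \<omega>)) (x' r)) *
             (\<Prod>r<M3. pmf (process_pmf z (p k \<omega>)) (x'' r))"
    and p_init: "\<And>\<omega>. \<omega> \<in> space M \<Longrightarrow> p 1 \<omega> = p1"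
    and s_init: "\<And>\<omega>. \<omega> \<in> space M \<Longrightarrow> s 1 \<omega> = s1"
    and p_step: "\<And>k \<omega>. 1 \<le> k \<Longrightarrow> \<omega> \<in> space M \<Longrightarrow>
           is_arg_min
             (mirror_objective (\<gamma> k)
                (lam k *\<^sub>R Psi_hat z g M3 (p k \<omega>) (\<lambda>r. X'' k r \<omega>) +
                 phi_p_hat z h y M1 M2 (p k \<omega>) (s k \<omega>) (\<lambda>r. X k r \<omega>) (\<lambda>r. X' k r \<omega>))
                (p k \<omega>))
             (\<lambda>v. v \<in> prob_simplex_ge \<epsilon>) (p (Suc k) \<omega>)"
    and s_step: "\<And>k \<omega> j. 1 \<le> k \<Longrightarrow> \<omega> \<in> space M \<Longrightarrow>
           s (Suc k) \<omega> $ j =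
             band_proj y q j
               (s k \<omega> $ j -
                \<beta> k * phi_s_hat h y M1 M2 (s k \<omega>) (\<lambda>r. X k r \<omega>) (\<lambda>r. X' k r \<omega>) $ j)"
  shows "AE \<omega> in M. (\<lambda>k. p k \<omega>) \<longlonglongrightarrow> p_opt"
proof -
  have lam_props: "\<And>k. 1 \<le> k \<Longrightarrow> 0 < lam k" "\<And>k. 2 \<le> k \<Longrightarrow> lam (Suc k) < lam k"
    "lam \<longlonglongrightarrow> 0" "\<not> summable (\<lambda>k. \<gamma> k * lam k)"
    using penalty_parameter_properties[OF alpha1_gt alpha1_le a_pos c_pos gamma lam_poly lam_log] by blast+
  have alpha2_pos: "0 < \<alpha>2" using alpha1_le alpha2_gt by simp
  interpret sampled_mirror_descent M z h g y q \<epsilon> \<gamma> \<beta> lam M1 M2 M3 F p s X X' X''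
  proof (rule sampled_mirror_descent.intro[OF prob_space sampled_mirror_descent_axioms.intro])
    show "0 \<le> \<gamma> k" if "1 \<le> k" for k using a_pos by (simp add: gamma[OF that])
    show "p 1 \<omega> \<in> prob_simplex_ge \<epsilon>" if "\<omega> \<in> space M" for \<omega> using p_init[OF that] p1_in by simp
    show "s 1 \<omega> $ j \<in> {lower_bd y q j .. upper_bd y q j}" if "\<omega> \<in> space M" for \<omega> j
      using s_init[OF that] s1_in by simp
  qed (fact support bands eps_pos M1_pos M2_pos M3_pos filtration subalgebra p_adapted s_adapted
    X_adapted X'_adapted X''_adapted sampling_law p_step s_step)+
  have beta_pos: "0 < \<beta> k" if "1 \<le> k" for k using b_pos that by (simp add: beta)
  have beta_le: "\<beta> k \<le> b" if "1 \<le> k" for k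
  proof -
    have "1 \<le> real k powr \<alpha>2" using that alpha2_pos by (intro ge_one_powr_ge_zero) auto
    then show ?thesis using b_pos by (simp add: beta[OF that] divide_le_eq)
  qed
  obtain t where t: "\<And>k. 1 \<le> k \<Longrightarrow> 0 < t k" "\<And>k. 1 \<le> k \<Longrightarrow> t (Suc k) \<le> t k"
    "summable (\<lambda>k. t k * (\<beta> k)\<^sup>2)" "summable (\<lambda>k. t k * ((\<gamma> k)\<^sup>2 / \<beta> k))"
    "summable (\<lambda>k. (\<gamma> k)\<^sup>2 / (t k * \<beta> k))" "summable (\<lambda>k. (\<gamma> k)\<^sup>2)"
    by (rule step_size_summability[OF alpha2_gt alpha2_lt b_pos gamma beta]) blast+
  obtain CN where CN: "0 < CN" "\<And>x. norm x \<le> CN * N x" by (rule is_norm_norm_le[OF norm]) blast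
  \<comment> \<open>The rate assumption is one-sided at 0, so positivity of \<open>lam\<close> is
    needed to pull it back along the sequence.\<close>
  have lam_right: "filterlim lam (at_right 0) sequentially"
    by (rule tendsto_imp_filterlim_at_right[OF lam_props(3) eventually_mono[OF eventually_ge_at_top[of 1] lam_props(1)]])
  obtain K where K: "\<forall>\<^sub>F l in at_right 0. norm (N (p_pen l - p_opt)) \<le> K * norm l"
    by (rule landau_o.bigE[OF Pen_rate])
  have "\<forall>\<^sub>F k in sequentially. lam k \<le> lam_max \<and> norm (N (p_pen (lam k) - p_opt)) \<le> K * norm (lam k) \<and> 2 \<le> k"
    using order_tendstoD(2)[OF lam_props(3) lam_max_pos] eventually_compose_filterlim[OF K lam_right] eventually_ge_at_top[of 2]
    by eventually_elim simp
  \<comment> \<open>Besides entering the range of the penalized program, \<open>n\<close> is at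
    least 2, from where on \<open>lam\<close> decreases strictly as the variation bound
    requires.\<close>
  then obtain n where n: "\<And>k. n \<le> k \<Longrightarrow> lam k \<le> lam_max"
    "\<And>k. n \<le> k \<Longrightarrow> norm (N (p_pen (lam k) - p_opt)) \<le> K * norm (lam k)" "2 \<le> n"
    unfolding eventually_at_top_linorder by blast
  define u where "u = (\<lambda>k. p_pen (min (lam k) lam_max))"
  have u_eq: "u k = p_pen (lam k)" if "n \<le> k" for k using n(1)[OF that] by (simp add: u_def)
  have u_mem: "u k \<in> prob_simplex_ge \<epsilon>" if "1 \<le> k" for k
    using Pen_opt[of "min (lam k) lam_max"] lam_props(1)[OF that] lam_max_pos
    by (simp add: u_def unique_min_on_def is_arg_min_def)
  have du: "summable (\<lambda>k. norm (u (Suc k) - u k))"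
  proof -
    have "summable (\<lambda>i. norm (u (Suc (i + n)) - u (i + n)))"
    proof (rule summableI_nonneg_bounded)
      fix m
      have "(\<Sum>i<m. norm (u (Suc (i + n)) - u (i + n))) \<le>
          (\<Sum>i<m. CN * N (p_pen (lam (i + n)) - p_pen (lam (Suc i + n))))"
        by (intro sum_mono) (simp add: u_eq norm_minus_commute[of "p_pen (lam (Suc _))"] CN(2))
      also have "\<dots> = CN * (\<Sum>i<m. N (p_pen (lam (i + n)) - p_pen (lam (Suc i + n))))"
        by (simp only: sum_distrib_left)
      \<comment> \<open>The variation bound is uniform in the length of the chain, so it bounds all
        partial sums of the drift from index \<open>n\<close> on.\<close>
      also have "\<dots> \<le> CN * M_var"
        using CN(1) n(1,3) lam_props(1,2)
        by (intro mult_left_mono Pen_variation[of "\<lambda>i. lam (i + n)"]) auto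
      finally show "(\<Sum>i<m. norm (u (Suc (i + n)) - u (i + n))) \<le> CN * M_var" .
    qed simp
    then show ?thesis by (rule summable_iff_shift[of "\<lambda>k. norm (u (Suc k) - u k)" n, THEN iffD1])
  qed
  show ?thesis
  proof (rule iterates_converge[OF beta_pos beta_le lam_props(1,3) t lam_props(4) u_mem du])
    show "1 \<le> n" using n(3) by simp
    show "norm (u k - p_opt) \<le> CN * K * lam k" if k: "n \<le> k" for k
    proof -
      have l: "0 < lam k" using lam_props(1) n(3) k by simp
      have "norm (u k - p_opt) \<le> CN * N (p_pen (lam k) - p_opt)" unfolding u_eq[OF k] by (rule CN(2))
      also have "\<dots> \<le> CN * (K * lam k)"
        using n(2)[OF k] l CN(1) by (intro mult_left_mono) auto
      finally show ?thesis by (simp add: mult.assoc)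
    qed
    show "(lam k *\<^sub>R gateaux (psi z g) v + gateaux (penalty z h y q) v) \<bullet> (v - u k) \<ge> 0"
      if k: "n \<le> k" and v: "v \<in> prob_simplex_ge \<epsilon>" for k v
      unfolding u_eq[OF k] using lam_props(1)[of k] n(1,3) k by (intro Pen_gradient v) auto
    show "p_opt \<in> prob_simplex_ge \<epsilon>"
      using R_opt by (simp add: unique_min_on_def is_arg_min_def feasible_set_def)
  qed (assumption | fact R_objective R_penalty)+
qed

end
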